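(* Let $\mathcal{C}$ be a pivotal finite tensor category and let $\mathcal{M}$ be a pivotal exact left $\mathcal{C}$-module category. The internal character is additive in exact sequences: for any exact sequence $0\to M_1\to M_2\to M_3\to 0$ in $\mathcal{M}$, $$\mathrm{ch}_{\mathcal{M}}(M_2)=\mathrm{ch}_{\mathcal{M}}(M_1)+\mathrm{ch}_{\mathcal{M}}(M_3).$$
   Context: $k$ is an algebraically closed field. A finite abelian category is a $k$-linear category equivalent to finite-dimensional left modules over a finite-dimensional $k$-algebra. A finite tensor category is a rigid monoidal category $\mathcal{C}$ that is finite abelian, with $k$-linear tensor product in each variable and simple unit $\mathbf{1}$. A finite left $\mathcal{C}$-module category is a left $\mathcal{C}$-module category that is finite abelian with action $\otimes$ $k$-linear and right exact in each variable; it is exact if $P\otimes M$ is projective for all projective $P\in\mathcal{C}$ and all $M$. Associativity constraints are suppressed. $(X^*,\mathrm{ev}_X,\mathrm{coev}_X:\mathbf{1}\to X\otimes X^* )$ is the left dual of $X$. Write $[M,N]=\underline{\mathrm{Hom}}(M,N)$: $[M,-]$ is right adjoint to $X\mapsto X\otimes M$, with unit $\underline{\mathrm{coev}}_{X,M}$ and counit $\underline{\mathrm{ev}}_{M,N}$. Let $\mathfrak{a}_{X,M,N}:X\otimes[M,N]\to[M,X\otimes N]$ correspond to $\mathrm{id}_X\otimes\underline{\mathrm{ev}}_{M,N}$, let $\mathfrak{b}^{\natural}_{Y,M,N}:[Y\otimes M,N]\otimes Y\to[M,N]$ correspond to $\underline{\mathrm{ev}}_{Y\otimes M,N}$, let $\mathfrak{b}_{Y,M,N}=(\mathfrak{b}^{\natural}_{Y,M,N}\otimes\mathrm{id}_{Y^*})\circ(\mathrm{id}\otimes\mathrm{coev}_Y):[Y\otimes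 M,N]\to[M,N]\otimes Y^*$, and $\mathfrak{c}_{X,M,N,Y}=\mathfrak{b}_{Y,M,X\otimes N}^{-1}\circ(\mathfrak{a}_{X,M,N}\otimes\mathrm{id}_{Y^*}):X\otimes[M,N]\otimes Y^*\to[Y\otimes M,X\otimes N]$ (all but $\mathfrak{b}^\natural$ are isomorphisms). $A_{\mathcal{M}}=\int_{M\in\mathcal{M}}[M,M]$ is the end (which exists) with universal dinatural transformation $\pi_{\mathcal{M}}(M):A_{\mathcal{M}}\to[M,M]$, and $\mathrm{CF}(\mathcal{M})=\mathrm{Hom}_{\mathcal{C}}(A_{\mathcal{M}},\mathbf{1})$. A pivotal structure of $\mathcal{C}$ is a monoidal natural isomorphism $j_X:X\to X^{**}$. For exact $\mathcal{M}$, the relative Serre functor $\mathbb{S}=\mathbb{S}_{\mathcal{M}}:\mathcal{M}\to\mathcal{M}$ is the (unique) functor with a natural isomorphism $\mathfrak{d}_{M,N}:[M,N]^*\to[N,\mathbb{S}(M)]$. There is a unique natural isomorphism $\zeta_{X,M}:X^{**}\otimes\mathbb{S}(M)\to\mathbb{S}(X\otimes M)$ making $\mathbb{S}$ a $\mathcal{C}$-module functor from $\mathcal{M}$ to $\mathcal{M}$ with action twisted by $(-)^{**}$, such that $\mathfrak{d}_{Y\otimes M,X\otimes N}\circ(\mathfrak{c}_{X,M,N,Y}^* )^{-1}=[\mathrm{id}_{X\otimes N},\zeta_{Y,M}]\circ\mathfrak{c}_{Y^{**},N,\mathbb{S}(M),X}\circ(\mathrm{id}_{Y^{**}}\otimes\mathfrak{d}_{M,N}\otimes\mathrm{id}_{X^*})$.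 A pivotal structure of $\mathcal{M}$ is a natural isomorphism $j':\mathrm{id}_{\mathcal{M}}\to\mathbb{S}$ with $j'_{X\otimes M}=\zeta_{X,M}\circ(j_X\otimes j'_M)$; a pivotal left $\mathcal{C}$-module category is an exact one equipped with a pivotal structure. The trace $\mathrm{tr}_{\mathcal{M}}(M):[M,M]\to\mathbf{1}$ is the morphism with $\mathfrak{d}_{M,M}\circ\mathrm{tr}_{\mathcal{M}}(M)^*=[\mathrm{id}_M,j'_M]\circ\underline{\mathrm{coev}}_{\mathbf{1},M}$, and the internal character of $M$ is $\mathrm{ch}_{\mathcal{M}}(M)=\mathrm{tr}_{\mathcal{M}}(M)\circ\pi_{\mathcal{M}}(M)\in\mathrm{CF}(\mathcal{M})$. *)

theory Defs
  imports "Jordan_Normal_Form.Matrix" "HOL-Computational_Algebra.Polynomial"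
begin

section \<open>Linear categories\<close>

text \<open>
  Composition, addition etc. are total operations on the type of arrows and are only meaningful on
  matching arrows. Composition is written in the usual order: \<open>g \<cdot> f\<close> means \<open>g\<close> after \<open>f\<close>.
\<close>

record ('o, 'a, 'k) lin_cat =
  Obj :: "'o set"
  Arr :: "'a set"
  Src :: "'a \<Rightarrow> 'o"
  Tgt :: "'a \<Rightarrow> 'o"
  Idn :: "'o \<Rightarrow> 'a"
  Comp :: "'a \<Rightarrow> 'a \<Rightarrow> 'a"  (infixr "\<cdot>\<index>" 70)
  Plus :: "'a \<Rightarrow> 'a \<Rightarrow> 'a"  (infixl "\<^bold>+\<index>" 65)
  Zero :: "'o \<Rightarrow> 'o \<Rightarrow> 'a"
  Scale :: "'k \<Rightarrow> 'a \<Rightarrow> 'a"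

definition Hom :: "('o, 'a, 'k, 'e) lin_cat_scheme \<Rightarrow> 'o \<Rightarrow> 'o \<Rightarrow> 'a set" where
  "Hom C X Y = {f \<in> Arr C. Src C f = X \<and> Tgt C f = Y}"

locale linear_category =
  fixes C :: "('o, 'a, 'k::field, 'e) lin_cat_scheme" (structure)
  assumes src_obj: "f \<in> Arr C \<Longrightarrow> Src C f \<in> Obj C"
    and tgt_obj: "f \<in> Arr C \<Longrightarrow> Tgt C f \<in> Obj C"
    and idn_hom: "X \<in> Obj C \<Longrightarrow> Idn C X \<in> Hom C X X"
    and comp_hom: "\<lbrakk>f \<in> Hom C X Y; g \<in> Hom C Y Z\<rbrakk> \<Longrightarrow> g \<cdot> f \<in> Hom C X Z"
    and idn_left: "f \<in> Hom C X Y \<Longrightarrow> Idn C Y \<cdot> f = f"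
    and idn_right: "f \<in> Hom C X Y \<Longrightarrow> f \<cdot> Idn C X = f"
    and comp_assoc:
      "\<lbrakk>f \<in> Hom C W X; g \<in> Hom C X Y; h \<in> Hom C Y Z\<rbrakk> \<Longrightarrow> (h \<cdot> g) \<cdot> f = h \<cdot> (g \<cdot> f)"
    and zero_hom: "\<lbrakk>X \<in> Obj C; Y \<in> Obj C\<rbrakk> \<Longrightarrow> Zero C X Y \<in> Hom C X Y"
    and plus_hom: "\<lbrakk>f \<in> Hom C X Y; g \<in> Hom C X Y\<rbrakk> \<Longrightarrow> f \<^bold>+ g \<in> Hom C X Y"
    and plus_assoc:
      "\<lbrakk>f \<in> Hom C X Y; g \<in> Hom C X Y; h \<in> Hom C X Y\<rbrakk> \<Longrightarrow> (f \<^bold>+ g) \<^bold>+ h = f \<^bold>+ (g \<^bold>+ h)"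
    and plus_commute: "\<lbrakk>f \<in> Hom C X Y; g \<in> Hom C X Y\<rbrakk> \<Longrightarrow> f \<^bold>+ g = g \<^bold>+ f"
    and plus_zero: "f \<in> Hom C X Y \<Longrightarrow> f \<^bold>+ Zero C X Y = f"
    and plus_inverse: "f \<in> Hom C X Y \<Longrightarrow> \<exists>g \<in> Hom C X Y. f \<^bold>+ g = Zero C X Y"
    and scale_hom: "f \<in> Hom C X Y \<Longrightarrow> Scale C c f \<in> Hom C X Y"
    and scale_plus: "\<lbrakk>f \<in> Hom C X Y; g \<in> Hom C X Y\<rbrakk>
      \<Longrightarrow> Scale C c (f \<^bold>+ g) = Scale C c f \<^bold>+ Scale C c g"
    and scale_add: "f \<in> Hom C X Y \<Longrightarrow> Scale C (c + d) f = Scale C c f \<^bold>+ Scale C d f"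
    and scale_mult: "f \<in> Hom C X Y \<Longrightarrow> Scale C (c * d) f = Scale C c (Scale C d f)"
    and scale_one: "f \<in> Hom C X Y \<Longrightarrow> Scale C 1 f = f"
    and comp_plus_right: "\<lbrakk>f \<in> Hom C X Y; f' \<in> Hom C X Y; g \<in> Hom C Y Z\<rbrakk>
      \<Longrightarrow> g \<cdot> (f \<^bold>+ f') = g \<cdot> f \<^bold>+ g \<cdot> f'"
    and comp_plus_left: "\<lbrakk>f \<in> Hom C X Y; g \<in> Hom C Y Z; g' \<in> Hom C Y Z\<rbrakk>
      \<Longrightarrow> (g \<^bold>+ g') \<cdot> f = g \<cdot> f \<^bold>+ g' \<cdot> f"
    and comp_scale_right: "\<lbrakk>f \<in> Hom C X Y; g \<in> Hom C Y Z\<rbrakk>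
      \<Longrightarrow> g \<cdot> Scale C c f = Scale C c (g \<cdot> f)"
    and comp_scale_left: "\<lbrakk>f \<in> Hom C X Y; g \<in> Hom C Y Z\<rbrakk>
      \<Longrightarrow> Scale C c g \<cdot> f = Scale C c (g \<cdot> f)"

context
  fixes C :: "('o, 'a, 'k, 'e) lin_cat_scheme" (structure)
begin

definition is_inverse :: "'a \<Rightarrow> 'a \<Rightarrow> bool" where
  "is_inverse f g \<longleftrightarrow> f \<in> Arr C \<and> g \<in> Hom C (Tgt C f) (Src C f) \<and>
     g \<cdot> f = Idn C (Src C f) \<and> f \<cdot> g = Idn C (Tgt C f)"

definition is_iso :: "'a \<Rightarrow> bool" where
  "is_iso f \<longleftrightarrow> (\<exists>g. is_inverse f g)"

definition Inv :: "'a \<Rightarrow> 'a" where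
  "Inv f = (THE g. is_inverse f g)"

definition is_mono :: "'a \<Rightarrow> bool" where
  "is_mono f \<longleftrightarrow> f \<in> Arr C \<and>
     (\<forall>W\<in>Obj C. \<forall>u\<in>Hom C W (Src C f). \<forall>v\<in>Hom C W (Src C f). f \<cdot> u = f \<cdot> v \<longrightarrow> u = v)"

definition is_epi :: "'a \<Rightarrow> bool" where
  "is_epi f \<longleftrightarrow> f \<in> Arr C \<and>
     (\<forall>W\<in>Obj C. \<forall>u\<in>Hom C (Tgt C f) W. \<forall>v\<in>Hom C (Tgt C f) W. u \<cdot> f = v \<cdot> f \<longrightarrow> u = v)"

definition is_zero_obj :: "'o \<Rightarrow> bool" where
  "is_zero_obj X \<longleftrightarrow> X \<in> Obj C \<and>
     (\<forall>Y\<in>Obj C. (\<exists>!f. f \<in> Hom C X Y) \<and> (\<exists>!f. f \<in> Hom C Y X))"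

definition is_simple :: "'o \<Rightarrow> bool" where
  "is_simple X \<longleftrightarrow> X \<in> Obj C \<and> \<not> is_zero_obj X \<and>
     (\<forall>f\<in>Arr C. Tgt C f = X \<longrightarrow> is_mono f \<longrightarrow> is_zero_obj (Src C f) \<or> is_iso f)"

definition is_projective :: "'o \<Rightarrow> bool" where
  "is_projective P \<longleftrightarrow> P \<in> Obj C \<and>
     (\<forall>X\<in>Obj C. \<forall>Y\<in>Obj C. \<forall>e\<in>Hom C X Y. \<forall>f\<in>Hom C P Y.
        is_epi e \<longrightarrow> (\<exists>g\<in>Hom C P X. e \<cdot> g = f))"

definition is_kernel :: "'a \<Rightarrow> 'a \<Rightarrow> bool" where
  "is_kernel g f \<longleftrightarrow> f \<in> Arr C \<and> g \<in> Arr C \<and> Tgt C f = Src C g \<and>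
     g \<cdot> f = Zero C (Src C f) (Tgt C g) \<and>
     (\<forall>W\<in>Obj C. \<forall>h\<in>Hom C W (Src C g). g \<cdot> h = Zero C W (Tgt C g) \<longrightarrow>
        (\<exists>!u. u \<in> Hom C W (Src C f) \<and> f \<cdot> u = h))"

definition is_cokernel :: "'a \<Rightarrow> 'a \<Rightarrow> bool" where
  "is_cokernel f g \<longleftrightarrow> f \<in> Arr C \<and> g \<in> Arr C \<and> Tgt C f = Src C g \<and>
     g \<cdot> f = Zero C (Src C f) (Tgt C g) \<and>
     (\<forall>W\<in>Obj C. \<forall>h\<in>Hom C (Tgt C f) W. h \<cdot> f = Zero C (Src C f) W \<longrightarrow>
        (\<exists>!u. u \<in> Hom C (Tgt C g) W \<and> u \<cdot> g = h))"

text \<open>Short exactness of \<open>0 \<longrightarrow> M\<^sub>1 \<longrightarrow> M\<^sub>2 \<longrightarrow> M\<^sub>3 \<longrightarrow> 0\<close> with maps \<open>f\<close> and \<open>g\<close>.\<close>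

definition short_exact :: "'o \<Rightarrow> 'a \<Rightarrow> 'o \<Rightarrow> 'a \<Rightarrow> 'o \<Rightarrow> bool" where
  "short_exact M\<^sub>1 f M\<^sub>2 g M\<^sub>3 \<longleftrightarrow>
     f \<in> Hom C M\<^sub>1 M\<^sub>2 \<and> g \<in> Hom C M\<^sub>2 M\<^sub>3 \<and> is_kernel g f \<and> is_cokernel f g"

end


section \<open>Functors, natural isomorphisms, equivalences\<close>

record ('o, 'a, 'p, 'b) fctr =
  FObj :: "'o \<Rightarrow> 'p"
  FArr :: "'a \<Rightarrow> 'b"

definition is_functor ::
  "('o, 'a, 'k, 'e) lin_cat_scheme \<Rightarrow> ('p, 'b, 'k, 'f) lin_cat_scheme \<Rightarrow>
   ('o, 'a, 'p, 'b) fctr \<Rightarrow> bool" where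
  "is_functor C D F \<longleftrightarrow>
     (\<forall>X\<in>Obj C. FObj F X \<in> Obj D) \<and>
     (\<forall>f\<in>Arr C. FArr F f \<in> Hom D (FObj F (Src C f)) (FObj F (Tgt C f))) \<and>
     (\<forall>X\<in>Obj C. FArr F (Idn C X) = Idn D (FObj F X)) \<and>
     (\<forall>f\<in>Arr C. \<forall>g\<in>Arr C. Tgt C f = Src C g \<longrightarrow>
        FArr F (g \<cdot>\<^bsub>C\<^esub> f) = FArr F g \<cdot>\<^bsub>D\<^esub> FArr F f)"

definition is_linear_functor ::
  "('o, 'a, 'k, 'e) lin_cat_scheme \<Rightarrow> ('p, 'b, 'k, 'f) lin_cat_scheme \<Rightarrow>
   ('o, 'a, 'p, 'b) fctr \<Rightarrow> bool" where
  "is_linear_functor C D F \<longleftrightarrow> is_functor C D F \<and>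
     (\<forall>X\<in>Obj C. \<forall>Y\<in>Obj C. \<forall>f\<in>Hom C X Y. \<forall>g\<in>Hom C X Y.
        FArr F (f \<^bold>+\<^bsub>C\<^esub> g) = FArr F f \<^bold>+\<^bsub>D\<^esub> FArr F g) \<and>
     (\<forall>f\<in>Arr C. \<forall>c. FArr F (Scale C c f) = Scale D c (FArr F f))"

definition id_fctr :: "('o, 'a, 'o, 'a) fctr" where
  "id_fctr = \<lparr>FObj = (\<lambda>X. X), FArr = (\<lambda>f. f)\<rparr>"

definition comp_fctr :: "('p, 'b, 'q, 'c) fctr \<Rightarrow> ('o, 'a, 'p, 'b) fctr \<Rightarrow> ('o, 'a, 'q, 'c) fctr" where
  "comp_fctr G F = \<lparr>FObj = FObj G \<circ> FObj F, FArr = FArr G \<circ> FArr F\<rparr>"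

definition is_nat_iso ::
  "('o, 'a, 'k, 'e) lin_cat_scheme \<Rightarrow> ('p, 'b, 'k, 'f) lin_cat_scheme \<Rightarrow>
   ('o, 'a, 'p, 'b) fctr \<Rightarrow> ('o, 'a, 'p, 'b) fctr \<Rightarrow> ('o \<Rightarrow> 'b) \<Rightarrow> bool" where
  "is_nat_iso C D F G \<tau> \<longleftrightarrow>
     (\<forall>X\<in>Obj C. \<tau> X \<in> Hom D (FObj F X) (FObj G X) \<and> is_iso D (\<tau> X)) \<and>
     (\<forall>f\<in>Arr C. \<tau> (Tgt C f) \<cdot>\<^bsub>D\<^esub> FArr F f = FArr G f \<cdot>\<^bsub>D\<^esub> \<tau> (Src C f))"

definition lin_equivalent ::
  "('o, 'a, 'k, 'e) lin_cat_scheme \<Rightarrow> ('p, 'b, 'k, 'f) lin_cat_scheme \<Rightarrow> bool" where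
  "lin_equivalent C D \<longleftrightarrow>
     (\<exists>F G \<eta> \<epsilon>. is_linear_functor C D F \<and> is_linear_functor D C G \<and>
        is_nat_iso C C id_fctr (comp_fctr G F) \<eta> \<and> is_nat_iso D D (comp_fctr F G) id_fctr \<epsilon>)"

text \<open>Right exactness of a linear functor between abelian categories.\<close>

definition is_right_exact ::
  "('o, 'a, 'k, 'e) lin_cat_scheme \<Rightarrow> ('p, 'b, 'k, 'f) lin_cat_scheme \<Rightarrow>
   ('o, 'a, 'p, 'b) fctr \<Rightarrow> bool" where
  "is_right_exact C D F \<longleftrightarrow>
     (\<forall>f g. is_cokernel C f g \<longrightarrow> is_cokernel D (FArr F f) (FArr F g))"


section \<open>Finite abelian categories\<close>

text \<open>
  Up to isomorphism a finite-dimensional algebra lives on some \<open>k\<^sup>n\<close>, and up to isomorphism a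
  finite-dimensional left module over it is some \<open>k\<^sup>m\<close> together with a representation by
  \<open>m \<times> m\<close> matrices; module homomorphisms are then intertwining matrices. (Representations that
  agree on \<open>k\<^sup>n\<close> but differ as total functions give distinct, isomorphic objects.)
\<close>

definition fd_algebra ::
  "nat \<Rightarrow> ('k::field vec \<Rightarrow> 'k vec \<Rightarrow> 'k vec) \<Rightarrow> 'k vec \<Rightarrow> bool" where
  "fd_algebra n mul u \<longleftrightarrow>
     u \<in> carrier_vec n \<and>
     (\<forall>a\<in>carrier_vec n. mul u a = a \<and> mul a u = a) \<and>
     (\<forall>a\<in>carrier_vec n. \<forall>b\<in>carrier_vec n. mul a b \<in> carrier_vec n) \<and>
     (\<forall>a\<in>carrier_vec n. \<forall>b\<in>carrier_vec n. \<forall>c\<in>carrier_vec n.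
        mul (mul a b) c = mul a (mul b c) \<and>
        mul (a + b) c = mul a c + mul b c \<and> mul a (b + c) = mul a b + mul a c) \<and>
     (\<forall>a\<in>carrier_vec n. \<forall>b\<in>carrier_vec n. \<forall>r.
        mul (r \<cdot>\<^sub>v a) b = r \<cdot>\<^sub>v mul a b \<and> mul a (r \<cdot>\<^sub>v b) = r \<cdot>\<^sub>v mul a b)"

type_synonym 'k fd_mod = "nat \<times> ('k vec \<Rightarrow> 'k mat)"

definition fd_modules ::
  "nat \<Rightarrow> ('k::field vec \<Rightarrow> 'k vec \<Rightarrow> 'k vec) \<Rightarrow> 'k vec \<Rightarrow> 'k fd_mod set" where
  "fd_modules n mul u = {(m, \<rho>).
     (\<forall>a\<in>carrier_vec n. \<rho> a \<in> carrier_mat m m) \<and>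
     (\<forall>a\<in>carrier_vec n. \<forall>b\<in>carrier_vec n. \<rho> (a + b) = \<rho> a + \<rho> b) \<and>
     (\<forall>a\<in>carrier_vec n. \<forall>r. \<rho> (r \<cdot>\<^sub>v a) = r \<cdot>\<^sub>m \<rho> a) \<and>
     (\<forall>a\<in>carrier_vec n. \<forall>b\<in>carrier_vec n. \<rho> (mul a b) = \<rho> a * \<rho> b) \<and>
     \<rho> u = 1\<^sub>m m}"

definition mod_cat ::
  "nat \<Rightarrow> ('k::field vec \<Rightarrow> 'k vec \<Rightarrow> 'k vec) \<Rightarrow> 'k vec \<Rightarrow>
   ('k fd_mod, 'k fd_mod \<times> 'k mat \<times> 'k fd_mod, 'k) lin_cat" where
  "mod_cat n mul u = \<lparr>
     Obj = fd_modules n mul u,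
     Arr = {(V, T, W). V \<in> fd_modules n mul u \<and> W \<in> fd_modules n mul u \<and>
              T \<in> carrier_mat (fst W) (fst V) \<and>
              (\<forall>a\<in>carrier_vec n. T * snd V a = snd W a * T)},
     Src = (\<lambda>(V, T, W). V),
     Tgt = (\<lambda>(V, T, W). W),
     Idn = (\<lambda>V. (V, 1\<^sub>m (fst V), V)),
     Comp = (\<lambda>(V', T', W') (V, T, W). (V, T' * T, W')),
     Plus = (\<lambda>(V, T, W) (V', T', W'). (V, T + T', W)),
     Zero = (\<lambda>V W. (V, 0\<^sub>m (fst W) (fst V), W)),
     Scale = (\<lambda>c (V, T, W). (V, c \<cdot>\<^sub>m T, W))\<rparr>"

locale finite_abelian_category = linear_category C
  for C :: "('o, 'a, 'k::field, 'e) lin_cat_scheme" (structure) +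
  assumes equivalent_to_modules:
    "\<exists>n mul u. fd_algebra n mul u \<and> lin_equivalent C (mod_cat n mul u)"


section \<open>Finite tensor categories\<close>

text \<open>
  The associativity and unit constraints are kept explicit:
  \<open>Assoc C X Y Z : (X \<otimes> Y) \<otimes> Z \<longrightarrow> X \<otimes> (Y \<otimes> Z)\<close>, \<open>LUnit C X : \<one> \<otimes> X \<longrightarrow> X\<close>,
  \<open>RUnit C X : X \<otimes> \<one> \<longrightarrow> X\<close>. The record also carries the chosen left duals
  \<open>(Dual C X, Ev C X, Coev C X)\<close>.
\<close>

record ('o, 'a, 'k) tensor_cat = "('o, 'a, 'k) lin_cat" +
  TObj :: "'o \<Rightarrow> 'o \<Rightarrow> 'o"  (infixr "\<otimes>\<^sub>o\<index>" 75)
  TArr :: "'a \<Rightarrow> 'a \<Rightarrow> 'a"  (infixr "\<otimes>\<^sub>a\<index>" 75)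
  Unit :: "'o"
  Assoc :: "'o \<Rightarrow> 'o \<Rightarrow> 'o \<Rightarrow> 'a"
  LUnit :: "'o \<Rightarrow> 'a"
  RUnit :: "'o \<Rightarrow> 'a"
  Dual :: "'o \<Rightarrow> 'o"
  Ev :: "'o \<Rightarrow> 'a"
  Coev :: "'o \<Rightarrow> 'a"

locale linear_monoidal_category = linear_category C
  for C :: "('o, 'a, 'k::field, 'e) tensor_cat_scheme" (structure) +
  assumes tensor_obj: "\<lbrakk>X \<in> Obj C; Y \<in> Obj C\<rbrakk> \<Longrightarrow> X \<otimes>\<^sub>o Y \<in> Obj C"
    and tensor_hom: "\<lbrakk>f \<in> Hom C X X'; g \<in> Hom C Y Y'\<rbrakk>
      \<Longrightarrow> f \<otimes>\<^sub>a g \<in> Hom C (X \<otimes>\<^sub>o Y) (X' \<otimes>\<^sub>o Y')"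
    and tensor_idn: "\<lbrakk>X \<in> Obj C; Y \<in> Obj C\<rbrakk> \<Longrightarrow> Idn C X \<otimes>\<^sub>a Idn C Y = Idn C (X \<otimes>\<^sub>o Y)"
    and tensor_comp:
      "\<lbrakk>f \<in> Hom C X X'; f' \<in> Hom C X' X''; g \<in> Hom C Y Y'; g' \<in> Hom C Y' Y''\<rbrakk>
       \<Longrightarrow> (f' \<cdot> f) \<otimes>\<^sub>a (g' \<cdot> g) = (f' \<otimes>\<^sub>a g') \<cdot> (f \<otimes>\<^sub>a g)"
    and tensor_plus_left: "\<lbrakk>f \<in> Hom C X X'; f' \<in> Hom C X X'; g \<in> Hom C Y Y'\<rbrakk>
      \<Longrightarrow> (f \<^bold>+ f') \<otimes>\<^sub>a g = f \<otimes>\<^sub>a g \<^bold>+ f' \<otimes>\<^sub>a g"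
    and tensor_plus_right: "\<lbrakk>f \<in> Hom C X X'; g \<in> Hom C Y Y'; g' \<in> Hom C Y Y'\<rbrakk>
      \<Longrightarrow> f \<otimes>\<^sub>a (g \<^bold>+ g') = f \<otimes>\<^sub>a g \<^bold>+ f \<otimes>\<^sub>a g'"
    and tensor_scale_left: "\<lbrakk>f \<in> Hom C X X'; g \<in> Hom C Y Y'\<rbrakk>
      \<Longrightarrow> Scale C c f \<otimes>\<^sub>a g = Scale C c (f \<otimes>\<^sub>a g)"
    and tensor_scale_right: "\<lbrakk>f \<in> Hom C X X'; g \<in> Hom C Y Y'\<rbrakk>
      \<Longrightarrow> f \<otimes>\<^sub>a Scale C c g = Scale C c (f \<otimes>\<^sub>a g)"
    and unit_obj: "Unit C \<in> Obj C"
    and assoc_hom: "\<lbrakk>X \<in> Obj C; Y \<in> Obj C; Z \<in> Obj C\<rbrakk>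
      \<Longrightarrow> Assoc C X Y Z \<in> Hom C ((X \<otimes>\<^sub>o Y) \<otimes>\<^sub>o Z) (X \<otimes>\<^sub>o (Y \<otimes>\<^sub>o Z))"
    and assoc_iso: "\<lbrakk>X \<in> Obj C; Y \<in> Obj C; Z \<in> Obj C\<rbrakk> \<Longrightarrow> is_iso C (Assoc C X Y Z)"
    and assoc_natural: "\<lbrakk>f \<in> Hom C X X'; g \<in> Hom C Y Y'; h \<in> Hom C Z Z'\<rbrakk>
      \<Longrightarrow> Assoc C X' Y' Z' \<cdot> ((f \<otimes>\<^sub>a g) \<otimes>\<^sub>a h) = (f \<otimes>\<^sub>a (g \<otimes>\<^sub>a h)) \<cdot> Assoc C X Y Z"
    and lunit_hom: "X \<in> Obj C \<Longrightarrow> LUnit C X \<in> Hom C (Unit C \<otimes>\<^sub>o X) X"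
    and lunit_iso: "X \<in> Obj C \<Longrightarrow> is_iso C (LUnit C X)"
    and lunit_natural: "f \<in> Hom C X X'
      \<Longrightarrow> LUnit C X' \<cdot> (Idn C (Unit C) \<otimes>\<^sub>a f) = f \<cdot> LUnit C X"
    and runit_hom: "X \<in> Obj C \<Longrightarrow> RUnit C X \<in> Hom C (X \<otimes>\<^sub>o Unit C) X"
    and runit_iso: "X \<in> Obj C \<Longrightarrow> is_iso C (RUnit C X)"
    and runit_natural: "f \<in> Hom C X X'
      \<Longrightarrow> RUnit C X' \<cdot> (f \<otimes>\<^sub>a Idn C (Unit C)) = f \<cdot> RUnit C X"
    and pentagon: "\<lbrakk>W \<in> Obj C; X \<in> Obj C; Y \<in> Obj C; Z \<in> Obj C\<rbrakk>
      \<Longrightarrow> (Idn C W \<otimes>\<^sub>a Assoc C X Y Z) \<cdot> Assoc C W (X \<otimes>\<^sub>o Y) Z \<cdot> (Assoc C W X Y \<otimes>\<^sub>a Idn C Z)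
        = Assoc C W X (Y \<otimes>\<^sub>o Z) \<cdot> Assoc C (W \<otimes>\<^sub>o X) Y Z"
    and triangle: "\<lbrakk>X \<in> Obj C; Y \<in> Obj C\<rbrakk>
      \<Longrightarrow> (Idn C X \<otimes>\<^sub>a LUnit C Y) \<cdot> Assoc C X (Unit C) Y = RUnit C X \<otimes>\<^sub>a Idn C Y"

context
  fixes C :: "('o, 'a, 'k, 'e) tensor_cat_scheme" (structure)
begin

text \<open>\<open>(Y, e, c)\<close> is a left dual of \<open>X\<close>; equivalently, \<open>(X, e, c)\<close> is a right dual of \<open>Y\<close>.\<close>

definition is_left_dual :: "'o \<Rightarrow> 'o \<Rightarrow> 'a \<Rightarrow> 'a \<Rightarrow> bool" where
  "is_left_dual X Y e c \<longleftrightarrow> X \<in> Obj C \<and> Y \<in> Obj C \<and>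
     e \<in> Hom C (Y \<otimes>\<^sub>o X) (Unit C) \<and> c \<in> Hom C (Unit C) (X \<otimes>\<^sub>o Y) \<and>
     RUnit C X \<cdot> (Idn C X \<otimes>\<^sub>a e) \<cdot> Assoc C X Y X \<cdot> (c \<otimes>\<^sub>a Idn C X) \<cdot> Inv C (LUnit C X)
       = Idn C X \<and>
     LUnit C Y \<cdot> (e \<otimes>\<^sub>a Idn C Y) \<cdot> Inv C (Assoc C Y X Y) \<cdot> (Idn C Y \<otimes>\<^sub>a c) \<cdot> Inv C (RUnit C Y)
       = Idn C Y"

text \<open>The morphism \<open>Z \<longrightarrow> X\<^sup>*\<close> corresponding to \<open>f : Z \<otimes> X \<longrightarrow> \<one>\<close>.\<close>

definition dual_transpose :: "'o \<Rightarrow> 'o \<Rightarrow> 'a \<Rightarrow> 'a" where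
  "dual_transpose Z X f =
     LUnit C (Dual C X) \<cdot> (f \<otimes>\<^sub>a Idn C (Dual C X)) \<cdot> Inv C (Assoc C Z X (Dual C X)) \<cdot>
     (Idn C Z \<otimes>\<^sub>a Coev C X) \<cdot> Inv C (RUnit C Z)"

definition dual_arr :: "'a \<Rightarrow> 'a" where
  "dual_arr f = dual_transpose (Dual C (Tgt C f)) (Src C f)
     (Ev C (Tgt C f) \<cdot> (Idn C (Dual C (Tgt C f)) \<otimes>\<^sub>a f))"

text \<open>The canonical isomorphisms \<open>Y\<^sup>* \<otimes> X\<^sup>* \<longrightarrow> (X \<otimes> Y)\<^sup>*\<close> and \<open>\<one> \<longrightarrow> \<one>\<^sup>*\<close>.\<close>

definition dual_tensor :: "'o \<Rightarrow> 'o \<Rightarrow> 'a" where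
  "dual_tensor X Y = dual_transpose (Dual C Y \<otimes>\<^sub>o Dual C X) (X \<otimes>\<^sub>o Y)
     (Ev C Y \<cdot> (Idn C (Dual C Y) \<otimes>\<^sub>a
        (LUnit C Y \<cdot> (Ev C X \<otimes>\<^sub>a Idn C Y) \<cdot> Inv C (Assoc C (Dual C X) X Y))) \<cdot>
      Assoc C (Dual C Y) (Dual C X) (X \<otimes>\<^sub>o Y))"

definition dual_unit :: "'a" where
  "dual_unit = LUnit C (Dual C (Unit C)) \<cdot> Coev C (Unit C)"

definition bidual_fctr :: "('o, 'a, 'o, 'a) fctr" where
  "bidual_fctr = \<lparr>FObj = (\<lambda>X. Dual C (Dual C X)), FArr = (\<lambda>f. dual_arr (dual_arr f))\<rparr>"

text \<open>The monoidal structure \<open>X\<^sup>*\<^sup>* \<otimes> Y\<^sup>*\<^sup>* \<longrightarrow> (X \<otimes> Y)\<^sup>*\<^sup>*\<close> and \<open>\<one> \<longrightarrow> \<one>\<^sup>*\<^sup>*\<close> of the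
  double dual functor.\<close>

definition bidual_tensor :: "'o \<Rightarrow> 'o \<Rightarrow> 'a" where
  "bidual_tensor X Y = Inv C (dual_arr (dual_tensor X Y)) \<cdot> dual_tensor (Dual C Y) (Dual C X)"

definition bidual_unit :: "'a" where
  "bidual_unit = Inv C (dual_arr dual_unit) \<cdot> dual_unit"

end

locale finite_tensor_category = linear_monoidal_category C + finite_abelian_category C
  for C :: "('o, 'a, 'k::field, 'e) tensor_cat_scheme" (structure) +
  assumes left_dual: "X \<in> Obj C \<Longrightarrow> is_left_dual C X (Dual C X) (Ev C X) (Coev C X)"
    and right_dual: "X \<in> Obj C \<Longrightarrow> \<exists>Y e c. is_left_dual C Y X e c"
    and unit_simple: "is_simple C (Unit C)"

locale pivotal_finite_tensor_category = finite_tensor_category C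
  for C :: "('o, 'a, 'k::field, 'e) tensor_cat_scheme" (structure) +
  fixes j :: "'o \<Rightarrow> 'a"
  assumes pivotal_nat_iso: "is_nat_iso C C id_fctr (bidual_fctr C) j"
    and pivotal_tensor: "\<lbrakk>X \<in> Obj C; Y \<in> Obj C\<rbrakk>
      \<Longrightarrow> j (X \<otimes>\<^sub>o Y) = bidual_tensor C X Y \<cdot> (j X \<otimes>\<^sub>a j Y)"
    and pivotal_unit: "j (Unit C) = bidual_unit C"


section \<open>Module categories\<close>

text \<open>
  \<open>ActAssoc M X Y N : (X \<otimes> Y) \<rhd> N \<longrightarrow> X \<rhd> (Y \<rhd> N)\<close> and \<open>ActUnit M N : \<one> \<rhd> N \<longrightarrow> N\<close> are the
  constraints of the action. The record also carries chosen internal Hom objects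
  \<open>IHom M N N' = [N, N']\<close> with counit \<open>IEv M N N' : [N, N'] \<rhd> N \<longrightarrow> N'\<close>.
\<close>

record ('p, 'b, 'k, 'o, 'a) module_cat = "('p, 'b, 'k) lin_cat" +
  ActObj :: "'o \<Rightarrow> 'p \<Rightarrow> 'p"  (infixr "\<rhd>\<^sub>o\<index>" 75)
  ActArr :: "'a \<Rightarrow> 'b \<Rightarrow> 'b"  (infixr "\<rhd>\<^sub>a\<index>" 75)
  ActAssoc :: "'o \<Rightarrow> 'o \<Rightarrow> 'p \<Rightarrow> 'b"
  ActUnit :: "'p \<Rightarrow> 'b"
  IHom :: "'p \<Rightarrow> 'p \<Rightarrow> 'o"
  IEv :: "'p \<Rightarrow> 'p \<Rightarrow> 'b"

definition act_by_obj ::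
  "('o, 'a, 'k, 'e) lin_cat_scheme \<Rightarrow> ('p, 'b, 'k, 'o, 'a, 'f) module_cat_scheme \<Rightarrow> 'o \<Rightarrow>
   ('p, 'b, 'p, 'b) fctr" where
  "act_by_obj C M X = \<lparr>FObj = (\<lambda>N. X \<rhd>\<^sub>o\<^bsub>M\<^esub> N), FArr = (\<lambda>f. Idn C X \<rhd>\<^sub>a\<^bsub>M\<^esub> f)\<rparr>"

definition act_on_obj ::
  "('p, 'b, 'k, 'o, 'a, 'f) module_cat_scheme \<Rightarrow> 'p \<Rightarrow> ('o, 'a, 'p, 'b) fctr" where
  "act_on_obj M N = \<lparr>FObj = (\<lambda>X. X \<rhd>\<^sub>o\<^bsub>M\<^esub> N), FArr = (\<lambda>f. f \<rhd>\<^sub>a\<^bsub>M\<^esub> Idn M N)\<rparr>"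

locale linear_module_category =
  C: linear_monoidal_category C + M: linear_category M
  for C :: "('o, 'a, 'k::field, 'e) tensor_cat_scheme"
    and M :: "('p, 'b, 'k, 'o, 'a, 'f) module_cat_scheme" (structure) +
  assumes act_obj: "\<lbrakk>X \<in> Obj C; N \<in> Obj M\<rbrakk> \<Longrightarrow> X \<rhd>\<^sub>o N \<in> Obj M"
    and act_hom: "\<lbrakk>f \<in> Hom C X X'; g \<in> Hom M N N'\<rbrakk>
      \<Longrightarrow> f \<rhd>\<^sub>a g \<in> Hom M (X \<rhd>\<^sub>o N) (X' \<rhd>\<^sub>o N')"
    and act_idn: "\<lbrakk>X \<in> Obj C; N \<in> Obj M\<rbrakk> \<Longrightarrow> Idn C X \<rhd>\<^sub>a Idn M N = Idn M (X \<rhd>\<^sub>o N)"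
    and act_comp:
      "\<lbrakk>f \<in> Hom C X X'; f' \<in> Hom C X' X''; g \<in> Hom M N N'; g' \<in> Hom M N' N''\<rbrakk>
       \<Longrightarrow> (f' \<cdot>\<^bsub>C\<^esub> f) \<rhd>\<^sub>a (g' \<cdot> g) = (f' \<rhd>\<^sub>a g') \<cdot> (f \<rhd>\<^sub>a g)"
    and act_plus_left: "\<lbrakk>f \<in> Hom C X X'; f' \<in> Hom C X X'; g \<in> Hom M N N'\<rbrakk>
      \<Longrightarrow> (f \<^bold>+\<^bsub>C\<^esub> f') \<rhd>\<^sub>a g = f \<rhd>\<^sub>a g \<^bold>+ f' \<rhd>\<^sub>a g"
    and act_plus_right: "\<lbrakk>f \<in> Hom C X X'; g \<in> Hom M N N'; g' \<in> Hom M N N'\<rbrakk>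
      \<Longrightarrow> f \<rhd>\<^sub>a (g \<^bold>+ g') = f \<rhd>\<^sub>a g \<^bold>+ f \<rhd>\<^sub>a g'"
    and act_scale_left: "\<lbrakk>f \<in> Hom C X X'; g \<in> Hom M N N'\<rbrakk>
      \<Longrightarrow> Scale C c f \<rhd>\<^sub>a g = Scale M c (f \<rhd>\<^sub>a g)"
    and act_scale_right: "\<lbrakk>f \<in> Hom C X X'; g \<in> Hom M N N'\<rbrakk>
      \<Longrightarrow> f \<rhd>\<^sub>a Scale M c g = Scale M c (f \<rhd>\<^sub>a g)"
    and act_assoc_hom: "\<lbrakk>X \<in> Obj C; Y \<in> Obj C; N \<in> Obj M\<rbrakk>
      \<Longrightarrow> ActAssoc M X Y N \<in> Hom M ((X \<otimes>\<^sub>o\<^bsub>C\<^esub> Y) \<rhd>\<^sub>o N) (X \<rhd>\<^sub>o (Y \<rhd>\<^sub>o N))"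
    and act_assoc_iso: "\<lbrakk>X \<in> Obj C; Y \<in> Obj C; N \<in> Obj M\<rbrakk> \<Longrightarrow> is_iso M (ActAssoc M X Y N)"
    and act_assoc_natural: "\<lbrakk>f \<in> Hom C X X'; h \<in> Hom C Y Y'; g \<in> Hom M N N'\<rbrakk>
      \<Longrightarrow> ActAssoc M X' Y' N' \<cdot> ((f \<otimes>\<^sub>a\<^bsub>C\<^esub> h) \<rhd>\<^sub>a g) = (f \<rhd>\<^sub>a (h \<rhd>\<^sub>a g)) \<cdot> ActAssoc M X Y N"
    and act_unit_hom: "N \<in> Obj M \<Longrightarrow> ActUnit M N \<in> Hom M (Unit C \<rhd>\<^sub>o N) N"
    and act_unit_iso: "N \<in> Obj M \<Longrightarrow> is_iso M (ActUnit M N)"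
    and act_unit_natural: "g \<in> Hom M N N'
      \<Longrightarrow> ActUnit M N' \<cdot> (Idn C (Unit C) \<rhd>\<^sub>a g) = g \<cdot> ActUnit M N"
    and act_pentagon: "\<lbrakk>X \<in> Obj C; Y \<in> Obj C; Z \<in> Obj C; N \<in> Obj M\<rbrakk>
      \<Longrightarrow> (Idn C X \<rhd>\<^sub>a ActAssoc M Y Z N) \<cdot> ActAssoc M X (Y \<otimes>\<^sub>o\<^bsub>C\<^esub> Z) N \<cdot>
          (Assoc C X Y Z \<rhd>\<^sub>a Idn M N)
        = ActAssoc M X Y (Z \<rhd>\<^sub>o N) \<cdot> ActAssoc M (X \<otimes>\<^sub>o\<^bsub>C\<^esub> Y) Z N"
    and act_triangle: "\<lbrakk>X \<in> Obj C; N \<in> Obj M\<rbrakk>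
      \<Longrightarrow> (Idn C X \<rhd>\<^sub>a ActUnit M N) \<cdot> ActAssoc M X (Unit C) N = RUnit C X \<rhd>\<^sub>a Idn M N"

text \<open>
  A finite left module category over a finite tensor category. The last two assumptions are no
  restriction: they say that the chosen \<open>IHom\<close>, \<open>IEv\<close> form a right adjoint of \<open>X \<mapsto> X \<rhd> N\<close>,
  which exists by finiteness and right exactness.
\<close>

locale finite_module_category =
  C: finite_tensor_category C + M: finite_abelian_category M + linear_module_category C M
  for C :: "('o, 'a, 'k::field, 'e) tensor_cat_scheme"
    and M :: "('p, 'b, 'k, 'o, 'a, 'f) module_cat_scheme" (structure) +
  assumes act_by_right_exact: "X \<in> Obj C \<Longrightarrow> is_right_exact M M (act_by_obj C M X)"
    and act_on_right_exact: "N \<in> Obj M \<Longrightarrow> is_right_exact C M (act_on_obj M N)"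
    and ihom: "\<lbrakk>N \<in> Obj M; N' \<in> Obj M\<rbrakk>
      \<Longrightarrow> IHom M N N' \<in> Obj C \<and> IEv M N N' \<in> Hom M (IHom M N N' \<rhd>\<^sub>o N) N'"
    and ihom_universal: "\<lbrakk>X \<in> Obj C; N \<in> Obj M; N' \<in> Obj M; f \<in> Hom M (X \<rhd>\<^sub>o N) N'\<rbrakk>
      \<Longrightarrow> \<exists>!h. h \<in> Hom C X (IHom M N N') \<and> IEv M N N' \<cdot> (h \<rhd>\<^sub>a Idn M N) = f"

locale exact_module_category = finite_module_category C M
  for C :: "('o, 'a, 'k::field, 'e) tensor_cat_scheme"
    and M :: "('p, 'b, 'k, 'o, 'a, 'f) module_cat_scheme" (structure) +
  assumes act_projective: "\<lbrakk>is_projective C P; N \<in> Obj M\<rbrakk> \<Longrightarrow> is_projective M (P \<rhd>\<^sub>o N)"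

context
  fixes C :: "('o, 'a, 'k, 'e) tensor_cat_scheme"
    and M :: "('p, 'b, 'k, 'o, 'a, 'f) module_cat_scheme" (structure)
begin

text \<open>The morphism \<open>X \<longrightarrow> [N, N']\<close> corresponding to \<open>f : X \<rhd> N \<longrightarrow> N'\<close>.\<close>

definition ihom_transpose :: "'o \<Rightarrow> 'p \<Rightarrow> 'p \<Rightarrow> 'b \<Rightarrow> 'a" where
  "ihom_transpose X N N' f =
     (THE h. h \<in> Hom C X (IHom M N N') \<and> IEv M N N' \<cdot> (h \<rhd>\<^sub>a Idn M N) = f)"

definition ihom_coev :: "'o \<Rightarrow> 'p \<Rightarrow> 'a" where
  "ihom_coev X N = ihom_transpose X N (X \<rhd>\<^sub>o N) (Idn M (X \<rhd>\<^sub>o N))"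

text \<open>\<open>ihom_arr g f : [N, L] \<longrightarrow> [N', L']\<close> is the morphism \<open>[g, f]\<close> for \<open>g : N' \<longrightarrow> N\<close> and
  \<open>f : L \<longrightarrow> L'\<close>.\<close>

definition ihom_arr :: "'b \<Rightarrow> 'b \<Rightarrow> 'a" where
  "ihom_arr g f = ihom_transpose (IHom M (Tgt M g) (Src M f)) (Src M g) (Tgt M f)
     (f \<cdot> IEv M (Tgt M g) (Src M f) \<cdot> (Idn C (IHom M (Tgt M g) (Src M f)) \<rhd>\<^sub>a g))"

definition ihom_a :: "'o \<Rightarrow> 'p \<Rightarrow> 'p \<Rightarrow> 'a" where
  "ihom_a X N L = ihom_transpose (X \<otimes>\<^sub>o\<^bsub>C\<^esub> IHom M N L) N (X \<rhd>\<^sub>o L)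
     ((Idn C X \<rhd>\<^sub>a IEv M N L) \<cdot> ActAssoc M X (IHom M N L) N)"

definition ihom_bnat :: "'o \<Rightarrow> 'p \<Rightarrow> 'p \<Rightarrow> 'a" where
  "ihom_bnat Y N L = ihom_transpose (IHom M (Y \<rhd>\<^sub>o N) L \<otimes>\<^sub>o\<^bsub>C\<^esub> Y) N L
     (IEv M (Y \<rhd>\<^sub>o N) L \<cdot> ActAssoc M (IHom M (Y \<rhd>\<^sub>o N) L) Y N)"

definition ihom_b :: "'o \<Rightarrow> 'p \<Rightarrow> 'p \<Rightarrow> 'a" where
  "ihom_b Y N L =
     (ihom_bnat Y N L \<otimes>\<^sub>a\<^bsub>C\<^esub> Idn C (Dual C Y)) \<cdot>\<^bsub>C\<^esub>
     Inv C (Assoc C (IHom M (Y \<rhd>\<^sub>o N) L) Y (Dual C Y)) \<cdot>\<^bsub>C\<^esub>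
     (Idn C (IHom M (Y \<rhd>\<^sub>o N) L) \<otimes>\<^sub>a\<^bsub>C\<^esub> Coev C Y) \<cdot>\<^bsub>C\<^esub>
     Inv C (RUnit C (IHom M (Y \<rhd>\<^sub>o N) L))"

text \<open>\<open>ihom_c X N L Y : (X \<otimes> [N, L]) \<otimes> Y\<^sup>* \<longrightarrow> [Y \<rhd> N, X \<rhd> L]\<close>\<close>

definition ihom_c :: "'o \<Rightarrow> 'p \<Rightarrow> 'p \<Rightarrow> 'o \<Rightarrow> 'a" where
  "ihom_c X N L Y =
     Inv C (ihom_b Y N (X \<rhd>\<^sub>o L)) \<cdot>\<^bsub>C\<^esub> (ihom_a X N L \<otimes>\<^sub>a\<^bsub>C\<^esub> Idn C (Dual C Y))"

text \<open>\<open>(A, \<pi>)\<close> is the end \<open>\<integral>\<^sub>N [N, N]\<close>.\<close>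

definition is_dinatural :: "'o \<Rightarrow> ('p \<Rightarrow> 'a) \<Rightarrow> bool" where
  "is_dinatural Z \<sigma> \<longleftrightarrow> Z \<in> Obj C \<and> (\<forall>N\<in>Obj M. \<sigma> N \<in> Hom C Z (IHom M N N)) \<and>
     (\<forall>N\<in>Obj M. \<forall>N'\<in>Obj M. \<forall>f\<in>Hom M N N'.
        ihom_arr (Idn M N) f \<cdot>\<^bsub>C\<^esub> \<sigma> N = ihom_arr f (Idn M N') \<cdot>\<^bsub>C\<^esub> \<sigma> N')"

definition is_end :: "'o \<Rightarrow> ('p \<Rightarrow> 'a) \<Rightarrow> bool" where
  "is_end A \<pi> \<longleftrightarrow> is_dinatural A \<pi> \<and>
     (\<forall>Z \<sigma>. is_dinatural Z \<sigma> \<longrightarrow>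
        (\<exists>!h. h \<in> Hom C Z A \<and> (\<forall>N\<in>Obj M. \<pi> N \<cdot>\<^bsub>C\<^esub> h = \<sigma> N)))"

end


section \<open>Relative Serre functors and pivotal module categories\<close>

locale relative_serre_functor = exact_module_category C M
  for C :: "('o, 'a, 'k::field, 'e) tensor_cat_scheme"
    and M :: "('p, 'b, 'k, 'o, 'a, 'f) module_cat_scheme" (structure) +
  fixes S :: "('p, 'b, 'p, 'b) fctr"
    and \<dd> :: "'p \<Rightarrow> 'p \<Rightarrow> 'a"
  assumes serre_functor: "is_functor M M S"
    and serre_hom: "\<lbrakk>N \<in> Obj M; L \<in> Obj M\<rbrakk>
      \<Longrightarrow> \<dd> N L \<in> Hom C (Dual C (IHom M N L)) (IHom M L (FObj S N))"
    and serre_iso: "\<lbrakk>N \<in> Obj M; L \<in> Obj M\<rbrakk> \<Longrightarrow> is_iso C (\<dd> N L)"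
    and serre_natural: "\<lbrakk>g \<in> Hom M N N'; f \<in> Hom M L L'\<rbrakk>
      \<Longrightarrow> \<dd> N' L \<cdot>\<^bsub>C\<^esub> dual_arr C (ihom_arr C M g f)
        = ihom_arr C M f (FArr S g) \<cdot>\<^bsub>C\<^esub> \<dd> N L'"

text \<open>
  The twisted module functor structure \<open>\<zeta> X N : X\<^sup>*\<^sup>* \<rhd> S N \<longrightarrow> S (X \<rhd> N)\<close>. In \<open>zeta_serre\<close> the
  composite of \<open>Assoc\<close> and \<open>dual_tensor\<close>s is the canonical identification
  \<open>(Y\<^sup>*\<^sup>* \<otimes> [N, L]\<^sup>*) \<otimes> X\<^sup>* \<longrightarrow> ((X \<otimes> [N, L]) \<otimes> Y\<^sup>*)\<^sup>*\<close>.
\<close>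

locale pivotal_exact_module_category =
  pivotal_finite_tensor_category C j + relative_serre_functor C M S \<dd>
  for C :: "('o, 'a, 'k::field, 'e) tensor_cat_scheme"
    and j :: "'o \<Rightarrow> 'a"
    and M :: "('p, 'b, 'k, 'o, 'a, 'f) module_cat_scheme" (structure)
    and S :: "('p, 'b, 'p, 'b) fctr"
    and \<dd> :: "'p \<Rightarrow> 'p \<Rightarrow> 'a" +
  fixes \<zeta> :: "'o \<Rightarrow> 'p \<Rightarrow> 'b"
    and j' :: "'p \<Rightarrow> 'b"
  assumes zeta_hom: "\<lbrakk>X \<in> Obj C; N \<in> Obj M\<rbrakk>
      \<Longrightarrow> \<zeta> X N \<in> Hom M (Dual C (Dual C X) \<rhd>\<^sub>o FObj S N) (FObj S (X \<rhd>\<^sub>o N))"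
    and zeta_iso: "\<lbrakk>X \<in> Obj C; N \<in> Obj M\<rbrakk> \<Longrightarrow> is_iso M (\<zeta> X N)"
    and zeta_natural: "\<lbrakk>f \<in> Hom C X X'; g \<in> Hom M N N'\<rbrakk>
      \<Longrightarrow> \<zeta> X' N' \<cdot> (dual_arr C (dual_arr C f) \<rhd>\<^sub>a FArr S g) = FArr S (f \<rhd>\<^sub>a g) \<cdot> \<zeta> X N"
    and zeta_assoc: "\<lbrakk>X \<in> Obj C; Y \<in> Obj C; N \<in> Obj M\<rbrakk>
      \<Longrightarrow> FArr S (ActAssoc M X Y N) \<cdot> \<zeta> (X \<otimes>\<^sub>o\<^bsub>C\<^esub> Y) N \<cdot>
          (bidual_tensor C X Y \<rhd>\<^sub>a Idn M (FObj S N))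
        = \<zeta> X (Y \<rhd>\<^sub>o N) \<cdot> (Idn C (Dual C (Dual C X)) \<rhd>\<^sub>a \<zeta> Y N) \<cdot>
          ActAssoc M (Dual C (Dual C X)) (Dual C (Dual C Y)) (FObj S N)"
    and zeta_unit: "N \<in> Obj M
      \<Longrightarrow> FArr S (ActUnit M N) \<cdot> \<zeta> (Unit C) N \<cdot> (bidual_unit C \<rhd>\<^sub>a Idn M (FObj S N))
        = ActUnit M (FObj S N)"
    and zeta_serre: "\<lbrakk>X \<in> Obj C; Y \<in> Obj C; N \<in> Obj M; L \<in> Obj M\<rbrakk>
      \<Longrightarrow> \<dd> (Y \<rhd>\<^sub>o N) (X \<rhd>\<^sub>o L) \<cdot>\<^bsub>C\<^esub> Inv C (dual_arr C (ihom_c C M X N L Y)) \<cdot>\<^bsub>C\<^esub>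
          dual_tensor C (X \<otimes>\<^sub>o\<^bsub>C\<^esub> IHom M N L) (Dual C Y) \<cdot>\<^bsub>C\<^esub>
          (Idn C (Dual C (Dual C Y)) \<otimes>\<^sub>a\<^bsub>C\<^esub> dual_tensor C X (IHom M N L)) \<cdot>\<^bsub>C\<^esub>
          Assoc C (Dual C (Dual C Y)) (Dual C (IHom M N L)) (Dual C X)
        = ihom_arr C M (Idn M (X \<rhd>\<^sub>o L)) (\<zeta> Y N) \<cdot>\<^bsub>C\<^esub>
          ihom_c C M (Dual C (Dual C Y)) L (FObj S N) X \<cdot>\<^bsub>C\<^esub>
          ((Idn C (Dual C (Dual C Y)) \<otimes>\<^sub>a\<^bsub>C\<^esub> \<dd> N L) \<otimes>\<^sub>a\<^bsub>C\<^esub> Idn C (Dual C X))"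
    and module_pivotal_nat_iso: "is_nat_iso M M id_fctr S j'"
    and module_pivotal_act: "\<lbrakk>X \<in> Obj C; N \<in> Obj M\<rbrakk>
      \<Longrightarrow> j' (X \<rhd>\<^sub>o N) = \<zeta> X N \<cdot> (j X \<rhd>\<^sub>a j' N)"

text \<open>
  Under the identifications \<open>\<one>\<^sup>* \<cong> \<one>\<close> (\<open>dual_unit\<close>) and \<open>\<one> \<rhd> N \<cong> N\<close> (\<open>ActUnit\<close>), the defining
  equation of the trace reads \<open>\<dd>\<^sub>N\<^sub>,\<^sub>N \<cdot> tr(N)\<^sup>* = [id, j'\<^sub>N] \<cdot> coev\<^sub>\<one>\<^sub>,\<^sub>N\<close>.
\<close>

definition internal_trace ::
  "('o, 'a, 'k, 'e) tensor_cat_scheme \<Rightarrow> ('p, 'b, 'k, 'o, 'a, 'f) module_cat_scheme \<Rightarrow>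
   ('p \<Rightarrow> 'p \<Rightarrow> 'a) \<Rightarrow> ('p \<Rightarrow> 'b) \<Rightarrow> 'p \<Rightarrow> 'a" where
  "internal_trace C M \<dd> j' N =
     (THE t. t \<in> Hom C (IHom M N N) (Unit C) \<and>
        \<dd> N N \<cdot>\<^bsub>C\<^esub> dual_arr C t \<cdot>\<^bsub>C\<^esub> dual_unit C
          = ihom_arr C M (Idn M N) (j' N) \<cdot>\<^bsub>C\<^esub>
            ihom_arr C M (Idn M N) (ActUnit M N) \<cdot>\<^bsub>C\<^esub> ihom_coev C M (Unit C) N)"

definition internal_character ::
  "('o, 'a, 'k, 'e) tensor_cat_scheme \<Rightarrow> ('p, 'b, 'k, 'o, 'a, 'f) module_cat_scheme \<Rightarrow>
   ('p \<Rightarrow> 'p \<Rightarrow> 'a) \<Rightarrow> ('p \<Rightarrow> 'b) \<Rightarrow> ('p \<Rightarrow> 'a) \<Rightarrow> 'p \<Rightarrow> 'a" where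
  "internal_character C M \<dd> j' \<pi> N = internal_trace C M \<dd> j' N \<cdot>\<^bsub>C\<^esub> \<pi> N"

end

theory Submission
  imports Defs
begin

text \<open>
  Why the character is additive. Write $t_i$ for the trace and $\pi_i$ for the component of the
  end at $M_i$, and let $f : M_1 \to M_2$, $g : M_2 \to M_3$ be the maps of the exact sequence.

  The trace is cyclic: $t_N [h, 1] = t_L [1, h]$ as morphisms $[L, N] \to \mathbf{1}$, for every
  $h : N \to L$ (\<open>internal_trace_cyclic\<close>). Indeed, under the Serre isomorphism and the adjunction
  both sides become $S(h) j'_N = j'_L h$.

  Dinaturality of the end says that \<open>\<pi>\<close> takes values in the endomorphisms of $M_2$ which are
  block triangular for the filtration $M_1 \subseteq M_2$, with diagonal blocks $\pi_1$ and
  $\pi_3$. A block triangular endomorphism should be a sum of two pieces, one factoring as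
  $M_2 \to M_1 \to M_2$ and one as $M_2 \to M_3 \to M_2$, and cyclicity computes the trace of such
  pieces. This decomposition exists only locally. The map $[1, g] : [M_3, M_2] \to [M_3, M_3]$ is
  an epimorphism (\<open>ihom_post_epi\<close>), so there are jointly epimorphic $e : P \to A$ with lifts
  $s : P \to [M_3, M_2]$, $[1, g] s = \pi_3 e$ (\<open>epi_joint_epi\<close>). The difference
  $\pi_2 e - [g, 1] s$ is then killed by $[1, g]$ and hence equals $[1, f] u$ for some
  $u : P \to [M_2, M_1]$, because $[M_2, -]$ preserves kernels (\<open>ihom_post_kernel\<close>); restricting
  along $f$ gives $[f, 1] u = \pi_1 e$. Therefore
  \[ t_2 \pi_2 e = t_3 [1, g] s + t_1 [f, 1] u = (t_3 \pi_3 + t_1 \pi_1) e. \]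

  Right exactness of $[N, -]$ is where duality enters: the Serre isomorphism turns the dual of
  $[1, g] : [N, M_2] \to [N, M_3]$ into $[g, 1] : [M_3, S N] \to [M_2, S N]$, which is monic since
  $X \rhd -$ preserves cokernels, and the dual functor is faithful.

  The lifts come from the equivalence of the tensor category with a category of modules. There an
  epimorphism is surjective; the maps from the regular module to a given module correspond to its
  elements, so they lift along epimorphisms and are jointly epimorphic.
\<close>

section \<open>Linear categories\<close>

context linear_category begin

lemma hom_iff: "f \<in> Hom C X Y \<longleftrightarrow> f \<in> Arr C \<and> Src C f = X \<and> Tgt C f = Y"
  by (auto simp: Hom_def)

lemma arr_hom: "f \<in> Arr C \<Longrightarrow> f \<in> Hom C (Src C f) (Tgt C f)"
  by (simp add: hom_iff)

lemma hom_obj: "f \<in> Hom C X Y \<Longrightarrow> X \<in> Obj C \<and> Y \<in> Obj C"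
  using src_obj tgt_obj by (auto simp: hom_iff)

text \<open>
  Conditions on sources and targets are phrased as equations between \<open>Src\<close> and \<open>Tgt\<close>, so that the
  simplifier can decide them; membership in a Hom set would leave it to guess the intermediate object.
\<close>

lemma arr_idn [simp]: "X \<in> Obj C \<Longrightarrow> Idn C X \<in> Arr C" "X \<in> Obj C \<Longrightarrow> Src C (Idn C X) = X"
  "X \<in> Obj C \<Longrightarrow> Tgt C (Idn C X) = X"
  using idn_hom by (auto simp: hom_iff)

lemma arr_zero [simp]: "\<lbrakk>X \<in> Obj C; Y \<in> Obj C\<rbrakk> \<Longrightarrow> Zero C X Y \<in> Arr C"
  "\<lbrakk>X \<in> Obj C; Y \<in> Obj C\<rbrakk> \<Longrightarrow> Src C (Zero C X Y) = X"
  "\<lbrakk>X \<in> Obj C; Y \<in> Obj C\<rbrakk> \<Longrightarrow> Tgt C (Zero C X Y) = Y"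
  using zero_hom by (auto simp: hom_iff)

lemma arr_comp [simp]: "\<lbrakk>f \<in> Arr C; g \<in> Arr C; Tgt C f = Src C g\<rbrakk> \<Longrightarrow> g \<cdot> f \<in> Arr C"
  "\<lbrakk>f \<in> Arr C; g \<in> Arr C; Tgt C f = Src C g\<rbrakk> \<Longrightarrow> Src C (g \<cdot> f) = Src C f"
  "\<lbrakk>f \<in> Arr C; g \<in> Arr C; Tgt C f = Src C g\<rbrakk> \<Longrightarrow> Tgt C (g \<cdot> f) = Tgt C g"
  using comp_hom[of f "Src C f" "Src C g" g "Tgt C g"] by (auto simp: hom_iff)

lemma arr_plus [simp]:
  "\<lbrakk>f \<in> Arr C; g \<in> Arr C; Src C f = Src C g; Tgt C f = Tgt C g\<rbrakk> \<Longrightarrow> f \<^bold>+ g \<in> Arr C"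
  "\<lbrakk>f \<in> Arr C; g \<in> Arr C; Src C f = Src C g; Tgt C f = Tgt C g\<rbrakk> \<Longrightarrow> Src C (f \<^bold>+ g) = Src C g"
  "\<lbrakk>f \<in> Arr C; g \<in> Arr C; Src C f = Src C g; Tgt C f = Tgt C g\<rbrakk> \<Longrightarrow> Tgt C (f \<^bold>+ g) = Tgt C g"
  using plus_hom[of f "Src C f" "Tgt C f" g] by (auto simp: hom_iff)

lemma idn_comp [simp]: "\<lbrakk>f \<in> Arr C; Tgt C f = Y\<rbrakk> \<Longrightarrow> Idn C Y \<cdot> f = f"
  "\<lbrakk>f \<in> Arr C; Src C f = X\<rbrakk> \<Longrightarrow> f \<cdot> Idn C X = f"
  using idn_left idn_right by (auto simp: hom_iff)

lemma assoc_comp [simp]: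
  "\<lbrakk>f \<in> Arr C; g \<in> Arr C; h \<in> Arr C; Tgt C f = Src C g; Tgt C g = Src C h\<rbrakk>
    \<Longrightarrow> (h \<cdot> g) \<cdot> f = h \<cdot> g \<cdot> f"
  by (rule comp_assoc) (auto simp: hom_iff)

text \<open>
  Composites are normalised to be nested to the right, where a factor $h g$ is visible only as
  $h (g f)$. This is the form in which a known equation for $h g$ applies inside a longer composite.
\<close>

lemma comp_tail:
  assumes "h \<cdot> g = q" "f \<in> Arr C" "g \<in> Arr C" "h \<in> Arr C" "Tgt C f = Src C g" "Tgt C g = Src C h"
  shows "h \<cdot> g \<cdot> f = q \<cdot> f"
  using assms assoc_comp[of f g h] by simp

lemma idem_zero:
  assumes z: "z \<in> Hom C X Y" and "z \<^bold>+ z = z"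
  shows "z = Zero C X Y"
proof -
  obtain n where n: "n \<in> Hom C X Y" "z \<^bold>+ n = Zero C X Y" using plus_inverse[OF z] by blast
  then show ?thesis using plus_assoc[OF z z n(1)] plus_zero[OF z] assms(2) by simp
qed

lemma comp_zero_right:
  assumes g: "g \<in> Hom C Y Z" and X: "X \<in> Obj C"
  shows "g \<cdot> Zero C X Y = Zero C X Z"
proof (rule idem_zero)
  have z: "Zero C X Y \<in> Hom C X Y" using X hom_obj[OF g] by (auto intro: zero_hom)
  show "g \<cdot> Zero C X Y \<in> Hom C X Z" by (rule comp_hom[OF z g])
  show "g \<cdot> Zero C X Y \<^bold>+ g \<cdot> Zero C X Y = g \<cdot> Zero C X Y"
    using comp_plus_right[OF z z g] plus_zero[OF z] by simp
qed

lemma comp_zero_left: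
  assumes f: "f \<in> Hom C X Y" and Z: "Z \<in> Obj C"
  shows "Zero C Y Z \<cdot> f = Zero C X Z"
proof (rule idem_zero)
  have z: "Zero C Y Z \<in> Hom C Y Z" using Z hom_obj[OF f] by (auto intro: zero_hom)
  show "Zero C Y Z \<cdot> f \<in> Hom C X Z" by (rule comp_hom[OF f z])
  show "Zero C Y Z \<cdot> f \<^bold>+ Zero C Y Z \<cdot> f = Zero C Y Z \<cdot> f"
    using comp_plus_left[OF f z z] plus_zero[OF z] by simp
qed

lemma inverse_unique: "\<lbrakk>is_inverse C f g; is_inverse C f h\<rbrakk> \<Longrightarrow> g = h"
proof -
  assume a: "is_inverse C f g" "is_inverse C f h"
  then have t: "f \<in> Arr C" "g \<in> Arr C" "h \<in> Arr C" "Src C g = Tgt C f" "Tgt C g = Src C f"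
    "Src C h = Tgt C f" "Tgt C h = Src C f"
    by (auto simp: is_inverse_def hom_iff)
  have "h \<cdot> f = Idn C (Src C f)" "f \<cdot> g = Idn C (Tgt C f)" using a by (auto simp: is_inverse_def)
  then show "g = h" using assoc_comp[of g f h] t by simp
qed

lemma is_inverse_Inv: "is_iso C f \<Longrightarrow> is_inverse C f (Inv C f)"
  unfolding Inv_def by (rule theI') (auto simp: is_iso_def intro: inverse_unique)

lemma inv_simps [simp]:
  assumes "is_iso C f"
  shows "Inv C f \<in> Arr C" "Src C (Inv C f) = Tgt C f" "Tgt C (Inv C f) = Src C f"
    "Inv C f \<cdot> f = Idn C (Src C f)" "f \<cdot> Inv C f = Idn C (Tgt C f)"
  using is_inverse_Inv[OF assms] by (auto simp: is_inverse_def hom_iff)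

lemma iso_arr: "is_iso C f \<Longrightarrow> f \<in> Arr C"
  by (auto simp: is_iso_def is_inverse_def)

lemma inv_comp_cancel [simp]:
  assumes "is_iso C f" "h \<in> Arr C"
  shows "Tgt C h = Src C f \<Longrightarrow> Inv C f \<cdot> f \<cdot> h = h"
    and "Tgt C h = Tgt C f \<Longrightarrow> f \<cdot> Inv C f \<cdot> h = h"
proof -
  assume t: "Tgt C h = Src C f"
  have "Inv C f \<cdot> f \<cdot> h = (Inv C f \<cdot> f) \<cdot> h"
    using assms iso_arr[OF assms(1)] t by (intro assoc_comp[symmetric]) auto
  also have "\<dots> = h" using assms t by (simp del: assoc_comp)
  finally show "Inv C f \<cdot> f \<cdot> h = h" .
next
  assume t: "Tgt C h = Tgt C f"
  have "f \<cdot> Inv C f \<cdot> h = (f \<cdot> Inv C f) \<cdot> h"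
    using assms iso_arr[OF assms(1)] t by (intro assoc_comp[symmetric]) auto
  also have "\<dots> = h" using assms t by (simp del: assoc_comp)
  finally show "f \<cdot> Inv C f \<cdot> h = h" .
qed

lemma iso_cancel_left:
  assumes "is_iso C f" "u \<in> Arr C" "v \<in> Arr C" "Tgt C u = Src C f" "Tgt C v = Src C f" "f \<cdot> u = f \<cdot> v"
  shows "u = v"
proof -
  have "u = Inv C f \<cdot> f \<cdot> u" using assms(1,2,4) by simp
  also have "\<dots> = v" unfolding assms(6) using assms(1,3,5) by simp
  finally show ?thesis .
qed

lemma iso_cancel_right:
  assumes "is_iso C f" "u \<in> Arr C" "v \<in> Arr C" "Src C u = Tgt C f" "Src C v = Tgt C f" "u \<cdot> f = v \<cdot> f"
  shows "u = v"
proof -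
  have "u = (u \<cdot> f) \<cdot> Inv C f" using assms(1,2,4) iso_arr[OF assms(1)] by simp
  also have "\<dots> = v" unfolding assms(6) using assms(1,3,5) iso_arr[OF assms(1)] by simp
  finally show ?thesis .
qed

lemma iso_swap:
  assumes "is_iso C a" "is_iso C b" "f \<in> Arr C" "g \<in> Arr C" "Tgt C f = Src C a" "Src C f = Src C b"
    "Src C g = Tgt C b" "a \<cdot> f = g \<cdot> b"
  shows "f \<cdot> Inv C b = Inv C a \<cdot> g"
proof -
  note [simp] = assms(1-7) iso_arr[OF assms(1)] iso_arr[OF assms(2)]
  have "Inv C a \<cdot> g = Inv C a \<cdot> (g \<cdot> b) \<cdot> Inv C b" by simp
  also have "\<dots> = f \<cdot> Inv C b" unfolding assms(8)[symmetric] by simp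
  finally show ?thesis ..
qed

lemma is_isoI:
  assumes "f \<in> Hom C X Y" "g \<in> Hom C Y X" "g \<cdot> f = Idn C X" "f \<cdot> g = Idn C Y"
  shows "is_iso C f"
  using assms by (auto simp: is_iso_def is_inverse_def hom_iff)

lemma is_iso_idn [simp]: "X \<in> Obj C \<Longrightarrow> is_iso C (Idn C X)"
  by (rule is_isoI[of _ X X "Idn C X"]) (auto simp: hom_iff)

lemma is_iso_comp [simp]:
  assumes "is_iso C f" "is_iso C g" "Tgt C f = Src C g"
  shows "is_iso C (g \<cdot> f)"
  using assms iso_arr[OF assms(1)] iso_arr[OF assms(2)]
  by (intro is_isoI[of _ "Src C f" "Tgt C g" "Inv C f \<cdot> Inv C g"]) (auto simp: hom_iff)

lemma cokernel_epi:
  assumes "is_cokernel C f g"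
  shows "is_epi C g"
  unfolding is_epi_def
proof (intro conjI ballI impI)
  show g: "g \<in> Arr C" using assms by (auto simp: is_cokernel_def)
  fix W u v assume W: "W \<in> Obj C" and uv: "u \<in> Hom C (Tgt C g) W" "v \<in> Hom C (Tgt C g) W"
    and eq: "u \<cdot> g = v \<cdot> g"
  have f: "f \<in> Arr C" "Tgt C f = Src C g" "g \<cdot> f = Zero C (Src C f) (Tgt C g)"
    using assms by (auto simp: is_cokernel_def)
  have "(u \<cdot> g) \<cdot> f = Zero C (Src C f) W"
    using comp_zero_right[OF uv(1) src_obj[OF f(1)]] f g uv by (simp add: hom_iff)
  moreover have "u \<cdot> g \<in> Hom C (Tgt C f) W" using f g uv by (simp add: hom_iff)
  ultimately have "\<exists>!x. x \<in> Hom C (Tgt C g) W \<and> x \<cdot> g = u \<cdot> g"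
    using assms W unfolding is_cokernel_def by blast
  then show "u = v" using uv eq by metis
qed

lemma kernel_mono:
  assumes "is_kernel C g f"
  shows "is_mono C f"
  unfolding is_mono_def
proof (intro conjI ballI impI)
  show f: "f \<in> Arr C" using assms by (auto simp: is_kernel_def)
  fix W u v assume W: "W \<in> Obj C" and uv: "u \<in> Hom C W (Src C f)" "v \<in> Hom C W (Src C f)"
    and eq: "f \<cdot> u = f \<cdot> v"
  have g: "g \<in> Arr C" "Tgt C f = Src C g" "g \<cdot> f = Zero C (Src C f) (Tgt C g)"
    using assms by (auto simp: is_kernel_def)
  have "(g \<cdot> f) \<cdot> u = Zero C W (Tgt C g)"
    using comp_zero_left[OF uv(1) tgt_obj[OF g(1)]] g(3) by simp
  moreover have "(g \<cdot> f) \<cdot> u = g \<cdot> f \<cdot> u" using f g(1,2) uv by (intro assoc_comp) (auto simp: hom_iff)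
  ultimately have "g \<cdot> f \<cdot> u = Zero C W (Tgt C g)" by simp
  moreover have "f \<cdot> u \<in> Hom C W (Src C g)" using f g uv by (simp add: hom_iff)
  ultimately have "\<exists>!x. x \<in> Hom C W (Src C f) \<and> f \<cdot> x = f \<cdot> u"
    using assms W unfolding is_kernel_def by blast
  then show "u = v" using uv eq by metis
qed

lemma epi_cancel: 
  "\<lbrakk>is_epi C p; u \<in> Arr C; v \<in> Arr C; Src C u = Tgt C p; Src C v = Tgt C p; Tgt C u = Tgt C v; 
     u \<cdot> p = v \<cdot> p\<rbrakk> \<Longrightarrow> u = v"
  using tgt_obj[of u] by (auto simp: is_epi_def hom_iff Ball_def)

lemma mono_cancel: 
  "\<lbrakk>is_mono C p; u \<in> Arr C; v \<in> Arr C; Tgt C u = Src C p; Tgt C v = Src C p; Src C u = Src C v; 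
     p \<cdot> u = p \<cdot> v\<rbrakk> \<Longrightarrow> u = v"
  using src_obj[of u] by (auto simp: is_mono_def hom_iff Ball_def)

end


section \<open>Lifting along epimorphisms of modules\<close>

lemma mat_eq_on_vecI:
  fixes A B :: "'k::comm_ring_1 mat"
  assumes "A \<in> carrier_mat m n" "B \<in> carrier_mat m n"
    and eq: "\<And>v. v \<in> carrier_vec n \<Longrightarrow> A *\<^sub>v v = B *\<^sub>v v"
  shows "A = B"
proof (rule eq_matI)
  show "dim_row A = dim_row B" "dim_col A = dim_col B" using assms by auto
  fix i k assume ik: "i < dim_row B" "k < dim_col B"
  then have "(A *\<^sub>v unit_vec n k) $ i = (B *\<^sub>v unit_vec n k) $ i" using eq assms by simp
  moreover have "(X *\<^sub>v unit_vec n k) $ i = X $$ (i, k)" if "X \<in> carrier_mat m n" for X :: "'k mat"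
    using that ik assms(1,2) by (simp add: scalar_prod_right_unit[of k n "row X i"])
  ultimately show "A $$ (i, k) = B $$ (i, k)" using assms by metis
qed

lemma smult_mat_vec:
  fixes A :: "'k::comm_ring_1 mat"
  shows "\<lbrakk>A \<in> carrier_mat m l; v \<in> carrier_vec l\<rbrakk> \<Longrightarrow> (r \<cdot>\<^sub>m A) *\<^sub>v v = r \<cdot>\<^sub>v (A *\<^sub>v v)"
  by (rule eq_vecI) auto

lemma transpose_smult_mat: "(r \<cdot>\<^sub>m A)\<^sup>T = r \<cdot>\<^sub>m A\<^sup>T"
  by (rule eq_matI) auto

lemma mat_of_linear_map:
  fixes L :: "'k::field vec \<Rightarrow> 'k vec"
  assumes carrier: "\<And>v. v \<in> carrier_vec n \<Longrightarrow> L v \<in> carrier_vec m"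
    and add: "\<And>v w. \<lbrakk>v \<in> carrier_vec n; w \<in> carrier_vec n\<rbrakk> \<Longrightarrow> L (v + w) = L v + L w"
    and scale: "\<And>v c. v \<in> carrier_vec n \<Longrightarrow> L (c \<cdot>\<^sub>v v) = c \<cdot>\<^sub>v L v"
    and b: "b \<in> carrier_vec n"
  shows "mat m n (\<lambda>(i, k). L (unit_vec n k) $ i) *\<^sub>v b = L b"
proof -
  define t where "t r = vec n (\<lambda>i. if i < r then b $ i else 0)" for r
  have t: "t r \<in> carrier_vec n" for r by (simp add: t_def)
  have partial: "L (t r) $ i = (\<Sum>k<r. L (unit_vec n k) $ i * b $ k)" if "r \<le> n" "i < m" for r i
    using that(1)
  proof (induction r)
    case 0
    have "t 0 = 0 \<cdot>\<^sub>v t 0" by (auto simp: t_def)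
    then have "L (t 0) $ i = (0 \<cdot>\<^sub>v L (t 0)) $ i" using scale[OF t, of 0 0] by simp
    also have "\<dots> = 0" using carrier[OF t, of 0] that(2) by simp
    finally show ?case by simp
  next
    case (Suc r)
    have "t (Suc r) = t r + b $ r \<cdot>\<^sub>v unit_vec n r" using b Suc by (auto simp: t_def less_Suc_eq)
    then have "L (t (Suc r)) = L (t r) + b $ r \<cdot>\<^sub>v L (unit_vec n r)"
      using add[OF t[of r], of "b $ r \<cdot>\<^sub>v unit_vec n r"] scale[of "unit_vec n r" "b $ r"] by simp
    then show ?case using Suc carrier[OF t, of r] carrier[of "unit_vec n r"] that(2)
      by (simp add: mult.commute)
  qed
  have "t n = b" using b by (auto simp: t_def)
  then show ?thesis
    using partial[of n] b carrier[OF b]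
    by (intro eq_vecI) (auto simp: scalar_prod_def atLeast0LessThan)
qed

text \<open>
  A vector outside the span of $c_0, \dots, c_{n-1}$ is detected by a functional vanishing on all
  $c_j$. The proof adds the vectors one at a time: when the functional $l$ found so far does not
  vanish on the new vector $c_n$, project $y$ along $c_n$ onto the kernel of $l$, separate the
  projection by some $\mu$, and correct $\mu$ by a multiple of $l$.
\<close>

lemma separating_functional:
  fixes c :: "nat \<Rightarrow> nat \<Rightarrow> 'k::field"
  shows "(\<exists>x. \<forall>i<m. y i = (\<Sum>j<n. x j * c j i)) \<or>
    (\<exists>l. (\<forall>j<n. (\<Sum>i<m. l i * c j i) = 0) \<and> (\<Sum>i<m. l i * y i) \<noteq> 0)"
proof (induction n arbitrary: y)
  case 0
  show ?case
  proof (cases "\<exists>i<m. y i \<noteq> 0")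
    case True
    then obtain i where i: "i < m" "y i \<noteq> 0" by blast
    have "(\<Sum>i'<m. (if i' = i then 1 else 0) * y i') = (\<Sum>i'<m. if i' = i then y i' else 0)"
      by (rule sum.cong) auto
    also have "\<dots> \<noteq> 0" using i by simp
    finally show ?thesis by (intro disjI2 exI[of _ "\<lambda>i'. if i' = i then 1 else 0"]) simp
  qed simp
next
  case (Suc n)
  define pair where "pair l v = (\<Sum>i<m. l i * v i)" for l v :: "nat \<Rightarrow> 'k"
  show ?case
  proof (cases "\<exists>x. \<forall>i<m. y i = (\<Sum>j<n. x j * c j i)")
    case True
    then obtain x where "\<forall>i<m. y i = (\<Sum>j<n. x j * c j i)" by blast
    then show ?thesis by (intro disjI1 exI[of _ "x(n := 0)"]) simp
  next
    case False
    then obtain l where l: "\<forall>j<n. pair l (c j) = 0" "pair l y \<noteq> 0"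
      using Suc.IH[of y] unfolding pair_def by blast
    show ?thesis
    proof (cases "pair l (c n) = 0")
      case True
      then show ?thesis using l by (intro disjI2 exI[of _ l]) (auto simp: pair_def less_Suc_eq)
    next
      case False
      define q where "q = pair l y / pair l (c n)"
      define z where "z i = y i - q * c n i" for i
      show ?thesis
      proof (cases "\<exists>x. \<forall>i<m. z i = (\<Sum>j<n. x j * c j i)")
        case True
        then obtain x where "\<forall>i<m. z i = (\<Sum>j<n. x j * c j i)" by blast
        then have "\<forall>i<m. y i = (\<Sum>j<n. x j * c j i) + q * c n i"
          by (metis z_def diff_add_cancel)
        then show ?thesis by (intro disjI1 exI[of _ "x(n := q)"]) simp
      next
        case False
        then obtain \<mu> where \<mu>: "\<forall>j<n. pair \<mu> (c j) = 0" "pair \<mu> z \<noteq> 0"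
          using Suc.IH[of z] unfolding pair_def by blast
        define r where "r = pair \<mu> (c n) / pair l (c n)"
        define \<nu> where "\<nu> i = \<mu> i - r * l i" for i
        have \<nu>: "pair \<nu> v = pair \<mu> v - r * pair l v" for v
          by (simp add: pair_def \<nu>_def algebra_simps sum_subtractf sum_distrib_left)
        have "pair \<mu> z = pair \<mu> y - q * pair \<mu> (c n)"
          by (simp add: pair_def z_def algebra_simps sum_subtractf sum_distrib_left)
        also have "\<dots> = pair \<nu> y"
          using \<open>pair l (c n) \<noteq> 0\<close> by (simp add: \<nu> q_def r_def field_simps)
        finally have "pair \<nu> y \<noteq> 0" using \<mu> by simp
        moreover have "pair \<nu> (c n) = 0" using \<open>pair l (c n) \<noteq> 0\<close> by (simp add: \<nu> r_def)
        moreover have "\<forall>j<n. pair \<nu> (c j) = 0" using l \<mu> by (simp add: \<nu>)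
        ultimately show ?thesis
          by (intro disjI2 exI[of _ \<nu>]) (auto simp: pair_def less_Suc_eq)
      qed
    qed
  qed
qed

lemma mat_range_or_functional:
  fixes T :: "'k::field mat"
  assumes T: "T \<in> carrier_mat m n" and y: "y \<in> carrier_vec m"
  obtains x where "x \<in> carrier_vec n" "T *\<^sub>v x = y"
  | l where "l \<in> carrier_vec m" "T\<^sup>T *\<^sub>v l = 0\<^sub>v n" "l \<bullet> y \<noteq> 0"
proof -
  consider x where "\<forall>i<m. y $ i = (\<Sum>j<n. x j * T $$ (i, j))"
    | l where "\<forall>j<n. (\<Sum>i<m. l i * T $$ (i, j)) = 0" "(\<Sum>i<m. l i * y $ i) \<noteq> 0"
    using separating_functional[where m = m and n = n and y = "\<lambda>i. y $ i" and
        c = "\<lambda>j i. T $$ (i, j)"] by blast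
  then show thesis
  proof cases
    case (1 x)
    then have "T *\<^sub>v vec n x = y" using T y
      by (intro eq_vecI) (auto simp: scalar_prod_def atLeast0LessThan mult.commute)
    then show thesis using that(1)[of "vec n x"] by simp
  next
    case (2 l)
    have "T\<^sup>T *\<^sub>v vec m l = 0\<^sub>v n" using T 2(1)
      by (intro eq_vecI) (auto simp: scalar_prod_def atLeast0LessThan mult.commute)
    moreover have "vec m l \<bullet> y \<noteq> 0" using 2(2) y by (simp add: scalar_prod_def atLeast0LessThan)
    ultimately show thesis using that(2)[of "vec m l"] by simp
  qed
qed

context
  fixes n :: nat and mul :: "'k::field vec \<Rightarrow> 'k vec \<Rightarrow> 'k vec" and u :: "'k vec"
  assumes alg: "fd_algebra n mul u"
begin

lemma alg_carrier [simp]: "u \<in> carrier_vec n"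
  "\<lbrakk>a \<in> carrier_vec n; b \<in> carrier_vec n\<rbrakk> \<Longrightarrow> mul a b \<in> carrier_vec n"
  using alg by (auto simp: fd_algebra_def)

lemma alg_laws:
  "a \<in> carrier_vec n \<Longrightarrow> mul u a = a" "a \<in> carrier_vec n \<Longrightarrow> mul a u = a"
  "\<lbrakk>a \<in> carrier_vec n; b \<in> carrier_vec n; c \<in> carrier_vec n\<rbrakk> \<Longrightarrow> mul (mul a b) c = mul a (mul b c)"
  "\<lbrakk>a \<in> carrier_vec n; b \<in> carrier_vec n; c \<in> carrier_vec n\<rbrakk> \<Longrightarrow> mul (a + b) c = mul a c + mul b c"
  "\<lbrakk>a \<in> carrier_vec n; b \<in> carrier_vec n; c \<in> carrier_vec n\<rbrakk> \<Longrightarrow> mul a (b + c) = mul a b + mul a c"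
  "\<lbrakk>a \<in> carrier_vec n; b \<in> carrier_vec n\<rbrakk> \<Longrightarrow> mul (r \<cdot>\<^sub>v a) b = r \<cdot>\<^sub>v mul a b"
  "\<lbrakk>a \<in> carrier_vec n; b \<in> carrier_vec n\<rbrakk> \<Longrightarrow> mul a (r \<cdot>\<^sub>v b) = r \<cdot>\<^sub>v mul a b"
  using alg unfolding fd_algebra_def by blast+

definition left_mult_mat :: "'k vec \<Rightarrow> 'k mat" where
  "left_mult_mat a = mat n n (\<lambda>(i, k). mul a (unit_vec n k) $ i)"

definition right_mult_mat :: "'k vec \<Rightarrow> 'k mat" where
  "right_mult_mat a = mat n n (\<lambda>(i, k). mul (unit_vec n k) a $ i)"

lemma mult_mat_carrier [simp]:
  "left_mult_mat a \<in> carrier_mat n n" "right_mult_mat a \<in> carrier_mat n n"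
  by (simp_all add: left_mult_mat_def right_mult_mat_def)

lemma left_mult_mat_apply:
  "\<lbrakk>a \<in> carrier_vec n; b \<in> carrier_vec n\<rbrakk> \<Longrightarrow> left_mult_mat a *\<^sub>v b = mul a b"
  unfolding left_mult_mat_def by (rule mat_of_linear_map) (auto simp: alg_laws)

lemma right_mult_mat_apply:
  "\<lbrakk>a \<in> carrier_vec n; b \<in> carrier_vec n\<rbrakk> \<Longrightarrow> right_mult_mat a *\<^sub>v b = mul b a"
  unfolding right_mult_mat_def
  by (rule mat_of_linear_map[where L = "\<lambda>b. mul b a"]) (auto simp: alg_laws)

definition regular_module :: "'k fd_mod" where
  "regular_module = (n, left_mult_mat)"

text \<open>
  The space of linear functionals on the algebra with $(a \xi)(b) = \xi(b a)$. It is cofree: every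
  functional on a module $V$ induces a module map from $V$, see \<open>functional_mat\<close>.
\<close>

definition coregular_module :: "'k fd_mod" where
  "coregular_module = (n, \<lambda>a. (right_mult_mat a)\<^sup>T)"

lemma regular_module: "regular_module \<in> fd_modules n mul u"
  unfolding regular_module_def fd_modules_def
  by (auto intro!: mat_eq_on_vecI[of _ n n] mult_carrier_mat[of _ n n]
    simp: left_mult_mat_apply alg_laws add_mult_distrib_mat_vec[of _ n n]
      assoc_mult_mat_vec[of _ n n _ n] smult_mat_vec[of _ n n])

lemma right_mult_mat_laws:
  assumes "a \<in> carrier_vec n" "b \<in> carrier_vec n"
  shows "right_mult_mat (a + b) = right_mult_mat a + right_mult_mat b"
    "right_mult_mat (r \<cdot>\<^sub>v a) = r \<cdot>\<^sub>m right_mult_mat a"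
    "right_mult_mat (mul a b) = right_mult_mat b * right_mult_mat a"
  using assms by (auto intro!: mat_eq_on_vecI[of _ n n] mult_carrier_mat[of _ n n]
    simp: right_mult_mat_apply alg_laws add_mult_distrib_mat_vec[of _ n n]
      assoc_mult_mat_vec[of _ n n _ n] smult_mat_vec[of _ n n])

lemma right_mult_mat_one: "right_mult_mat u = 1\<^sub>m n"
  by (auto intro!: mat_eq_on_vecI[of _ n n] simp: right_mult_mat_apply alg_laws)

lemma coregular_module: "coregular_module \<in> fd_modules n mul u"
  unfolding coregular_module_def fd_modules_def
  by (auto simp: right_mult_mat_laws right_mult_mat_one transpose_smult_mat
      transpose_add[of _ n n] transpose_mult[of _ n n _ n])

lemma fd_modulesD:
  assumes "V \<in> fd_modules n mul u"
  shows "a \<in> carrier_vec n \<Longrightarrow> snd V a \<in> carrier_mat (fst V) (fst V)"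
    "\<lbrakk>a \<in> carrier_vec n; b \<in> carrier_vec n\<rbrakk> \<Longrightarrow> snd V (a + b) = snd V a + snd V b"
    "a \<in> carrier_vec n \<Longrightarrow> snd V (r \<cdot>\<^sub>v a) = r \<cdot>\<^sub>m snd V a"
    "\<lbrakk>a \<in> carrier_vec n; b \<in> carrier_vec n\<rbrakk> \<Longrightarrow> snd V (mul a b) = snd V a * snd V b"
    "snd V u = 1\<^sub>m (fst V)"
  using assms by (auto simp: fd_modules_def)

text \<open>
  The matrix of $b \mapsto b x$, a module map from the regular module to $V$.
\<close>

definition orbit_mat :: "'k fd_mod \<Rightarrow> 'k vec \<Rightarrow> 'k mat" where
  "orbit_mat V x = mat (fst V) n (\<lambda>(i, k). (snd V (unit_vec n k) *\<^sub>v x) $ i)"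

lemma orbit_mat_carrier [simp]: "orbit_mat V x \<in> carrier_mat (fst V) n"
  by (simp add: orbit_mat_def)

lemma orbit_mat_apply:
  assumes V: "V \<in> fd_modules n mul u" and x: "x \<in> carrier_vec (fst V)" and b: "b \<in> carrier_vec n"
  shows "orbit_mat V x *\<^sub>v b = snd V b *\<^sub>v x"
  unfolding orbit_mat_def
  by (rule mat_of_linear_map)
    (use x b in \<open>auto simp: fd_modulesD[OF V] add_mult_distrib_mat_vec[of _ "fst V" "fst V"]
      smult_mat_vec[of _ "fst V" "fst V"] intro!: mult_mat_vec_carrier[of _ "fst V" "fst V"]\<close>)

lemma orbit_mat_intertwines:
  assumes V: "V \<in> fd_modules n mul u" and x: "x \<in> carrier_vec (fst V)" and a: "a \<in> carrier_vec n"
  shows "orbit_mat V x * left_mult_mat a = snd V a * orbit_mat V x"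
proof (rule mat_eq_on_vecI[of _ "fst V" n])
  have Va: "snd V b \<in> carrier_mat (fst V) (fst V)" if "b \<in> carrier_vec n" for b
    using fd_modulesD(1)[OF V that] .
  show "orbit_mat V x * left_mult_mat a \<in> carrier_mat (fst V) n"
    "snd V a * orbit_mat V x \<in> carrier_mat (fst V) n"
    by (rule mult_carrier_mat[OF orbit_mat_carrier mult_mat_carrier(1)],
      rule mult_carrier_mat[OF Va[OF a] orbit_mat_carrier])
  fix b :: "'k vec" assume b: "b \<in> carrier_vec n"
  have "orbit_mat V x * left_mult_mat a *\<^sub>v b = snd V (mul a b) *\<^sub>v x"
    using a b by (simp add: assoc_mult_mat_vec[of _ "fst V" n _ n] left_mult_mat_apply
        orbit_mat_apply[OF V x])
  also have "\<dots> = snd V a *\<^sub>v (snd V b *\<^sub>v x)"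
    using Va[OF a] Va[OF b] a b x
    by (simp add: fd_modulesD(4)[OF V] assoc_mult_mat_vec[of _ "fst V" "fst V" _ "fst V"])
  also have "\<dots> = snd V a * orbit_mat V x *\<^sub>v b"
    using Va[OF a] b x
    by (simp add: assoc_mult_mat_vec[of _ "fst V" "fst V" _ n] orbit_mat_apply[OF V])
  finally show "orbit_mat V x * left_mult_mat a *\<^sub>v b = snd V a * orbit_mat V x *\<^sub>v b" .
qed

text \<open>
  The matrix of $y \mapsto (b \mapsto l(b y))$, a module map from $V$ to the coregular module. It is
  given through its transpose, the matrix of the linear map $b \mapsto \rho(b)^T l$.
\<close>

definition functional_mat :: "'k fd_mod \<Rightarrow> 'k vec \<Rightarrow> 'k mat" where
  "functional_mat V l = (mat (fst V) n (\<lambda>(i, k). ((snd V (unit_vec n k))\<^sup>T *\<^sub>v l) $ i))\<^sup>T"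

lemma functional_mat_carrier [simp]: "functional_mat V l \<in> carrier_mat n (fst V)"
  by (simp add: functional_mat_def)

lemma functional_mat_apply:
  assumes V: "V \<in> fd_modules n mul u" and l: "l \<in> carrier_vec (fst V)" and b: "b \<in> carrier_vec n"
  shows "(functional_mat V l)\<^sup>T *\<^sub>v b = (snd V b)\<^sup>T *\<^sub>v l"
  unfolding functional_mat_def transpose_transpose
  by (rule mat_of_linear_map[where L = "\<lambda>b. (snd V b)\<^sup>T *\<^sub>v l"])
    (use l b in \<open>auto simp: fd_modulesD[OF V] transpose_smult_mat
      transpose_add[of _ "fst V" "fst V"] add_mult_distrib_mat_vec[of _ "fst V" "fst V"]
      smult_mat_vec[of _ "fst V" "fst V"] intro!: mult_mat_vec_carrier[of _ "fst V" "fst V"]\<close>)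

lemma functional_mat_intertwines:
  assumes V: "V \<in> fd_modules n mul u" and l: "l \<in> carrier_vec (fst V)" and a: "a \<in> carrier_vec n"
  shows "functional_mat V l * snd V a = (right_mult_mat a)\<^sup>T * functional_mat V l"
proof -
  have Va: "snd V b \<in> carrier_mat (fst V) (fst V)" if "b \<in> carrier_vec n" for b
    using fd_modulesD(1)[OF V that] .
  let ?U = "functional_mat V l"
  have U: "?U\<^sup>T \<in> carrier_mat (fst V) n" by simp
  have "(snd V a)\<^sup>T * ?U\<^sup>T = ?U\<^sup>T * right_mult_mat a"
  proof (rule mat_eq_on_vecI[of _ "fst V" n])
    show "(snd V a)\<^sup>T * ?U\<^sup>T \<in> carrier_mat (fst V) n" "?U\<^sup>T * right_mult_mat a \<in> carrier_mat (fst V) n"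
      using Va[OF a] by (auto intro: mult_carrier_mat[OF _ U] mult_carrier_mat[OF U])
    fix b :: "'k vec" assume b: "b \<in> carrier_vec n"
    have "(snd V a)\<^sup>T * ?U\<^sup>T *\<^sub>v b = (snd V a)\<^sup>T *\<^sub>v ((snd V b)\<^sup>T *\<^sub>v l)"
      using Va[OF a] b l U
      by (simp add: assoc_mult_mat_vec[of _ "fst V" "fst V" _ n] functional_mat_apply[OF V])
    also have "\<dots> = (snd V b * snd V a)\<^sup>T *\<^sub>v l"
      using Va[OF a] Va[OF b] l
      by (simp add: transpose_mult[of _ "fst V" "fst V" _ "fst V"]
          assoc_mult_mat_vec[of _ "fst V" "fst V" _ "fst V"])
    also have "\<dots> = ?U\<^sup>T *\<^sub>v mul b a"
      using a b l by (simp add: functional_mat_apply[OF V] fd_modulesD(4)[OF V])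
    also have "\<dots> = ?U\<^sup>T * right_mult_mat a *\<^sub>v b"
      using a b U by (simp add: assoc_mult_mat_vec[of _ "fst V" n _ n] right_mult_mat_apply)
    finally show "(snd V a)\<^sup>T * ?U\<^sup>T *\<^sub>v b = ?U\<^sup>T * right_mult_mat a *\<^sub>v b" .
  qed
  then have "((snd V a)\<^sup>T * ?U\<^sup>T)\<^sup>T = (?U\<^sup>T * right_mult_mat a)\<^sup>T" by simp
  then show ?thesis using Va[OF a] U
    by (simp add: transpose_mult[of _ "fst V" "fst V" _ n] transpose_mult[of _ "fst V" n _ n])
qed

lemma mod_cat_hom_iff:
  "(V, T, W) \<in> Hom (mod_cat n mul u) V' W' \<longleftrightarrow> V = V' \<and> W = W' \<and>
     V \<in> fd_modules n mul u \<and> W \<in> fd_modules n mul u \<and> T \<in> carrier_mat (fst W) (fst V) \<and>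
     (\<forall>a\<in>carrier_vec n. T * snd V a = snd W a * T)"
  by (auto simp: Hom_def mod_cat_def)

lemma mod_cat_homE:
  assumes "t \<in> Hom (mod_cat n mul u) V W"
  obtains T where "t = (V, T, W)" "V \<in> fd_modules n mul u" "W \<in> fd_modules n mul u"
    "T \<in> carrier_mat (fst W) (fst V)" "\<And>a. a \<in> carrier_vec n \<Longrightarrow> T * snd V a = snd W a * T"
  using assms by (cases t) (auto simp: mod_cat_hom_iff)

lemma mod_cat_comp [simp]:
  "Comp (mod_cat n mul u) (V', T', W') (V, T, W) = (V, T' * T, W')"
  by (simp add: mod_cat_def)

text \<open>
  A vector $y$ outside the image would be separated from it by a functional $l$. The induced map to
  the coregular module vanishes on the image, which is a submodule, hence is zero because the
  morphism is epic; but evaluating it at $y$ and the unit of the algebra gives $l(y) \neq 0$.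
\<close>

lemma mod_cat_epi_surj:
  assumes p: "(X, T, Y) \<in> Hom (mod_cat n mul u) X Y" and epi: "is_epi (mod_cat n mul u) (X, T, Y)"
    and y: "y \<in> carrier_vec (fst Y)"
  shows "\<exists>x\<in>carrier_vec (fst X). T *\<^sub>v x = y"
proof -
  have X: "X \<in> fd_modules n mul u" and Y: "Y \<in> fd_modules n mul u"
    and T: "T \<in> carrier_mat (fst Y) (fst X)"
    and comm: "\<And>a. a \<in> carrier_vec n \<Longrightarrow> T * snd X a = snd Y a * T"
    using p by (auto simp: mod_cat_hom_iff)
  show ?thesis
  proof (rule mat_range_or_functional[OF T y])
    fix l assume l: "l \<in> carrier_vec (fst Y)" "T\<^sup>T *\<^sub>v l = 0\<^sub>v (fst X)" "l \<bullet> y \<noteq> 0"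
    let ?U = "functional_mat Y l" and ?Z = coregular_module
    let ?O = "0\<^sub>m n (fst Y) :: 'k mat"
    have Z: "?Z \<in> fd_modules n mul u" "fst ?Z = n" by (rule coregular_module) (simp add: coregular_module_def)
    have "(?U * T)\<^sup>T = 0\<^sub>m (fst X) n"
    proof (rule mat_eq_on_vecI[of _ "fst X" n])
      show "(?U * T)\<^sup>T \<in> carrier_mat (fst X) n"
        using T by (simp add: mult_carrier_mat[of _ _ "fst Y"])
      fix b :: "'k vec" assume b: "b \<in> carrier_vec n"
      note Xb = fd_modulesD(1)[OF X b] and Yb = fd_modulesD(1)[OF Y b]
      have "(?U * T)\<^sup>T *\<^sub>v b = T\<^sup>T *\<^sub>v ((snd Y b)\<^sup>T *\<^sub>v l)"
        using T l b by (simp add: transpose_mult[of _ n "fst Y" _ "fst X"]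
            assoc_mult_mat_vec[of _ "fst X" "fst Y" _ n] functional_mat_apply[OF Y])
      also have "\<dots> = (snd Y b * T)\<^sup>T *\<^sub>v l"
        using T l Yb by (simp add: transpose_mult[of _ "fst Y" "fst Y" _ "fst X"]
            assoc_mult_mat_vec[of _ "fst X" "fst Y" _ "fst Y"])
      also have "\<dots> = (snd X b)\<^sup>T *\<^sub>v (T\<^sup>T *\<^sub>v l)"
        using T l Xb unfolding comm[OF b, symmetric]
        by (simp add: transpose_mult[of _ "fst Y" "fst X" _ "fst X"]
            assoc_mult_mat_vec[of _ "fst X" "fst X" _ "fst Y"])
      also have "\<dots> = 0\<^sub>m (fst X) n *\<^sub>v b" using l b Xb by (auto simp: l(2))
      finally show "(?U * T)\<^sup>T *\<^sub>v b = 0\<^sub>m (fst X) n *\<^sub>v b" .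
    qed simp
    then have UT: "?U * T = 0\<^sub>m n (fst X)" by (metis transpose_transpose zero_transpose_mat)
    have U: "(Y, ?U, ?Z) \<in> Hom (mod_cat n mul u) Y ?Z"
      using Y Z functional_mat_intertwines[OF Y l(1)]
      by (simp add: mod_cat_hom_iff) (simp add: coregular_module_def)
    have O: "(Y, ?O, ?Z) \<in> Hom (mod_cat n mul u) Y ?Z"
      using Y Z fd_modulesD(1)[OF Y] fd_modulesD(1)[OF Z(1)]
      by (auto simp: mod_cat_hom_iff left_mult_zero_mat[of _ "fst Y"] right_mult_zero_mat[of _ n n])
    have "?O * T = ?U * T" using T UT by simp
    then have "(Y, ?U, ?Z) = (Y, ?O, ?Z)"
      using epi U O Z(1) by (force simp: is_epi_def mod_cat_def)
    then have "?U = ?O" by simp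
    moreover have "l = ?U\<^sup>T *\<^sub>v u" using l fd_modulesD(5)[OF Y] by (simp add: functional_mat_apply[OF Y])
    ultimately have "l = 0\<^sub>v (fst Y)" by auto
    then show ?thesis using l(3) y by simp
  qed auto
qed

text \<open>
  Every element $x$ of $A$ is the image of the unit under the module map $b \mapsto b x$ from the regular
  module, and this map lifts through $p$ as $b \mapsto b y$ for any $y$ with $p(y) = h(x)$.
\<close>

lemma mod_cat_joint_epi:
  assumes epi: "is_epi (mod_cat n mul u) p" and p: "p \<in> Hom (mod_cat n mul u) X Y"
    and h: "h \<in> Hom (mod_cat n mul u) A Y"
    and v: "v \<in> Hom (mod_cat n mul u) A Z" and w: "w \<in> Hom (mod_cat n mul u) A Z"
    and eq: "\<And>P e s. \<lbrakk>e \<in> Hom (mod_cat n mul u) P A; s \<in> Hom (mod_cat n mul u) P X;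
      Comp (mod_cat n mul u) p s = Comp (mod_cat n mul u) h e\<rbrakk> \<Longrightarrow>
      Comp (mod_cat n mul u) v e = Comp (mod_cat n mul u) w e"
  shows "v = w"
proof -
  obtain T where T: "p = (X, T, Y)" "X \<in> fd_modules n mul u" "Y \<in> fd_modules n mul u"
    "T \<in> carrier_mat (fst Y) (fst X)" "\<And>a. a \<in> carrier_vec n \<Longrightarrow> T * snd X a = snd Y a * T"
    by (rule mod_cat_homE[OF p]) blast
  obtain H where H: "h = (A, H, Y)" "A \<in> fd_modules n mul u"
    "H \<in> carrier_mat (fst Y) (fst A)" "\<And>a. a \<in> carrier_vec n \<Longrightarrow> H * snd A a = snd Y a * H"
    by (rule mod_cat_homE[OF h]) blast
  obtain V where V: "v = (A, V, Z)" "V \<in> carrier_mat (fst Z) (fst A)"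
    by (rule mod_cat_homE[OF v]) blast
  obtain W where W: "w = (A, W, Z)" "W \<in> carrier_mat (fst Z) (fst A)"
    by (rule mod_cat_homE[OF w]) blast
  let ?R = regular_module
  have R: "?R \<in> fd_modules n mul u" "fst ?R = n" "snd ?R = left_mult_mat"
    by (rule regular_module) (simp_all add: regular_module_def)
  have "V = W"
  proof (rule mat_eq_on_vecI[OF V(2) W(2)])
    fix x :: "'k vec" assume x: "x \<in> carrier_vec (fst A)"
    have "H *\<^sub>v x \<in> carrier_vec (fst Y)" using H(3) x by simp
    then obtain y where y: "y \<in> carrier_vec (fst X)" "T *\<^sub>v y = H *\<^sub>v x"
      using mod_cat_epi_surj[of X T Y] p epi T(1) by blast
    let ?e = "orbit_mat A x" and ?s = "orbit_mat X y"
    have e: "(?R, ?e, A) \<in> Hom (mod_cat n mul u) ?R A"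
      using R H(2) x orbit_mat_intertwines by (auto simp: mod_cat_hom_iff)
    have s: "(?R, ?s, X) \<in> Hom (mod_cat n mul u) ?R X"
      using R T(2) y(1) orbit_mat_intertwines by (auto simp: mod_cat_hom_iff)
    have "T * ?s = H * ?e"
    proof (rule mat_eq_on_vecI[of _ "fst Y" n])
      show "T * ?s \<in> carrier_mat (fst Y) n" "H * ?e \<in> carrier_mat (fst Y) n"
        using T(4) H(3) by (auto intro!: mult_carrier_mat[of _ _ "fst X"] mult_carrier_mat[of _ _ "fst A"])
      fix b :: "'k vec" assume b: "b \<in> carrier_vec n"
      note Xb = fd_modulesD(1)[OF T(2) b] and Yb = fd_modulesD(1)[OF T(3) b]
        and Ab = fd_modulesD(1)[OF H(2) b]
      have "T * ?s *\<^sub>v b = T *\<^sub>v (snd X b *\<^sub>v y)"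
        using T y b by (simp add: assoc_mult_mat_vec[of _ "fst Y" "fst X" _ n] orbit_mat_apply)
      also have "\<dots> = (T * snd X b) *\<^sub>v y"
        using T(4) y Xb by (simp add: assoc_mult_mat_vec[of _ "fst Y" "fst X" _ "fst X"])
      also have "\<dots> = snd Y b *\<^sub>v (H *\<^sub>v x)"
        using T(4) y Yb by (simp add: T(5)[OF b] assoc_mult_mat_vec[of _ "fst Y" "fst Y" _ "fst X"])
      also have "\<dots> = (H * snd A b) *\<^sub>v x"
        using H(3) x Yb by (simp add: H(4)[OF b] assoc_mult_mat_vec[of _ "fst Y" "fst Y" _ "fst A"])
      also have "\<dots> = H *\<^sub>v (?e *\<^sub>v b)"
        using H(2,3) x b Ab
        by (simp add: assoc_mult_mat_vec[of _ "fst Y" "fst A" _ "fst A"] orbit_mat_apply)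
      also have "\<dots> = H * ?e *\<^sub>v b"
        using H(3) b by (simp add: assoc_mult_mat_vec[of _ "fst Y" "fst A" _ n])
      finally show "T * ?s *\<^sub>v b = H * ?e *\<^sub>v b" .
    qed
    then have "Comp (mod_cat n mul u) v (?R, ?e, A) = Comp (mod_cat n mul u) w (?R, ?e, A)"
      using eq[OF e s] T(1) H(1) by simp
    then have "V * ?e *\<^sub>v u = W * ?e *\<^sub>v u" using V W by simp
    then have "V *\<^sub>v (?e *\<^sub>v u) = W *\<^sub>v (?e *\<^sub>v u)"
      using V(2) W(2) by (simp add: assoc_mult_mat_vec[of _ "fst Z" "fst A" _ n])
    then show "V *\<^sub>v x = W *\<^sub>v x"
      using x H(2) by (simp add: orbit_mat_apply fd_modulesD(5))
  qed
  then show ?thesis using V W by simp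
qed

lemma mod_cat_idn_right:
  assumes "f \<in> Hom (mod_cat n mul u) V W"
  shows "Comp (mod_cat n mul u) f (Idn (mod_cat n mul u) V) = f"
  using assms by (elim mod_cat_homE) (simp add: mod_cat_def)

lemma mod_cat_comp_hom:
  assumes "f \<in> Hom (mod_cat n mul u) V W" "g \<in> Hom (mod_cat n mul u) W Z"
  shows "Comp (mod_cat n mul u) g f \<in> Hom (mod_cat n mul u) V Z"
proof -
  obtain T where f: "f = (V, T, W)" "V \<in> fd_modules n mul u" "W \<in> fd_modules n mul u"
    "T \<in> carrier_mat (fst W) (fst V)" "\<And>a. a \<in> carrier_vec n \<Longrightarrow> T * snd V a = snd W a * T"
    by (rule mod_cat_homE[OF assms(1)]) blast
  obtain U where g: "g = (W, U, Z)" "Z \<in> fd_modules n mul u"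
    "U \<in> carrier_mat (fst Z) (fst W)" "\<And>a. a \<in> carrier_vec n \<Longrightarrow> U * snd W a = snd Z a * U"
    by (rule mod_cat_homE[OF assms(2)]) blast
  have "U * T * snd V a = snd Z a * (U * T)" if a: "a \<in> carrier_vec n" for a
  proof -
    note m = fd_modulesD(1)[OF f(2) a] fd_modulesD(1)[OF f(3) a] fd_modulesD(1)[OF g(2) a]
    have "U * T * snd V a = U * (snd W a * T)"
      unfolding f(5)[OF a, symmetric] by (rule assoc_mult_mat[OF g(3) f(4) m(1)])
    also have "\<dots> = (snd Z a * U) * T"
      unfolding g(4)[OF a, symmetric] by (rule assoc_mult_mat[OF g(3) m(2) f(4), symmetric])
    also have "\<dots> = snd Z a * (U * T)"
      by (rule assoc_mult_mat[OF m(3) g(3) f(4)])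
    finally show ?thesis .
  qed
  then show ?thesis using f g by (auto simp: mod_cat_hom_iff)
qed

lemma mod_cat_comp_assoc:
  assumes "f \<in> Hom (mod_cat n mul u) W X" "g \<in> Hom (mod_cat n mul u) X Y"
    "h \<in> Hom (mod_cat n mul u) Y Z"
  shows "Comp (mod_cat n mul u) (Comp (mod_cat n mul u) h g) f =
    Comp (mod_cat n mul u) h (Comp (mod_cat n mul u) g f)"
  using assms(1,2,3)
  by (elim mod_cat_homE) simp

end


section \<open>Lifting along epimorphisms in finite abelian categories\<close>

context finite_abelian_category begin

text \<open>
  This stands in for the stability of epimorphisms under pullback: the morphisms $e$ into $A$ for
  which $h e$ lifts along the epimorphism $p$ are jointly epimorphic. The property only involves
  composition, so it transports from modules along the equivalence.
\<close>

lemma epi_joint_epi: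
  assumes epi: "is_epi C p" and p: "p \<in> Hom C X Y" and h: "h \<in> Hom C A Y"
    and v: "v \<in> Hom C A Z" and w: "w \<in> Hom C A Z"
    and eq: "\<And>P e s. \<lbrakk>e \<in> Hom C P A; s \<in> Hom C P X; p \<cdot> s = h \<cdot> e\<rbrakk> \<Longrightarrow> v \<cdot> e = w \<cdot> e"
  shows "v = w"
proof -
  obtain n mul u F G \<eta> \<epsilon> where alg: "fd_algebra n mul u"
    and FG: "is_linear_functor C (mod_cat n mul u) F" "is_linear_functor (mod_cat n mul u) C G"
      "is_nat_iso C C id_fctr (comp_fctr G F) \<eta>"
      "is_nat_iso (mod_cat n mul u) (mod_cat n mul u) (comp_fctr F G) id_fctr \<epsilon>"
    using equivalent_to_modules unfolding lin_equivalent_def by blast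
  let ?D = "mod_cat n mul u"
  have Fhom: "FArr F f \<in> Hom ?D (FObj F V) (FObj F W)" if "f \<in> Hom C V W" for f V W
    using FG(1) that by (auto simp: is_linear_functor_def is_functor_def hom_iff)
  have Fcomp: "FArr F (g \<cdot> f) = Comp ?D (FArr F g) (FArr F f)" if "f \<in> Hom C V W" "g \<in> Hom C W W'"
    for f g V W W'
    using FG(1) that by (auto simp: is_linear_functor_def is_functor_def hom_iff)
  have Ghom: "FArr G f \<in> Hom C (FObj G V) (FObj G W)" if "f \<in> Hom ?D V W" for f V W
    using FG(2) that by (auto simp: is_linear_functor_def is_functor_def Hom_def)
  have Gcomp: "FArr G (Comp ?D g f) = FArr G g \<cdot> FArr G f" if "f \<in> Hom ?D V W" "g \<in> Hom ?D W W'"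
    for f g V W W'
    using FG(2) that by (auto simp: is_linear_functor_def is_functor_def Hom_def)
  have eta: "\<eta> V \<in> Hom C V (FObj G (FObj F V))" "is_iso C (\<eta> V)" if "V \<in> Obj C" for V
    using FG(3) that by (auto simp: is_nat_iso_def id_fctr_def comp_fctr_def)
  have eta_nat: "\<eta> W \<cdot> f = FArr G (FArr F f) \<cdot> \<eta> V" if "f \<in> Hom C V W" for f V W
    using FG(3) that by (auto simp: is_nat_iso_def id_fctr_def comp_fctr_def hom_iff)
  have G_faithful: "a = b" if ab: "a \<in> Hom ?D V W" "b \<in> Hom ?D V W" "FArr G a = FArr G b" for a b V W
  proof -
    have V: "V \<in> Obj ?D" using ab(1) by (auto simp: mod_cat_def Hom_def)
    obtain i where e: "\<epsilon> V \<in> Hom ?D (FObj F (FObj G V)) V" and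
      i: "i \<in> Hom ?D V (FObj F (FObj G V))" "Comp ?D (\<epsilon> V) i = Idn ?D V"
      using FG(4) V by (force simp: is_nat_iso_def id_fctr_def comp_fctr_def is_iso_def
          is_inverse_def Hom_def)
    have "Comp ?D c (\<epsilon> V) = Comp ?D (\<epsilon> W) (FArr F (FArr G c))" if "c \<in> Hom ?D V W" for c
      using FG(4) that by (auto simp: is_nat_iso_def id_fctr_def comp_fctr_def Hom_def)
    then have "Comp ?D (Comp ?D a (\<epsilon> V)) i = Comp ?D (Comp ?D b (\<epsilon> V)) i"
      using ab by simp
    then have "Comp ?D a (Idn ?D V) = Comp ?D b (Idn ?D V)"
      using mod_cat_comp_assoc[OF alg i(1) e ab(1)] mod_cat_comp_assoc[OF alg i(1) e ab(2)] i(2)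
      by simp
    then show ?thesis
      using mod_cat_idn_right[OF alg ab(1)] mod_cat_idn_right[OF alg ab(2)] by simp
  qed
  have X: "X \<in> Obj C" "Y \<in> Obj C" "A \<in> Obj C" "Z \<in> Obj C" using hom_obj p h v by auto
  note hX = eta[OF X(1), unfolded hom_iff] and hY = eta[OF X(2), unfolded hom_iff]
    and hA = eta[OF X(3), unfolded hom_iff] and hZ = eta[OF X(4), unfolded hom_iff]
  \<comment> \<open>Naturality of \<open>\<eta>\<close> moves an equation \<open>r \<cdot> F p = t \<cdot> F p\<close> in the module category back to one between
    morphisms precomposed with \<open>p\<close> itself.\<close>
  have F_epi: "is_epi ?D (FArr F p)"
    unfolding is_epi_def
  proof (intro conjI ballI impI)
    show "FArr F p \<in> Arr ?D" using Fhom[OF p] by (simp add: Hom_def)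
    fix W r t
    assume "W \<in> Obj ?D" "r \<in> Hom ?D (Tgt ?D (FArr F p)) W" "t \<in> Hom ?D (Tgt ?D (FArr F p)) W"
      and rt: "Comp ?D r (FArr F p) = Comp ?D t (FArr F p)"
    then have r: "r \<in> Hom ?D (FObj F Y) W" and t: "t \<in> Hom ?D (FObj F Y) W"
      using Fhom[OF p] by (auto simp: Hom_def)
    note T = Ghom[OF r, unfolded hom_iff] Ghom[OF t, unfolded hom_iff]
      Ghom[OF Fhom[OF p], unfolded hom_iff] p[unfolded hom_iff]
    have "FArr G r \<cdot> FArr G (FArr F p) = FArr G t \<cdot> FArr G (FArr F p)"
      using Gcomp[OF Fhom[OF p] r] Gcomp[OF Fhom[OF p] t] rt by simp
    then have "(FArr G r \<cdot> FArr G (FArr F p)) \<cdot> \<eta> X = (FArr G t \<cdot> FArr G (FArr F p)) \<cdot> \<eta> X"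
      by simp
    then have "(FArr G r \<cdot> \<eta> Y) \<cdot> p = (FArr G t \<cdot> \<eta> Y) \<cdot> p"
      using T hX hY by (simp add: eta_nat[OF p])
    then have "FArr G r \<cdot> \<eta> Y = FArr G t \<cdot> \<eta> Y"
      using T hY by - (rule epi_cancel[OF epi], auto)
    then have "FArr G r = FArr G t"
      using T hY by - (rule iso_cancel_right[OF hY(2)], auto)
    then show "r = t" by (rule G_faithful[OF r t])
  qed
  have "FArr F v = FArr F w"
  proof (rule mod_cat_joint_epi[OF alg F_epi Fhom[OF p] Fhom[OF h] Fhom[OF v] Fhom[OF w]])
    fix P e s
    assume e: "e \<in> Hom ?D P (FObj F A)" and s: "s \<in> Hom ?D P (FObj F X)"
      and es: "Comp ?D (FArr F p) s = Comp ?D (FArr F h) e"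
    \<comment> \<open>The unit of the equivalence turns \<open>G e\<close> and \<open>G s\<close> into morphisms with targets \<open>A\<close> and \<open>X\<close>.\<close>
    define e' where "e' = Inv C (\<eta> A) \<cdot> FArr G e"
    define s' where "s' = Inv C (\<eta> X) \<cdot> FArr G s"
    note T = Ghom[OF e, unfolded hom_iff] Ghom[OF s, unfolded hom_iff]
    have e': "e' \<in> Hom C (FObj G P) A" and s': "s' \<in> Hom C (FObj G P) X"
      using T hA hX by (auto simp: hom_iff e'_def s'_def)
    have nat_e: "\<eta> W \<cdot> f \<cdot> e' = FArr G (Comp ?D (FArr F f) e)" if f: "f \<in> Hom C A W" for f W
    proof -
      have "\<eta> W \<cdot> f \<cdot> e' = FArr G (FArr F f) \<cdot> \<eta> A \<cdot> e'"
        using eta[OF hom_obj[OF f, THEN conjunct2], unfolded hom_iff] f e' hA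
          Ghom[OF Fhom[OF f]]
        by (simp add: comp_tail[OF eta_nat[OF f]] hom_iff)
      also have "\<dots> = FArr G (Comp ?D (FArr F f) e)"
        using T hA Gcomp[OF e Fhom[OF f]] by (simp add: e'_def)
      finally show ?thesis .
    qed
    have nat_s: "\<eta> W \<cdot> f \<cdot> s' = FArr G (Comp ?D (FArr F f) s)" if f: "f \<in> Hom C X W" for f W
    proof -
      have "\<eta> W \<cdot> f \<cdot> s' = FArr G (FArr F f) \<cdot> \<eta> X \<cdot> s'"
        using eta[OF hom_obj[OF f, THEN conjunct2], unfolded hom_iff] f s' hX
          Ghom[OF Fhom[OF f]]
        by (simp add: comp_tail[OF eta_nat[OF f]] hom_iff)
      also have "\<dots> = FArr G (Comp ?D (FArr F f) s)"
        using T hX Gcomp[OF s Fhom[OF f]] by (simp add: s'_def)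
      finally show ?thesis .
    qed
    have "\<eta> Y \<cdot> p \<cdot> s' = \<eta> Y \<cdot> h \<cdot> e'" using nat_s[OF p] nat_e[OF h] es by simp
    then have "p \<cdot> s' = h \<cdot> e'"
      using hY p h e' s' by - (rule iso_cancel_left[OF hY(2)], auto simp: hom_iff)
    then have "v \<cdot> e' = w \<cdot> e'" by (rule eq[OF e' s'])
    then have "FArr G (Comp ?D (FArr F v) e) = FArr G (Comp ?D (FArr F w) e)"
      using nat_e[OF v] nat_e[OF w] by simp
    then show "Comp ?D (FArr F v) e = Comp ?D (FArr F w) e"
    proof (rule G_faithful[rotated 2])
      show "Comp ?D (FArr F v) e \<in> Hom ?D P (FObj F Z)" "Comp ?D (FArr F w) e \<in> Hom ?D P (FObj F Z)"
        using mod_cat_comp_hom[OF alg e Fhom[OF v]] mod_cat_comp_hom[OF alg e Fhom[OF w]] by auto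
    qed
  qed
  then have "\<eta> Z \<cdot> v = \<eta> Z \<cdot> w" using eta_nat[OF v] eta_nat[OF w] by simp
  then show "v = w" using hZ v w by - (rule iso_cancel_left[OF hZ(2)], auto simp: hom_iff)
qed

end


section \<open>Coherence of the unit constraints\<close>

context linear_monoidal_category begin

lemma arr_tensor [simp]:
  "\<lbrakk>f \<in> Arr C; g \<in> Arr C\<rbrakk> \<Longrightarrow> f \<otimes>\<^sub>a g \<in> Arr C"
  "\<lbrakk>f \<in> Arr C; g \<in> Arr C\<rbrakk> \<Longrightarrow> Src C (f \<otimes>\<^sub>a g) = Src C f \<otimes>\<^sub>o Src C g"
  "\<lbrakk>f \<in> Arr C; g \<in> Arr C\<rbrakk> \<Longrightarrow> Tgt C (f \<otimes>\<^sub>a g) = Tgt C f \<otimes>\<^sub>o Tgt C g"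
  using tensor_hom[of f "Src C f" "Tgt C f" g "Src C g" "Tgt C g"] by (auto simp: hom_iff)

lemma arr_constraints [simp]:
  "\<lbrakk>X \<in> Obj C; Y \<in> Obj C; Z \<in> Obj C\<rbrakk> \<Longrightarrow> Assoc C X Y Z \<in> Arr C"
  "\<lbrakk>X \<in> Obj C; Y \<in> Obj C; Z \<in> Obj C\<rbrakk> \<Longrightarrow> Src C (Assoc C X Y Z) = (X \<otimes>\<^sub>o Y) \<otimes>\<^sub>o Z"
  "\<lbrakk>X \<in> Obj C; Y \<in> Obj C; Z \<in> Obj C\<rbrakk> \<Longrightarrow> Tgt C (Assoc C X Y Z) = X \<otimes>\<^sub>o (Y \<otimes>\<^sub>o Z)"
  "X \<in> Obj C \<Longrightarrow> LUnit C X \<in> Arr C" "X \<in> Obj C \<Longrightarrow> Src C (LUnit C X) = Unit C \<otimes>\<^sub>o X"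
  "X \<in> Obj C \<Longrightarrow> Tgt C (LUnit C X) = X"
  "X \<in> Obj C \<Longrightarrow> RUnit C X \<in> Arr C" "X \<in> Obj C \<Longrightarrow> Src C (RUnit C X) = X \<otimes>\<^sub>o Unit C"
  "X \<in> Obj C \<Longrightarrow> Tgt C (RUnit C X) = X"
  using assoc_hom[of X Y Z] lunit_hom[of X] runit_hom[of X] by (auto simp: hom_iff)

lemmas monoidal_simps [simp] =
  src_obj tgt_obj tensor_obj unit_obj tensor_idn assoc_iso lunit_iso runit_iso

lemma interchange:
  "\<lbrakk>f \<in> Arr C; f' \<in> Arr C; g \<in> Arr C; g' \<in> Arr C; Tgt C f = Src C f'; Tgt C g = Src C g'\<rbrakk>
    \<Longrightarrow> (f' \<otimes>\<^sub>a g') \<cdot> (f \<otimes>\<^sub>a g) = (f' \<cdot> f) \<otimes>\<^sub>a (g' \<cdot> g)"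
  by (rule tensor_comp[symmetric]) (auto simp: hom_iff)

lemma interchange_tail:
  assumes "f \<in> Arr C" "f' \<in> Arr C" "g \<in> Arr C" "g' \<in> Arr C" "Tgt C f = Src C f'"
    "Tgt C g = Src C g'" "h \<in> Arr C" "Tgt C h = Src C f \<otimes>\<^sub>o Src C g"
  shows "(f' \<otimes>\<^sub>a g') \<cdot> (f \<otimes>\<^sub>a g) \<cdot> h = ((f' \<cdot> f) \<otimes>\<^sub>a (g' \<cdot> g)) \<cdot> h"
  using assms by (intro comp_tail interchange) auto

lemma is_iso_tensor [simp]:
  assumes "is_iso C f" "is_iso C g"
  shows "is_iso C (f \<otimes>\<^sub>a g)"
  using assms iso_arr[OF assms(1)] iso_arr[OF assms(2)]
  by (intro is_isoI[of _ "Src C f \<otimes>\<^sub>o Src C g" "Tgt C f \<otimes>\<^sub>o Tgt C g" "Inv C f \<otimes>\<^sub>a Inv C g"])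
    (auto simp: hom_iff interchange)

lemma lunit_nat: "f \<in> Arr C \<Longrightarrow> LUnit C (Tgt C f) \<cdot> (Idn C (Unit C) \<otimes>\<^sub>a f) = f \<cdot> LUnit C (Src C f)"
  by (rule lunit_natural[of f "Src C f" "Tgt C f"]) (auto simp: hom_iff)

lemma runit_nat: "f \<in> Arr C \<Longrightarrow> RUnit C (Tgt C f) \<cdot> (f \<otimes>\<^sub>a Idn C (Unit C)) = f \<cdot> RUnit C (Src C f)"
  by (rule runit_natural[of f "Src C f" "Tgt C f"]) (auto simp: hom_iff)

lemma assoc_nat:
  "\<lbrakk>f \<in> Arr C; g \<in> Arr C; h \<in> Arr C\<rbrakk> \<Longrightarrow>
    Assoc C (Tgt C f) (Tgt C g) (Tgt C h) \<cdot> ((f \<otimes>\<^sub>a g) \<otimes>\<^sub>a h) =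
    (f \<otimes>\<^sub>a g \<otimes>\<^sub>a h) \<cdot> Assoc C (Src C f) (Src C g) (Src C h)"
  by (rule assoc_natural) (auto simp: hom_iff)

lemma unit_tensor_cancel:
  assumes "f \<in> Arr C" "g \<in> Arr C" "Src C f = Src C g" "Tgt C f = Tgt C g"
  shows "Idn C (Unit C) \<otimes>\<^sub>a f = Idn C (Unit C) \<otimes>\<^sub>a g \<Longrightarrow> f = g"
    and "f \<otimes>\<^sub>a Idn C (Unit C) = g \<otimes>\<^sub>a Idn C (Unit C) \<Longrightarrow> f = g"
proof -
  assume "Idn C (Unit C) \<otimes>\<^sub>a f = Idn C (Unit C) \<otimes>\<^sub>a g"
  then have "f \<cdot> LUnit C (Src C f) = g \<cdot> LUnit C (Src C f)"
    using lunit_nat[OF assms(1)] lunit_nat[OF assms(2)] assms by simp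
  then show "f = g" using assms by - (rule iso_cancel_right[of "LUnit C (Src C f)"], auto)
next
  assume "f \<otimes>\<^sub>a Idn C (Unit C) = g \<otimes>\<^sub>a Idn C (Unit C)"
  then have "f \<cdot> RUnit C (Src C f) = g \<cdot> RUnit C (Src C f)"
    using runit_nat[OF assms(1)] runit_nat[OF assms(2)] assms by simp
  then show "f = g" using assms by - (rule iso_cancel_right[of "RUnit C (Src C f)"], auto)
qed

text \<open>
  Kelly's argument: tensoring with the unit object is faithful, and after tensoring, the equation
  follows from the pentagon, two instances of the triangle and naturality of the associator.
\<close>

lemma lunit_tensor:
  assumes [simp]: "X \<in> Obj C" "Y \<in> Obj C"
  shows "LUnit C (X \<otimes>\<^sub>o Y) \<cdot> Assoc C (Unit C) X Y = LUnit C X \<otimes>\<^sub>a Idn C Y"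
proof -
  let ?I = "Unit C"
  let ?c = "Assoc C ?I (?I \<otimes>\<^sub>o X) Y \<cdot> (Assoc C ?I ?I X \<otimes>\<^sub>a Idn C Y)"
  have "(Idn C ?I \<otimes>\<^sub>a (LUnit C (X \<otimes>\<^sub>o Y) \<cdot> Assoc C ?I X Y)) \<cdot> ?c =
    (Idn C ?I \<otimes>\<^sub>a LUnit C (X \<otimes>\<^sub>o Y)) \<cdot> (Idn C ?I \<otimes>\<^sub>a Assoc C ?I X Y) \<cdot> ?c"
    by (simp add: interchange_tail)
  also have "\<dots> = (Idn C ?I \<otimes>\<^sub>a LUnit C (X \<otimes>\<^sub>o Y)) \<cdot> Assoc C ?I ?I (X \<otimes>\<^sub>o Y) \<cdot> Assoc C (?I \<otimes>\<^sub>o ?I) X Y"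
    by (simp add: pentagon)
  also have "\<dots> = (RUnit C ?I \<otimes>\<^sub>a Idn C X \<otimes>\<^sub>a Idn C Y) \<cdot> Assoc C (?I \<otimes>\<^sub>o ?I) X Y"
    by (simp add: comp_tail[OF triangle])
  also have "\<dots> = Assoc C ?I X Y \<cdot> ((RUnit C ?I \<otimes>\<^sub>a Idn C X) \<otimes>\<^sub>a Idn C Y)"
    using assoc_nat[of "RUnit C ?I" "Idn C X" "Idn C Y"] by simp
  also have "\<dots> = Assoc C ?I X Y \<cdot> ((Idn C ?I \<otimes>\<^sub>a LUnit C X) \<otimes>\<^sub>a Idn C Y) \<cdot> (Assoc C ?I ?I X \<otimes>\<^sub>a Idn C Y)"
    by (simp add: interchange triangle)
  also have "\<dots> = (Idn C ?I \<otimes>\<^sub>a (LUnit C X \<otimes>\<^sub>a Idn C Y)) \<cdot> ?c"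
    using comp_tail[OF assoc_nat[of "Idn C ?I" "LUnit C X" "Idn C Y"], of "Assoc C ?I ?I X \<otimes>\<^sub>a Idn C Y"]
    by simp
  finally have "Idn C ?I \<otimes>\<^sub>a (LUnit C (X \<otimes>\<^sub>o Y) \<cdot> Assoc C ?I X Y) = Idn C ?I \<otimes>\<^sub>a (LUnit C X \<otimes>\<^sub>a Idn C Y)"
    by - (rule iso_cancel_right[of ?c], auto)
  then show ?thesis by - (rule unit_tensor_cancel(1), auto)
qed

text \<open>
  The mirror image of \<open>lunit_tensor\<close>, tensoring with the unit object on the right.
\<close>

lemma runit_tensor:
  assumes [simp]: "X \<in> Obj C" "Y \<in> Obj C"
  shows "(Idn C X \<otimes>\<^sub>a RUnit C Y) \<cdot> Assoc C X Y (Unit C) = RUnit C (X \<otimes>\<^sub>o Y)"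
proof -
  let ?I = "Unit C"
  have "Assoc C X Y ?I \<cdot> (((Idn C X \<otimes>\<^sub>a RUnit C Y) \<cdot> Assoc C X Y ?I) \<otimes>\<^sub>a Idn C ?I) =
    Assoc C X Y ?I \<cdot> ((Idn C X \<otimes>\<^sub>a RUnit C Y) \<otimes>\<^sub>a Idn C ?I) \<cdot> (Assoc C X Y ?I \<otimes>\<^sub>a Idn C ?I)"
    by (simp add: interchange)
  also have "\<dots> = (Idn C X \<otimes>\<^sub>a (RUnit C Y \<otimes>\<^sub>a Idn C ?I)) \<cdot> Assoc C X (Y \<otimes>\<^sub>o ?I) ?I \<cdot>
      (Assoc C X Y ?I \<otimes>\<^sub>a Idn C ?I)"
    using comp_tail[OF assoc_nat[of "Idn C X" "RUnit C Y" "Idn C ?I"], of "Assoc C X Y ?I \<otimes>\<^sub>a Idn C ?I"]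
    by simp
  also have "\<dots> = (Idn C X \<otimes>\<^sub>a (Idn C Y \<otimes>\<^sub>a LUnit C ?I)) \<cdot> (Idn C X \<otimes>\<^sub>a Assoc C Y ?I ?I) \<cdot>
      Assoc C X (Y \<otimes>\<^sub>o ?I) ?I \<cdot> (Assoc C X Y ?I \<otimes>\<^sub>a Idn C ?I)"
    by (simp add: interchange_tail triangle)
  also have "\<dots> = (Idn C X \<otimes>\<^sub>a (Idn C Y \<otimes>\<^sub>a LUnit C ?I)) \<cdot> Assoc C X Y (?I \<otimes>\<^sub>o ?I) \<cdot>
      Assoc C (X \<otimes>\<^sub>o Y) ?I ?I"
    by (simp add: pentagon)
  also have "\<dots> = Assoc C X Y ?I \<cdot> (Idn C (X \<otimes>\<^sub>o Y) \<otimes>\<^sub>a LUnit C ?I) \<cdot> Assoc C (X \<otimes>\<^sub>o Y) ?I ?I"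
    using comp_tail[OF assoc_nat[of "Idn C X" "Idn C Y" "LUnit C ?I"], of "Assoc C (X \<otimes>\<^sub>o Y) ?I ?I"]
    by simp
  also have "\<dots> = Assoc C X Y ?I \<cdot> (RUnit C (X \<otimes>\<^sub>o Y) \<otimes>\<^sub>a Idn C ?I)"
    by (simp add: triangle)
  finally have "((Idn C X \<otimes>\<^sub>a RUnit C Y) \<cdot> Assoc C X Y ?I) \<otimes>\<^sub>a Idn C ?I = RUnit C (X \<otimes>\<^sub>o Y) \<otimes>\<^sub>a Idn C ?I"
    by - (rule iso_cancel_left[of "Assoc C X Y ?I"], auto)
  then show ?thesis by - (rule unit_tensor_cancel(2), auto)
qed

text \<open>
  Naturality of the left unit constraint at itself identifies its value at $\mathbf{1} \otimes \mathbf{1}$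
  with $1 \otimes \lambda$; then \<open>lunit_tensor\<close> and the triangle compare it with the right constraint.
\<close>

lemma lunit_unit_eq_runit_unit: "LUnit C (Unit C) = RUnit C (Unit C)"
proof -
  let ?I = "Unit C"
  have "LUnit C ?I \<cdot> (Idn C ?I \<otimes>\<^sub>a LUnit C ?I) = LUnit C ?I \<cdot> LUnit C (?I \<otimes>\<^sub>o ?I)"
    using lunit_nat[of "LUnit C ?I"] by simp
  then have "Idn C ?I \<otimes>\<^sub>a LUnit C ?I = LUnit C (?I \<otimes>\<^sub>o ?I)"
    by - (rule iso_cancel_left[of "LUnit C ?I"], auto)
  then have "LUnit C ?I \<otimes>\<^sub>a Idn C ?I = RUnit C ?I \<otimes>\<^sub>a Idn C ?I"
    using lunit_tensor[of ?I ?I] triangle[of ?I ?I] by simp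
  then show ?thesis by - (rule unit_tensor_cancel(2), auto)
qed

end


section \<open>Duals\<close>

context finite_tensor_category begin

lemma dual_obj [simp]: "X \<in> Obj C \<Longrightarrow> Dual C X \<in> Obj C"
  using left_dual by (auto simp: is_left_dual_def)

lemma arr_ev_coev [simp]:
  "X \<in> Obj C \<Longrightarrow> Ev C X \<in> Arr C" "X \<in> Obj C \<Longrightarrow> Src C (Ev C X) = Dual C X \<otimes>\<^sub>o X"
  "X \<in> Obj C \<Longrightarrow> Tgt C (Ev C X) = Unit C"
  "X \<in> Obj C \<Longrightarrow> Coev C X \<in> Arr C" "X \<in> Obj C \<Longrightarrow> Src C (Coev C X) = Unit C"
  "X \<in> Obj C \<Longrightarrow> Tgt C (Coev C X) = X \<otimes>\<^sub>o Dual C X"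
  using left_dual by (auto simp: is_left_dual_def hom_iff)

lemma zigzag:
  assumes "X \<in> Obj C"
  shows "RUnit C X \<cdot> (Idn C X \<otimes>\<^sub>a Ev C X) \<cdot> Assoc C X (Dual C X) X \<cdot> (Coev C X \<otimes>\<^sub>a Idn C X) \<cdot>
      Inv C (LUnit C X) = Idn C X"
    and "LUnit C (Dual C X) \<cdot> (Ev C X \<otimes>\<^sub>a Idn C (Dual C X)) \<cdot> Inv C (Assoc C (Dual C X) X (Dual C X)) \<cdot>
      (Idn C (Dual C X) \<otimes>\<^sub>a Coev C X) \<cdot> Inv C (RUnit C (Dual C X)) = Idn C (Dual C X)"
  using left_dual[OF assms] by (auto simp: is_left_dual_def)

lemma dual_transpose_hom:
  assumes "Z \<in> Obj C" "X \<in> Obj C" "f \<in> Hom C (Z \<otimes>\<^sub>o X) (Unit C)"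
  shows "dual_transpose C Z X f \<in> Hom C Z (Dual C X)"
  using assms by (simp add: dual_transpose_def hom_iff)

lemma dual_transpose_natural:
  assumes "X \<in> Obj C" "f \<in> Hom C (Z \<otimes>\<^sub>o X) (Unit C)" "h \<in> Hom C Z' Z"
  shows "dual_transpose C Z X f \<cdot> h = dual_transpose C Z' X (f \<cdot> (h \<otimes>\<^sub>a Idn C X))"
proof -
  note [simp] = assms(1) assms(2,3)[unfolded hom_iff]
  have [simp]: "Z \<in> Obj C" "Z' \<in> Obj C" using hom_obj[OF assms(3)] by auto
  let ?D = "Dual C X"
  have 1: "Inv C (RUnit C Z) \<cdot> h = (h \<otimes>\<^sub>a Idn C (Unit C)) \<cdot> Inv C (RUnit C Z')"
    by (rule iso_swap[symmetric]) (auto simp: runit_nat[of h, simplified])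
  have 2: "Inv C (Assoc C Z X ?D) \<cdot> (h \<otimes>\<^sub>a Idn C X \<otimes>\<^sub>a Idn C ?D) =
      ((h \<otimes>\<^sub>a Idn C X) \<otimes>\<^sub>a Idn C ?D) \<cdot> Inv C (Assoc C Z' X ?D)"
    using assoc_nat[of h "Idn C X" "Idn C ?D"] by - (rule iso_swap[symmetric], auto)
  have "dual_transpose C Z X f \<cdot> h = LUnit C ?D \<cdot> (f \<otimes>\<^sub>a Idn C ?D) \<cdot> Inv C (Assoc C Z X ?D) \<cdot>
      (Idn C Z \<otimes>\<^sub>a Coev C X) \<cdot> (h \<otimes>\<^sub>a Idn C (Unit C)) \<cdot> Inv C (RUnit C Z')"
    by (simp add: dual_transpose_def 1)
  also have "\<dots> = LUnit C ?D \<cdot> (f \<otimes>\<^sub>a Idn C ?D) \<cdot> Inv C (Assoc C Z X ?D) \<cdot>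
      (h \<otimes>\<^sub>a Idn C X \<otimes>\<^sub>a Idn C ?D) \<cdot> (Idn C Z' \<otimes>\<^sub>a Coev C X) \<cdot> Inv C (RUnit C Z')"
    by (simp add: interchange_tail)
  also have "\<dots> = LUnit C ?D \<cdot> (f \<otimes>\<^sub>a Idn C ?D) \<cdot> ((h \<otimes>\<^sub>a Idn C X) \<otimes>\<^sub>a Idn C ?D) \<cdot>
      Inv C (Assoc C Z' X ?D) \<cdot> (Idn C Z' \<otimes>\<^sub>a Coev C X) \<cdot> Inv C (RUnit C Z')"
    using comp_tail[OF 2, of "(Idn C Z' \<otimes>\<^sub>a Coev C X) \<cdot> Inv C (RUnit C Z')"] by simp
  also have "\<dots> = dual_transpose C Z' X (f \<cdot> (h \<otimes>\<^sub>a Idn C X))"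
    by (simp add: dual_transpose_def interchange_tail)
  finally show ?thesis .
qed

text \<open>
  By naturality in $Z$ it suffices to transpose the evaluation itself, which is the second
  zigzag identity.
\<close>

lemma dual_transpose_ev:
  assumes "X \<in> Obj C" "h \<in> Hom C Z (Dual C X)"
  shows "dual_transpose C Z X (Ev C X \<cdot> (h \<otimes>\<^sub>a Idn C X)) = h"
proof -
  have "dual_transpose C Z X (Ev C X \<cdot> (h \<otimes>\<^sub>a Idn C X)) = dual_transpose C (Dual C X) X (Ev C X) \<cdot> h"
    using assms by (intro dual_transpose_natural[symmetric]) (auto simp: hom_iff)
  also have "\<dots> = h" using assms by (simp add: dual_transpose_def zigzag(2) hom_iff del: assoc_comp)
  finally show ?thesis .
qed

text \<open>
  Sliding $f$ to the far left, past the evaluation, leaves $Z$ tensored with the first zigzag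
  identity. Moving the unit constraints across the tensor products is what needs the coherence
  lemmas above.
\<close>

lemma ev_dual_transpose:
  assumes "Z \<in> Obj C" "X \<in> Obj C" "f \<in> Hom C (Z \<otimes>\<^sub>o X) (Unit C)"
  shows "Ev C X \<cdot> (dual_transpose C Z X f \<otimes>\<^sub>a Idn C X) = f"
proof -
  note [simp] = assms(1,2) assms(3)[unfolded hom_iff]
  let ?I = "Unit C" and ?D = "Dual C X"
  let ?r = "(Inv C (Assoc C Z X ?D) \<otimes>\<^sub>a Idn C X) \<cdot> ((Idn C Z \<otimes>\<^sub>a Coev C X) \<otimes>\<^sub>a Idn C X) \<cdot>
    (Inv C (RUnit C Z) \<otimes>\<^sub>a Idn C X)"
  have pent: "Assoc C Z X (?D \<otimes>\<^sub>o X) \<cdot> Assoc C (Z \<otimes>\<^sub>o X) ?D X \<cdot> (Inv C (Assoc C Z X ?D) \<otimes>\<^sub>a Idn C X) =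
      (Idn C Z \<otimes>\<^sub>a Assoc C X ?D X) \<cdot> Assoc C Z (X \<otimes>\<^sub>o ?D) X"
  proof -
    have "Assoc C Z X (?D \<otimes>\<^sub>o X) \<cdot> Assoc C (Z \<otimes>\<^sub>o X) ?D X \<cdot> (Inv C (Assoc C Z X ?D) \<otimes>\<^sub>a Idn C X) =
      ((Idn C Z \<otimes>\<^sub>a Assoc C X ?D X) \<cdot> Assoc C Z (X \<otimes>\<^sub>o ?D) X \<cdot> (Assoc C Z X ?D \<otimes>\<^sub>a Idn C X)) \<cdot>
        (Inv C (Assoc C Z X ?D) \<otimes>\<^sub>a Idn C X)"
      unfolding pentagon[OF assms(1,2) dual_obj[OF assms(2)] assms(2)] by simp
    then show ?thesis by (simp add: interchange)
  qed
  have tri: "Assoc C Z ?I X \<cdot> (Inv C (RUnit C Z) \<otimes>\<^sub>a Idn C X) = Idn C Z \<otimes>\<^sub>a Inv C (LUnit C X)"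
  proof -
    have "(Idn C Z \<otimes>\<^sub>a LUnit C X) \<cdot> Assoc C Z ?I X \<cdot> (Inv C (RUnit C Z) \<otimes>\<^sub>a Idn C X) =
        (Idn C Z \<otimes>\<^sub>a LUnit C X) \<cdot> (Idn C Z \<otimes>\<^sub>a Inv C (LUnit C X))"
      using comp_tail[OF triangle[of Z X], of "Inv C (RUnit C Z) \<otimes>\<^sub>a Idn C X"] by (simp add: interchange)
    then show ?thesis by - (rule iso_cancel_left[of "Idn C Z \<otimes>\<^sub>a LUnit C X"], auto)
  qed
  have snake: "RUnit C (Z \<otimes>\<^sub>o X) \<cdot> (Idn C (Z \<otimes>\<^sub>o X) \<otimes>\<^sub>a Ev C X) \<cdot> Assoc C (Z \<otimes>\<^sub>o X) ?D X \<cdot> ?r =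
      Idn C (Z \<otimes>\<^sub>o X)"
  proof -
    have "RUnit C (Z \<otimes>\<^sub>o X) \<cdot> (Idn C (Z \<otimes>\<^sub>o X) \<otimes>\<^sub>a Ev C X) \<cdot> Assoc C (Z \<otimes>\<^sub>o X) ?D X \<cdot> ?r =
      (Idn C Z \<otimes>\<^sub>a RUnit C X) \<cdot> Assoc C Z X ?I \<cdot> (Idn C (Z \<otimes>\<^sub>o X) \<otimes>\<^sub>a Ev C X) \<cdot>
        Assoc C (Z \<otimes>\<^sub>o X) ?D X \<cdot> ?r"
      unfolding runit_tensor[OF assms(1,2), symmetric] by simp
    also have "\<dots> = (Idn C Z \<otimes>\<^sub>a RUnit C X) \<cdot> (Idn C Z \<otimes>\<^sub>a Idn C X \<otimes>\<^sub>a Ev C X) \<cdot>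
        Assoc C Z X (?D \<otimes>\<^sub>o X) \<cdot> Assoc C (Z \<otimes>\<^sub>o X) ?D X \<cdot> ?r"
      using comp_tail[OF assoc_nat[of "Idn C Z" "Idn C X" "Ev C X"],
          of "Assoc C (Z \<otimes>\<^sub>o X) ?D X \<cdot> ?r"] by simp
    also have "\<dots> = (Idn C Z \<otimes>\<^sub>a RUnit C X) \<cdot> (Idn C Z \<otimes>\<^sub>a Idn C X \<otimes>\<^sub>a Ev C X) \<cdot>
        (Idn C Z \<otimes>\<^sub>a Assoc C X ?D X) \<cdot> Assoc C Z (X \<otimes>\<^sub>o ?D) X \<cdot>
        ((Idn C Z \<otimes>\<^sub>a Coev C X) \<otimes>\<^sub>a Idn C X) \<cdot> (Inv C (RUnit C Z) \<otimes>\<^sub>a Idn C X)"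
      using arg_cong[OF pent, of "\<lambda>k. k \<cdot> ((Idn C Z \<otimes>\<^sub>a Coev C X) \<otimes>\<^sub>a Idn C X) \<cdot> (Inv C (RUnit C Z) \<otimes>\<^sub>a Idn C X)"]
      by simp
    also have "\<dots> = (Idn C Z \<otimes>\<^sub>a RUnit C X) \<cdot> (Idn C Z \<otimes>\<^sub>a Idn C X \<otimes>\<^sub>a Ev C X) \<cdot>
        (Idn C Z \<otimes>\<^sub>a Assoc C X ?D X) \<cdot> (Idn C Z \<otimes>\<^sub>a Coev C X \<otimes>\<^sub>a Idn C X) \<cdot> (Idn C Z \<otimes>\<^sub>a Inv C (LUnit C X))"
      using comp_tail[OF assoc_nat[of "Idn C Z" "Coev C X" "Idn C X"],
          of "Inv C (RUnit C Z) \<otimes>\<^sub>a Idn C X"] by (simp add: tri)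
    also have "\<dots> = Idn C Z \<otimes>\<^sub>a (RUnit C X \<cdot> (Idn C X \<otimes>\<^sub>a Ev C X) \<cdot> Assoc C X (Dual C X) X \<cdot>
        (Coev C X \<otimes>\<^sub>a Idn C X) \<cdot> Inv C (LUnit C X))"
      by (simp add: interchange)
    also have "\<dots> = Idn C (Z \<otimes>\<^sub>o X)" by (simp add: zigzag(1))
    finally show ?thesis .
  qed
  have "Ev C X \<cdot> (dual_transpose C Z X f \<otimes>\<^sub>a Idn C X) =
      Ev C X \<cdot> (LUnit C ?D \<otimes>\<^sub>a Idn C X) \<cdot> ((f \<otimes>\<^sub>a Idn C ?D) \<otimes>\<^sub>a Idn C X) \<cdot> ?r"
    by (simp add: dual_transpose_def interchange)
  also have "\<dots> = (Ev C X \<cdot> LUnit C (?D \<otimes>\<^sub>o X)) \<cdot> Assoc C ?I ?D X \<cdot> ((f \<otimes>\<^sub>a Idn C ?D) \<otimes>\<^sub>a Idn C X) \<cdot> ?r"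
    unfolding lunit_tensor[OF dual_obj[OF assms(2)] assms(2), symmetric] by simp
  also have "\<dots> = LUnit C ?I \<cdot> (Idn C ?I \<otimes>\<^sub>a Ev C X) \<cdot> Assoc C ?I ?D X \<cdot>
      ((f \<otimes>\<^sub>a Idn C ?D) \<otimes>\<^sub>a Idn C X) \<cdot> ?r"
    unfolding lunit_nat[of "Ev C X", symmetric, simplified] by simp
  also have "\<dots> = LUnit C ?I \<cdot> (Idn C ?I \<otimes>\<^sub>a Ev C X) \<cdot> (f \<otimes>\<^sub>a Idn C ?D \<otimes>\<^sub>a Idn C X) \<cdot>
      Assoc C (Z \<otimes>\<^sub>o X) ?D X \<cdot> ?r"
    using comp_tail[OF assoc_nat[of f "Idn C ?D" "Idn C X"], of ?r] by simp
  also have "\<dots> = RUnit C ?I \<cdot> (f \<otimes>\<^sub>a Idn C ?I) \<cdot> (Idn C (Z \<otimes>\<^sub>o X) \<otimes>\<^sub>a Ev C X) \<cdot>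
      Assoc C (Z \<otimes>\<^sub>o X) ?D X \<cdot> ?r"
    by (simp add: interchange_tail lunit_unit_eq_runit_unit)
  also have "\<dots> = f \<cdot> RUnit C (Z \<otimes>\<^sub>o X) \<cdot> (Idn C (Z \<otimes>\<^sub>o X) \<otimes>\<^sub>a Ev C X) \<cdot>
      Assoc C (Z \<otimes>\<^sub>o X) ?D X \<cdot> ?r"
    using comp_tail[OF runit_nat[of f], of "(Idn C (Z \<otimes>\<^sub>o X) \<otimes>\<^sub>a Ev C X) \<cdot> Assoc C (Z \<otimes>\<^sub>o X) ?D X \<cdot> ?r"]
    by simp
  also have "\<dots> = f" unfolding snake by simp
  finally show ?thesis .
qed

lemma dual_arr_hom:
  assumes "f \<in> Hom C X Y"
  shows "dual_arr C f \<in> Hom C (Dual C Y) (Dual C X)"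
  using assms hom_obj[OF assms]
    dual_transpose_hom[of "Dual C Y" X "Ev C Y \<cdot> (Idn C (Dual C Y) \<otimes>\<^sub>a f)"]
  by (simp add: dual_arr_def hom_iff)

text \<open>
  The characterisation of the dual morphism by which its functoriality is proved.
\<close>

lemma ev_dual_arr:
  assumes f: "f \<in> Hom C X Y"
  shows "Ev C X \<cdot> (dual_arr C f \<otimes>\<^sub>a Idn C X) = Ev C Y \<cdot> (Idn C (Dual C Y) \<otimes>\<^sub>a f)"
  using f hom_obj[OF f] by (simp add: dual_arr_def hom_iff ev_dual_transpose)

lemma dual_arr_natural:
  assumes f: "f \<in> Hom C X Y" and h: "h \<in> Hom C Z (Dual C Y)"
  shows "dual_arr C f \<cdot> h = dual_transpose C Z X (Ev C Y \<cdot> (h \<otimes>\<^sub>a f))"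
proof -
  note [simp] = hom_obj[OF f] f[unfolded hom_iff] h[unfolded hom_iff]
  have "dual_arr C f \<cdot> h =
      dual_transpose C Z X ((Ev C Y \<cdot> (Idn C (Dual C Y) \<otimes>\<^sub>a f)) \<cdot> (h \<otimes>\<^sub>a Idn C X))"
    unfolding dual_arr_def using h by (simp only: f[unfolded hom_iff])
      (rule dual_transpose_natural, auto simp: hom_iff)
  then show ?thesis by (simp add: interchange)
qed

lemma dual_arr_comp:
  assumes f: "f \<in> Hom C X Y" and g: "g \<in> Hom C Y Z"
  shows "dual_arr C (g \<cdot> f) = dual_arr C f \<cdot> dual_arr C g"
proof -
  note [simp] = hom_obj[OF f] hom_obj[OF g] f[unfolded hom_iff] g[unfolded hom_iff]
    dual_arr_hom[OF g, unfolded hom_iff]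
  have "dual_arr C f \<cdot> dual_arr C g = dual_transpose C (Dual C Z) X (Ev C Y \<cdot> (dual_arr C g \<otimes>\<^sub>a f))"
    by (rule dual_arr_natural[OF f]) (simp add: hom_iff)
  also have "Ev C Y \<cdot> (dual_arr C g \<otimes>\<^sub>a f) = (Ev C Y \<cdot> (dual_arr C g \<otimes>\<^sub>a Idn C Y)) \<cdot> (Idn C (Dual C Z) \<otimes>\<^sub>a f)"
    by (simp add: interchange)
  also have "\<dots> = Ev C Z \<cdot> (Idn C (Dual C Z) \<otimes>\<^sub>a (g \<cdot> f))"
    unfolding ev_dual_arr[OF g] by (simp add: interchange)
  finally show ?thesis by (simp add: dual_arr_def)
qed

text \<open>
  The morphism $\mathrm{ev}_Y (1 \otimes h)$, which is determined by the dual of $h$, gives back $h$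
  when it is precomposed with the coevaluation of $Y$.
\<close>

lemma dual_arr_faithful:
  assumes f: "f \<in> Hom C X Y" and g: "g \<in> Hom C X Y" and eq: "dual_arr C f = dual_arr C g"
  shows "f = g"
proof -
  note [simp] = hom_obj[OF f]
  let ?I = "Unit C" and ?D = "Dual C Y"
  have recover: "RUnit C Y \<cdot> (Idn C Y \<otimes>\<^sub>a (Ev C Y \<cdot> (Idn C ?D \<otimes>\<^sub>a h))) \<cdot> Assoc C Y ?D X \<cdot>
      (Coev C Y \<otimes>\<^sub>a Idn C X) \<cdot> Inv C (LUnit C X) = h" if h: "h \<in> Hom C X Y" for h
  proof -
    note [simp] = h[unfolded hom_iff]
    have l: "Inv C (LUnit C Y) \<cdot> h = (Idn C ?I \<otimes>\<^sub>a h) \<cdot> Inv C (LUnit C X)"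
      by (rule iso_swap[symmetric]) (auto simp: lunit_nat[of h, simplified])
    have "RUnit C Y \<cdot> (Idn C Y \<otimes>\<^sub>a (Ev C Y \<cdot> (Idn C ?D \<otimes>\<^sub>a h))) \<cdot> Assoc C Y ?D X \<cdot>
        (Coev C Y \<otimes>\<^sub>a Idn C X) \<cdot> Inv C (LUnit C X) =
      RUnit C Y \<cdot> (Idn C Y \<otimes>\<^sub>a Ev C Y) \<cdot> (Idn C Y \<otimes>\<^sub>a Idn C ?D \<otimes>\<^sub>a h) \<cdot> Assoc C Y ?D X \<cdot>
        (Coev C Y \<otimes>\<^sub>a Idn C X) \<cdot> Inv C (LUnit C X)"
      by (simp add: interchange_tail)
    also have "\<dots> = RUnit C Y \<cdot> (Idn C Y \<otimes>\<^sub>a Ev C Y) \<cdot> Assoc C Y ?D Y \<cdot>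
        (Idn C (Y \<otimes>\<^sub>o ?D) \<otimes>\<^sub>a h) \<cdot> (Coev C Y \<otimes>\<^sub>a Idn C X) \<cdot> Inv C (LUnit C X)"
      using comp_tail[OF assoc_nat[of "Idn C Y" "Idn C ?D" h],
          of "(Coev C Y \<otimes>\<^sub>a Idn C X) \<cdot> Inv C (LUnit C X)"] by simp
    also have "\<dots> = RUnit C Y \<cdot> (Idn C Y \<otimes>\<^sub>a Ev C Y) \<cdot> Assoc C Y ?D Y \<cdot>
        (Coev C Y \<otimes>\<^sub>a Idn C Y) \<cdot> (Idn C ?I \<otimes>\<^sub>a h) \<cdot> Inv C (LUnit C X)"
      by (simp add: interchange_tail)
    also have "\<dots> = (RUnit C Y \<cdot> (Idn C Y \<otimes>\<^sub>a Ev C Y) \<cdot> Assoc C Y ?D Y \<cdot>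
        (Coev C Y \<otimes>\<^sub>a Idn C Y) \<cdot> Inv C (LUnit C Y)) \<cdot> h"
      by (simp add: l)
    also have "\<dots> = h" by (simp add: zigzag(1) del: assoc_comp)
    finally show ?thesis .
  qed
  have ev: "Ev C Y \<cdot> (Idn C ?D \<otimes>\<^sub>a f) = Ev C Y \<cdot> (Idn C ?D \<otimes>\<^sub>a g)"
    unfolding ev_dual_arr[OF f, symmetric] ev_dual_arr[OF g, symmetric] eq ..
  show ?thesis by (rule trans[OF recover[OF f, symmetric], unfolded ev, OF recover[OF g]])
qed

lemma dual_unit_hom: "dual_unit C \<in> Hom C (Unit C) (Dual C (Unit C))"
  by (simp add: dual_unit_def hom_iff)

lemma ev_dual_unit: "Ev C (Unit C) \<cdot> (dual_unit C \<otimes>\<^sub>a Idn C (Unit C)) = LUnit C (Unit C)"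
proof -
  let ?I = "Unit C" and ?D = "Dual C (Unit C)"
  have "Ev C ?I \<cdot> (dual_unit C \<otimes>\<^sub>a Idn C ?I) =
      Ev C ?I \<cdot> (LUnit C ?D \<otimes>\<^sub>a Idn C ?I) \<cdot> (Coev C ?I \<otimes>\<^sub>a Idn C ?I)"
    by (simp add: dual_unit_def interchange)
  also have "\<dots> = (Ev C ?I \<cdot> LUnit C (?D \<otimes>\<^sub>o ?I)) \<cdot> Assoc C ?I ?D ?I \<cdot> (Coev C ?I \<otimes>\<^sub>a Idn C ?I)"
    unfolding lunit_tensor[OF dual_obj[OF unit_obj] unit_obj, symmetric] by simp
  also have "\<dots> = RUnit C ?I \<cdot> (Idn C ?I \<otimes>\<^sub>a Ev C ?I) \<cdot> Assoc C ?I ?D ?I \<cdot> (Coev C ?I \<otimes>\<^sub>a Idn C ?I)"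
    unfolding lunit_nat[of "Ev C ?I", symmetric, simplified] lunit_unit_eq_runit_unit by simp
  also have "\<dots> = (RUnit C ?I \<cdot> (Idn C ?I \<otimes>\<^sub>a Ev C ?I) \<cdot> Assoc C ?I ?D ?I \<cdot> (Coev C ?I \<otimes>\<^sub>a Idn C ?I) \<cdot>
      Inv C (LUnit C ?I)) \<cdot> LUnit C ?I"
    by simp
  also have "\<dots> = LUnit C ?I" by (simp add: zigzag(1) del: assoc_comp)
  finally show ?thesis .
qed

text \<open>
  With the identification of $\mathbf{1}$ with its dual, dualising a morphism to $\mathbf{1}$ is the same as
  transposing it. The next two lemmas conclude that this is a bijection onto the morphisms from
  $\mathbf{1}$ to the dual of $X$, which makes the trace well defined.
\<close>

lemma dual_arr_dual_unit:
  assumes t: "t \<in> Hom C X (Unit C)"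
  shows "dual_arr C t \<cdot> dual_unit C = dual_transpose C (Unit C) X (t \<cdot> LUnit C X)"
proof -
  note [simp] = hom_obj[OF t] t[unfolded hom_iff] dual_unit_hom[unfolded hom_iff]
  let ?I = "Unit C"
  have "dual_arr C t \<cdot> dual_unit C = dual_transpose C ?I X (Ev C ?I \<cdot> (dual_unit C \<otimes>\<^sub>a t))"
    by (rule dual_arr_natural[OF t dual_unit_hom])
  also have "Ev C ?I \<cdot> (dual_unit C \<otimes>\<^sub>a t) = (Ev C ?I \<cdot> (dual_unit C \<otimes>\<^sub>a Idn C ?I)) \<cdot> (Idn C ?I \<otimes>\<^sub>a t)"
    by (simp add: interchange)
  also have "\<dots> = t \<cdot> LUnit C X" unfolding ev_dual_unit using lunit_nat[of t] by simp
  finally show ?thesis .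
qed

lemma dual_arr_unit_inj:
  assumes s: "s \<in> Hom C X (Unit C)" and t: "t \<in> Hom C X (Unit C)"
    and eq: "dual_arr C s \<cdot> dual_unit C = dual_arr C t \<cdot> dual_unit C"
  shows "s = t"
proof -
  note [simp] = hom_obj[OF t] t[unfolded hom_iff] s[unfolded hom_iff]
  have "s \<cdot> LUnit C X = Ev C X \<cdot> (dual_transpose C (Unit C) X (s \<cdot> LUnit C X) \<otimes>\<^sub>a Idn C X)"
    by (rule ev_dual_transpose[symmetric]) (auto simp: hom_iff)
  also have "\<dots> = Ev C X \<cdot> (dual_transpose C (Unit C) X (t \<cdot> LUnit C X) \<otimes>\<^sub>a Idn C X)"
    using eq by (simp add: dual_arr_dual_unit[OF s] dual_arr_dual_unit[OF t])
  also have "\<dots> = t \<cdot> LUnit C X"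
    by (rule ev_dual_transpose) (auto simp: hom_iff)
  finally show ?thesis by - (rule iso_cancel_right[of "LUnit C X"], auto)
qed

lemma dual_arr_unit_surj:
  assumes X: "X \<in> Obj C" and x: "x \<in> Hom C (Unit C) (Dual C X)"
  shows "\<exists>t\<in>Hom C X (Unit C). dual_arr C t \<cdot> dual_unit C = x"
proof
  note [simp] = X x[unfolded hom_iff]
  let ?t = "Ev C X \<cdot> (x \<otimes>\<^sub>a Idn C X) \<cdot> Inv C (LUnit C X)"
  show t: "?t \<in> Hom C X (Unit C)" by (simp add: hom_iff)
  have "?t \<cdot> LUnit C X = Ev C X \<cdot> (x \<otimes>\<^sub>a Idn C X)" by simp
  then show "dual_arr C ?t \<cdot> dual_unit C = x"
    unfolding dual_arr_dual_unit[OF t] by (simp only: dual_transpose_ev[OF X x])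
qed

end


section \<open>Internal Homs and the Serre functor\<close>

context linear_module_category begin

lemma arr_act [simp]:
  "\<lbrakk>f \<in> Arr C; g \<in> Arr M\<rbrakk> \<Longrightarrow> f \<rhd>\<^sub>a g \<in> Arr M"
  "\<lbrakk>f \<in> Arr C; g \<in> Arr M\<rbrakk> \<Longrightarrow> Src M (f \<rhd>\<^sub>a g) = Src C f \<rhd>\<^sub>o Src M g"
  "\<lbrakk>f \<in> Arr C; g \<in> Arr M\<rbrakk> \<Longrightarrow> Tgt M (f \<rhd>\<^sub>a g) = Tgt C f \<rhd>\<^sub>o Tgt M g"
  using act_hom[of f "Src C f" "Tgt C f" g "Src M g" "Tgt M g"] by (auto simp: M.hom_iff C.hom_iff)

lemma arr_act_unit [simp]:
  "N \<in> Obj M \<Longrightarrow> ActUnit M N \<in> Arr M" "N \<in> Obj M \<Longrightarrow> Src M (ActUnit M N) = Unit C \<rhd>\<^sub>o N"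
  "N \<in> Obj M \<Longrightarrow> Tgt M (ActUnit M N) = N"
  using act_unit_hom[of N] by (auto simp: M.hom_iff)

lemmas act_simps [simp] = act_obj act_idn M.src_obj M.tgt_obj

lemma act_interchange:
  "\<lbrakk>f \<in> Arr C; f' \<in> Arr C; g \<in> Arr M; g' \<in> Arr M; Tgt C f = Src C f'; Tgt M g = Src M g'\<rbrakk>
    \<Longrightarrow> (f' \<rhd>\<^sub>a g') \<cdot> (f \<rhd>\<^sub>a g) = (f' \<cdot>\<^bsub>C\<^esub> f) \<rhd>\<^sub>a (g' \<cdot> g)"
  by (rule act_comp[symmetric]) (auto simp: M.hom_iff C.hom_iff)

lemma act_zero_right:
  assumes h: "h \<in> Hom C X Y" and N: "N \<in> Obj M" "L \<in> Obj M"
  shows "h \<rhd>\<^sub>a Zero M N L = Zero M (X \<rhd>\<^sub>o N) (Y \<rhd>\<^sub>o L)"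
proof -
  note [simp] = h[unfolded C.hom_iff] C.hom_obj[OF h] N
  have z: "Zero M L L \<cdot> Zero M N L = Zero M N L"
    by (rule M.comp_zero_left) (auto simp: M.hom_iff)
  let ?z = "h \<rhd>\<^sub>a Zero M N L"
  have t: "?z \<in> Hom M (X \<rhd>\<^sub>o N) (Y \<rhd>\<^sub>o L)" by (simp add: M.hom_iff)
  have "?z \<^bold>+ ?z = h \<rhd>\<^sub>a (Zero M N L \<^bold>+ Zero M N L)"
    by (rule act_plus_right[symmetric]) (auto simp: M.hom_iff C.hom_iff)
  also have "\<dots> = ?z" using M.plus_zero[of "Zero M N L" N L] by (simp add: M.hom_iff)
  finally show ?thesis by (rule M.idem_zero[OF t])
qed

lemma act_zero_left:
  assumes h: "h \<in> Hom M N L" and X: "X \<in> Obj C" "Y \<in> Obj C"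
  shows "Zero C X Y \<rhd>\<^sub>a h = Zero M (X \<rhd>\<^sub>o N) (Y \<rhd>\<^sub>o L)"
proof -
  note [simp] = h[unfolded M.hom_iff] M.hom_obj[OF h] X
  let ?z = "Zero C X Y \<rhd>\<^sub>a h"
  have t: "?z \<in> Hom M (X \<rhd>\<^sub>o N) (Y \<rhd>\<^sub>o L)" by (simp add: M.hom_iff)
  have "?z \<^bold>+ ?z = (Zero C X Y \<^bold>+\<^bsub>C\<^esub> Zero C X Y) \<rhd>\<^sub>a h"
    by (rule act_plus_left[symmetric]) (auto simp: M.hom_iff C.hom_iff)
  also have "\<dots> = ?z" using C.plus_zero[of "Zero C X Y" X Y] by (simp add: C.hom_iff)
  finally show ?thesis by (rule M.idem_zero[OF t])
qed

end

context finite_module_category begin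

lemma ihom_simps [simp]:
  "\<lbrakk>N \<in> Obj M; L \<in> Obj M\<rbrakk> \<Longrightarrow> IHom M N L \<in> Obj C"
  "\<lbrakk>N \<in> Obj M; L \<in> Obj M\<rbrakk> \<Longrightarrow> IEv M N L \<in> Arr M"
  "\<lbrakk>N \<in> Obj M; L \<in> Obj M\<rbrakk> \<Longrightarrow> Src M (IEv M N L) = IHom M N L \<rhd>\<^sub>o N"
  "\<lbrakk>N \<in> Obj M; L \<in> Obj M\<rbrakk> \<Longrightarrow> Tgt M (IEv M N L) = L"
  using ihom[of N L] by (auto simp: M.hom_iff)

lemma ihom_transpose:
  assumes "X \<in> Obj C" "N \<in> Obj M" "f \<in> Hom M (X \<rhd>\<^sub>o N) L"
  shows "ihom_transpose C M X N L f \<in> Hom C X (IHom M N L)"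
    and "IEv M N L \<cdot> (ihom_transpose C M X N L f \<rhd>\<^sub>a Idn M N) = f"
  using theI'[OF ihom_universal[OF assms(1,2) _ assms(3)]] M.hom_obj[OF assms(3)]
  unfolding ihom_transpose_def by auto

lemma ihom_eqI:
  assumes h: "h \<in> Hom C X (IHom M N L)" and h': "h' \<in> Hom C X (IHom M N L)"
    and N: "N \<in> Obj M" "L \<in> Obj M"
    and eq: "IEv M N L \<cdot> (h \<rhd>\<^sub>a Idn M N) = IEv M N L \<cdot> (h' \<rhd>\<^sub>a Idn M N)"
  shows "h = h'"
proof -
  note [simp] = h[unfolded C.hom_iff] C.hom_obj[OF h] N
  have "IEv M N L \<cdot> (h \<rhd>\<^sub>a Idn M N) \<in> Hom M (X \<rhd>\<^sub>o N) L" by (simp add: M.hom_iff)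
  from ihom_universal[OF _ N this] show ?thesis using h h' eq by auto
qed

lemma ihom_arr_hom:
  assumes "g \<in> Hom M N' N" "f \<in> Hom M L L'"
  shows "ihom_arr C M g f \<in> Hom C (IHom M N L) (IHom M N' L')"
    and "IEv M N' L' \<cdot> (ihom_arr C M g f \<rhd>\<^sub>a Idn M N') = f \<cdot> IEv M N L \<cdot> (Idn C (IHom M N L) \<rhd>\<^sub>a g)"
proof -
  note [simp] = assms[unfolded M.hom_iff] M.hom_obj[OF assms(1)] M.hom_obj[OF assms(2)]
  let ?f = "f \<cdot> IEv M N L \<cdot> (Idn C (IHom M N L) \<rhd>\<^sub>a g)"
  have f: "?f \<in> Hom M (IHom M N L \<rhd>\<^sub>o N') L'" by (simp add: M.hom_iff)
  show "ihom_arr C M g f \<in> Hom C (IHom M N L) (IHom M N' L')"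
    "IEv M N' L' \<cdot> (ihom_arr C M g f \<rhd>\<^sub>a Idn M N') = ?f"
    using ihom_transpose[OF _ _ f] by (auto simp: ihom_arr_def)
qed

lemma arr_ihom_arr [simp]:
  assumes "g \<in> Arr M" "f \<in> Arr M"
  shows "ihom_arr C M g f \<in> Arr C"
    "Src C (ihom_arr C M g f) = IHom M (Tgt M g) (Src M f)"
    "Tgt C (ihom_arr C M g f) = IHom M (Src M g) (Tgt M f)"
  using ihom_arr_hom(1)[OF M.arr_hom[OF assms(1)] M.arr_hom[OF assms(2)]] by (auto simp: C.hom_iff)

text \<open>
  The adjunct of $[g, f] h$ in terms of $h$. Equations between morphisms into internal Homs are
  checked on adjuncts with the help of this formula.
\<close>

lemma iev_ihom_arr:
  assumes g: "g \<in> Hom M N' N" and f: "f \<in> Hom M L L'" and h: "h \<in> Hom C X (IHom M N L)"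
  shows "IEv M N' L' \<cdot> ((ihom_arr C M g f \<cdot>\<^bsub>C\<^esub> h) \<rhd>\<^sub>a Idn M N') = f \<cdot> IEv M N L \<cdot> (h \<rhd>\<^sub>a g)"
proof -
  note [simp] = f[unfolded M.hom_iff] g[unfolded M.hom_iff] M.hom_obj[OF f] M.hom_obj[OF g]
    h[unfolded C.hom_iff] C.hom_obj[OF h]
  have "IEv M N' L' \<cdot> ((ihom_arr C M g f \<cdot>\<^bsub>C\<^esub> h) \<rhd>\<^sub>a Idn M N') =
      (IEv M N' L' \<cdot> (ihom_arr C M g f \<rhd>\<^sub>a Idn M N')) \<cdot> (h \<rhd>\<^sub>a Idn M N')"
    by (simp add: act_interchange)
  also have "\<dots> = f \<cdot> IEv M N L \<cdot> (h \<rhd>\<^sub>a g)"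
    unfolding ihom_arr_hom(2)[OF g f] by (simp add: act_interchange)
  finally show ?thesis .
qed

lemma ihom_arr_comp:
  assumes g: "g \<in> Hom M N' N" and f: "f \<in> Hom M L L'"
    and g': "g' \<in> Hom M N'' N'" and f': "f' \<in> Hom M L' L''"
  shows "ihom_arr C M g' f' \<cdot>\<^bsub>C\<^esub> ihom_arr C M g f = ihom_arr C M (g \<cdot> g') (f' \<cdot> f)"
proof (rule ihom_eqI)
  note [simp] = f[unfolded M.hom_iff] g[unfolded M.hom_iff] M.hom_obj[OF f] M.hom_obj[OF g]
    f'[unfolded M.hom_iff] g'[unfolded M.hom_iff] M.hom_obj[OF f'] M.hom_obj[OF g']
  show "ihom_arr C M g' f' \<cdot>\<^bsub>C\<^esub> ihom_arr C M g f \<in> Hom C (IHom M N L) (IHom M N'' L'')"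
    "ihom_arr C M (g \<cdot> g') (f' \<cdot> f) \<in> Hom C (IHom M N L) (IHom M N'' L'')"
    "N'' \<in> Obj M" "L'' \<in> Obj M" by (simp_all add: C.hom_iff)
  have "IEv M N'' L'' \<cdot> ((ihom_arr C M g' f' \<cdot>\<^bsub>C\<^esub> ihom_arr C M g f) \<rhd>\<^sub>a Idn M N'') =
      f' \<cdot> IEv M N' L' \<cdot> (ihom_arr C M g f \<rhd>\<^sub>a g')"
    by (rule iev_ihom_arr[OF g' f']) (simp add: C.hom_iff)
  also have "\<dots> = f' \<cdot> (IEv M N' L' \<cdot> (ihom_arr C M g f \<rhd>\<^sub>a Idn M N')) \<cdot> (Idn C (IHom M N L) \<rhd>\<^sub>a g')"
    by (simp add: act_interchange)
  also have "\<dots> = (f' \<cdot> f) \<cdot> IEv M N L \<cdot> (Idn C (IHom M N L) \<rhd>\<^sub>a (g \<cdot> g'))"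
    unfolding ihom_arr_hom(2)[OF g f] by (simp add: act_interchange)
  also have "\<dots> = IEv M N'' L'' \<cdot> (ihom_arr C M (g \<cdot> g') (f' \<cdot> f) \<rhd>\<^sub>a Idn M N'')"
    by (rule ihom_arr_hom(2)[symmetric]) (auto simp: M.hom_iff)
  finally show "IEv M N'' L'' \<cdot> ((ihom_arr C M g' f' \<cdot>\<^bsub>C\<^esub> ihom_arr C M g f) \<rhd>\<^sub>a Idn M N'') = \<dots>" .
qed

lemma ihom_arr_zero:
  assumes N: "N \<in> Obj M" "N' \<in> Obj M" and f: "f \<in> Hom M L L'" and h: "h \<in> Hom C X (IHom M N L)"
  shows "ihom_arr C M (Zero M N' N) f \<cdot>\<^bsub>C\<^esub> h = Zero C X (IHom M N' L')"
proof (rule ihom_eqI)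
  note [simp] = f[unfolded M.hom_iff] N M.hom_obj[OF f] h[unfolded C.hom_iff] C.hom_obj[OF h]
  show "ihom_arr C M (Zero M N' N) f \<cdot>\<^bsub>C\<^esub> h \<in> Hom C X (IHom M N' L')"
    "Zero C X (IHom M N' L') \<in> Hom C X (IHom M N' L')"
    "N' \<in> Obj M" "L' \<in> Obj M" by (simp_all add: C.hom_iff)
  have "IEv M N' L' \<cdot> ((ihom_arr C M (Zero M N' N) f \<cdot>\<^bsub>C\<^esub> h) \<rhd>\<^sub>a Idn M N') =
      (f \<cdot> IEv M N L) \<cdot> Zero M (X \<rhd>\<^sub>o N') (IHom M N L \<rhd>\<^sub>o N)"
    using iev_ihom_arr[OF _ f h, of "Zero M N' N" N'] act_zero_right[OF h, of N' N]
    by (simp add: M.hom_iff)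
  also have "\<dots> = Zero M (X \<rhd>\<^sub>o N') L'"
    by (rule M.comp_zero_right) (auto simp: M.hom_iff)
  also have "\<dots> = IEv M N' L' \<cdot> (Zero C X (IHom M N' L') \<rhd>\<^sub>a Idn M N')"
    using M.comp_zero_right[of "IEv M N' L'" "IHom M N' L' \<rhd>\<^sub>o N'" L' "X \<rhd>\<^sub>o N'"]
      act_zero_left[of "Idn M N'" N' N' X "IHom M N' L'"] by (simp add: M.hom_iff)
  finally show "IEv M N' L' \<cdot> ((ihom_arr C M (Zero M N' N) f \<cdot>\<^bsub>C\<^esub> h) \<rhd>\<^sub>a Idn M N') = \<dots>" .
qed

lemma ihom_post_mono:
  assumes f: "f \<in> Hom M L L'" and mono: "is_mono M f" and N: "N \<in> Obj M"
    and s: "s \<in> Hom C X (IHom M N L)" and t: "t \<in> Hom C X (IHom M N L)"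
    and eq: "ihom_arr C M (Idn M N) f \<cdot>\<^bsub>C\<^esub> s = ihom_arr C M (Idn M N) f \<cdot>\<^bsub>C\<^esub> t"
  shows "s = t"
proof (rule ihom_eqI[OF s t N])
  note [simp] = f[unfolded M.hom_iff] N M.hom_obj[OF f] s[unfolded C.hom_iff] t[unfolded C.hom_iff]
    C.hom_obj[OF s]
  show "L \<in> Obj M" by simp
  have "f \<cdot> IEv M N L \<cdot> (s \<rhd>\<^sub>a Idn M N) = f \<cdot> IEv M N L \<cdot> (t \<rhd>\<^sub>a Idn M N)"
    using iev_ihom_arr[OF M.idn_hom[OF N] f s] iev_ihom_arr[OF M.idn_hom[OF N] f t] eq by simp
  then show "IEv M N L \<cdot> (s \<rhd>\<^sub>a Idn M N) = IEv M N L \<cdot> (t \<rhd>\<^sub>a Idn M N)"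
    by - (rule M.mono_cancel[OF mono], auto)
qed

text \<open>
  A right adjoint preserves kernels: the adjunct of $w$ is killed by $g$ and hence factors
  through $f$.
\<close>

lemma ihom_post_kernel:
  assumes k: "is_kernel M g f" and f: "f \<in> Hom M L L'" and g: "g \<in> Hom M L' L''" and N: "N \<in> Obj M"
    and w: "w \<in> Hom C X (IHom M N L')"
    and eq: "ihom_arr C M (Idn M N) g \<cdot>\<^bsub>C\<^esub> w = Zero C X (IHom M N L'')"
  shows "\<exists>t\<in>Hom C X (IHom M N L). ihom_arr C M (Idn M N) f \<cdot>\<^bsub>C\<^esub> t = w"
proof -
  note [simp] = f[unfolded M.hom_iff] g[unfolded M.hom_iff] N M.hom_obj[OF f] M.hom_obj[OF g]
    w[unfolded C.hom_iff] C.hom_obj[OF w]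
  let ?w = "IEv M N L' \<cdot> (w \<rhd>\<^sub>a Idn M N)"
  have "g \<cdot> ?w = IEv M N L'' \<cdot> (Zero C X (IHom M N L'') \<rhd>\<^sub>a Idn M N)"
    using iev_ihom_arr[OF M.idn_hom[OF N] g w] eq by simp
  also have "\<dots> = Zero M (X \<rhd>\<^sub>o N) L''"
    using M.comp_zero_right[of "IEv M N L''" "IHom M N L'' \<rhd>\<^sub>o N" L'' "X \<rhd>\<^sub>o N"]
      act_zero_left[of "Idn M N" N N X "IHom M N L''"] by (simp add: M.hom_iff)
  finally have "g \<cdot> ?w = Zero M (X \<rhd>\<^sub>o N) (Tgt M g)" by simp
  moreover have "?w \<in> Hom M (X \<rhd>\<^sub>o N) (Src M g)" by (simp add: M.hom_iff)
  moreover have "X \<rhd>\<^sub>o N \<in> Obj M" by simp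
  ultimately obtain u where "u \<in> Hom M (X \<rhd>\<^sub>o N) (Src M f)" "f \<cdot> u = ?w"
    using k unfolding is_kernel_def by blast
  then have u: "u \<in> Hom M (X \<rhd>\<^sub>o N) L" "f \<cdot> u = ?w" by simp_all
  note t = ihom_transpose[OF C.hom_obj[OF w, THEN conjunct1] N u(1)]
  let ?t = "ihom_transpose C M X N L u"
  have "ihom_arr C M (Idn M N) f \<cdot>\<^bsub>C\<^esub> ?t = w"
  proof (rule ihom_eqI[OF _ w N])
    show "ihom_arr C M (Idn M N) f \<cdot>\<^bsub>C\<^esub> ?t \<in> Hom C X (IHom M N L')" "L' \<in> Obj M"
      using t(1) by (simp_all add: C.hom_iff)
    show "IEv M N L' \<cdot> ((ihom_arr C M (Idn M N) f \<cdot>\<^bsub>C\<^esub> ?t) \<rhd>\<^sub>a Idn M N) = ?w"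
      using iev_ihom_arr[OF M.idn_hom[OF N] f t(1)] t(2) u(2) by simp
  qed
  then show ?thesis using t(1) by blast
qed

text \<open>
  On adjuncts, $[g, 1]$ is precomposition with $X \rhd g$, which is epic because the action by $X$
  preserves the cokernel $g$.
\<close>

lemma ihom_pre_cokernel_mono:
  assumes k: "is_cokernel M f g" and g: "g \<in> Hom M N' N" and L: "L \<in> Obj M"
    and s: "s \<in> Hom C X (IHom M N L)" and t: "t \<in> Hom C X (IHom M N L)"
    and eq: "ihom_arr C M g (Idn M L) \<cdot>\<^bsub>C\<^esub> s = ihom_arr C M g (Idn M L) \<cdot>\<^bsub>C\<^esub> t"
  shows "s = t"
proof (rule ihom_eqI[OF s t _ L])
  note [simp] = g[unfolded M.hom_iff] L M.hom_obj[OF g] s[unfolded C.hom_iff] t[unfolded C.hom_iff]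
    C.hom_obj[OF s]
  show "N \<in> Obj M" by simp
  have "is_cokernel M (Idn C X \<rhd>\<^sub>a f) (Idn C X \<rhd>\<^sub>a g)"
    using act_by_right_exact[of X] k by (simp add: is_right_exact_def act_by_obj_def)
  note epi = M.cokernel_epi[OF this]
  have "IEv M N L \<cdot> (s \<rhd>\<^sub>a g) = IEv M N L \<cdot> (t \<rhd>\<^sub>a g)"
    using iev_ihom_arr[OF g M.idn_hom[OF L] s] iev_ihom_arr[OF g M.idn_hom[OF L] t] eq by simp
  then have "(IEv M N L \<cdot> (s \<rhd>\<^sub>a Idn M N)) \<cdot> (Idn C X \<rhd>\<^sub>a g) =
      (IEv M N L \<cdot> (t \<rhd>\<^sub>a Idn M N)) \<cdot> (Idn C X \<rhd>\<^sub>a g)"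
    by (simp add: act_interchange)
  then show "IEv M N L \<cdot> (s \<rhd>\<^sub>a Idn M N) = IEv M N L \<cdot> (t \<rhd>\<^sub>a Idn M N)"
    by - (rule M.epi_cancel[OF epi], auto)
qed

end

context relative_serre_functor begin

lemma serre_obj [simp]: "N \<in> Obj M \<Longrightarrow> FObj S N \<in> Obj M"
  using serre_functor by (auto simp: is_functor_def)

lemma serre_arr [simp]:
  "f \<in> Arr M \<Longrightarrow> FArr S f \<in> Arr M" "f \<in> Arr M \<Longrightarrow> Src M (FArr S f) = FObj S (Src M f)"
  "f \<in> Arr M \<Longrightarrow> Tgt M (FArr S f) = FObj S (Tgt M f)"
  "N \<in> Obj M \<Longrightarrow> FArr S (Idn M N) = Idn M (FObj S N)"
  using serre_functor by (auto simp: is_functor_def M.hom_iff)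

lemma arr_serre_dual [simp]:
  "\<lbrakk>N \<in> Obj M; L \<in> Obj M\<rbrakk> \<Longrightarrow> \<dd> N L \<in> Arr C"
  "\<lbrakk>N \<in> Obj M; L \<in> Obj M\<rbrakk> \<Longrightarrow> Src C (\<dd> N L) = Dual C (IHom M N L)"
  "\<lbrakk>N \<in> Obj M; L \<in> Obj M\<rbrakk> \<Longrightarrow> Tgt C (\<dd> N L) = IHom M L (FObj S N)"
  using serre_hom[of N L] by (auto simp: C.hom_iff)

text \<open>
  The Serre isomorphism identifies the dual of $[1, g]$ with $[g, 1]$, which is monic by
  \<open>ihom_pre_cokernel_mono\<close>. Since the dual functor is contravariant and faithful, $[1, g]$ is epic.
\<close>

lemma ihom_post_epi:
  assumes k: "is_cokernel M f g" and g: "g \<in> Hom M L L'" and N: "N \<in> Obj M"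
  shows "is_epi C (ihom_arr C M (Idn M N) g)"
  unfolding is_epi_def
proof (intro conjI ballI impI)
  note [simp] = g[unfolded M.hom_iff] N M.hom_obj[OF g]
  let ?g = "ihom_arr C M (Idn M N) g"
  show "?g \<in> Arr C" by simp
  fix W u v
  assume W: "W \<in> Obj C" and "u \<in> Hom C (Tgt C ?g) W" "v \<in> Hom C (Tgt C ?g) W"
    and uv: "u \<cdot>\<^bsub>C\<^esub> ?g = v \<cdot>\<^bsub>C\<^esub> ?g"
  then have u: "u \<in> Hom C (IHom M N L') W" and v: "v \<in> Hom C (IHom M N L') W"
    by simp_all
  have g': "?g \<in> Hom C (IHom M N L) (IHom M N L')" by (simp add: C.hom_iff)
  note ud = C.dual_arr_hom[OF u, unfolded C.hom_iff] and vd = C.dual_arr_hom[OF v, unfolded C.hom_iff]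
    and gd = C.dual_arr_hom[OF g', unfolded C.hom_iff]
  have nat: "\<dd> N L \<cdot>\<^bsub>C\<^esub> dual_arr C ?g = ihom_arr C M g (Idn M (FObj S N)) \<cdot>\<^bsub>C\<^esub> \<dd> N L'"
    using serre_natural[OF M.idn_hom[OF N] g] by simp
  have step: "\<dd> N L \<cdot>\<^bsub>C\<^esub> dual_arr C (x \<cdot>\<^bsub>C\<^esub> ?g) =
      ihom_arr C M g (Idn M (FObj S N)) \<cdot>\<^bsub>C\<^esub> \<dd> N L' \<cdot>\<^bsub>C\<^esub> dual_arr C x"
    if x: "x \<in> Hom C (IHom M N L') W" for x
    using C.dual_arr_hom[OF x, unfolded C.hom_iff] gd C.comp_tail[OF nat, of "dual_arr C x"]
    by (simp add: C.dual_arr_comp[OF g' x])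
  have "\<dd> N L' \<cdot>\<^bsub>C\<^esub> dual_arr C u = \<dd> N L' \<cdot>\<^bsub>C\<^esub> dual_arr C v"
  proof (rule ihom_pre_cokernel_mono[OF k g])
    show "ihom_arr C M g (Idn M (FObj S N)) \<cdot>\<^bsub>C\<^esub> \<dd> N L' \<cdot>\<^bsub>C\<^esub> dual_arr C u =
        ihom_arr C M g (Idn M (FObj S N)) \<cdot>\<^bsub>C\<^esub> \<dd> N L' \<cdot>\<^bsub>C\<^esub> dual_arr C v"
      unfolding step[OF u, symmetric] step[OF v, symmetric] uv ..
    show "FObj S N \<in> Obj M"
      "\<dd> N L' \<cdot>\<^bsub>C\<^esub> dual_arr C u \<in> Hom C (Dual C W) (IHom M L' (FObj S N))"
      "\<dd> N L' \<cdot>\<^bsub>C\<^esub> dual_arr C v \<in> Hom C (Dual C W) (IHom M L' (FObj S N))"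
      using ud vd by (simp_all add: C.hom_iff)
  qed
  then have "dual_arr C u = dual_arr C v"
    using ud vd serre_iso[of N L'] by - (rule C.iso_cancel_left[of "\<dd> N L'"], auto)
  then show "u = v" by (rule C.dual_arr_faithful[OF u v])
qed

lemma iev_ihom_coev:
  assumes "X \<in> Obj C" "N \<in> Obj M"
  shows "ihom_coev C M X N \<in> Hom C X (IHom M N (X \<rhd>\<^sub>o N))"
    and "IEv M N (X \<rhd>\<^sub>o N) \<cdot> (ihom_coev C M X N \<rhd>\<^sub>a Idn M N) = Idn M (X \<rhd>\<^sub>o N)"
  using assms ihom_transpose[OF assms, of "Idn M (X \<rhd>\<^sub>o N)" "X \<rhd>\<^sub>o N"]
  by (auto simp: ihom_coev_def M.hom_iff)


section \<open>The trace and its cyclicity\<close>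

context
  fixes j' :: "'p \<Rightarrow> 'b"
  assumes pivotal: "is_nat_iso M M id_fctr S j'"
begin

lemma arr_pivotal [simp]:
  "N \<in> Obj M \<Longrightarrow> j' N \<in> Arr M" "N \<in> Obj M \<Longrightarrow> Src M (j' N) = N" "N \<in> Obj M \<Longrightarrow> Tgt M (j' N) = FObj S N"
  using pivotal by (auto simp: is_nat_iso_def id_fctr_def M.hom_iff)

lemma pivotal_nat: "f \<in> Hom M N L \<Longrightarrow> j' L \<cdot> f = FArr S f \<cdot> j' N"
  using pivotal by (auto simp: is_nat_iso_def id_fctr_def M.hom_iff)

text \<open>
  The right-hand side of the equation defining the trace; its adjunct is essentially the component
  of the pivotal structure at $N$, see \<open>iev_pivotal_element\<close>.
\<close>

definition pivotal_element :: "'p \<Rightarrow> 'a" where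
  "pivotal_element N = ihom_arr C M (Idn M N) (j' N) \<cdot>\<^bsub>C\<^esub>
     ihom_arr C M (Idn M N) (ActUnit M N) \<cdot>\<^bsub>C\<^esub> ihom_coev C M (Unit C) N"

lemma pivotal_element_hom:
  "N \<in> Obj M \<Longrightarrow> pivotal_element N \<in> Hom C (Unit C) (IHom M N (FObj S N))"
  using iev_ihom_coev(1)[of "Unit C" N] by (simp add: pivotal_element_def C.hom_iff)

lemma iev_pivotal_element:
  assumes [simp]: "N \<in> Obj M"
  shows "IEv M N (FObj S N) \<cdot> (pivotal_element N \<rhd>\<^sub>a Idn M N) = j' N \<cdot> ActUnit M N"
proof -
  let ?c = "ihom_coev C M (Unit C) N"
  have c: "?c \<in> Hom C (Unit C) (IHom M N (Unit C \<rhd>\<^sub>o N))"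
    by (rule iev_ihom_coev(1)) auto
  note [simp] = c[unfolded C.hom_iff]
  have jN: "j' N \<in> Hom M N (FObj S N)" and u: "ActUnit M N \<in> Hom M (Unit C \<rhd>\<^sub>o N) N"
    and ju: "j' N \<cdot> ActUnit M N \<in> Hom M (Unit C \<rhd>\<^sub>o N) (FObj S N)"
    by (simp_all add: M.hom_iff)
  have "pivotal_element N = ihom_arr C M (Idn M N) (j' N \<cdot> ActUnit M N) \<cdot>\<^bsub>C\<^esub> ?c"
    using C.comp_tail[OF ihom_arr_comp[OF M.idn_hom[OF assms] u M.idn_hom[OF assms] jN], of ?c]
    by (simp add: pivotal_element_def)
  then have "IEv M N (FObj S N) \<cdot> (pivotal_element N \<rhd>\<^sub>a Idn M N) =
      (j' N \<cdot> ActUnit M N) \<cdot> IEv M N (Unit C \<rhd>\<^sub>o N) \<cdot> (?c \<rhd>\<^sub>a Idn M N)"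
    using iev_ihom_arr[OF M.idn_hom[OF assms] ju c] by simp
  then show ?thesis by (simp add: iev_ihom_coev(2))
qed

text \<open>
  The Serre isomorphism is invertible, and every morphism from $\mathbf{1}$ to the dual of $[N, N]$ comes
  from exactly one morphism to $\mathbf{1}$, so the defining equation has exactly one solution.
\<close>

lemma internal_trace_spec:
  assumes [simp]: "N \<in> Obj M"
  shows "internal_trace C M \<dd> j' N \<in> Hom C (IHom M N N) (Unit C)"
    and "\<dd> N N \<cdot>\<^bsub>C\<^esub> dual_arr C (internal_trace C M \<dd> j' N) \<cdot>\<^bsub>C\<^esub> dual_unit C = pivotal_element N"
proof -
  note p [simp] = pivotal_element_hom[OF assms, unfolded C.hom_iff]
  note d [simp] = serre_iso[OF assms assms]
  obtain t where t: "t \<in> Hom C (IHom M N N) (Unit C)"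
    and tp: "dual_arr C t \<cdot>\<^bsub>C\<^esub> dual_unit C = Inv C (\<dd> N N) \<cdot>\<^bsub>C\<^esub> pivotal_element N"
    using C.dual_arr_unit_surj[of "IHom M N N" "Inv C (\<dd> N N) \<cdot>\<^bsub>C\<^esub> pivotal_element N"]
    by (auto simp: C.hom_iff)
  have dt_hom: "dual_arr C s \<cdot>\<^bsub>C\<^esub> dual_unit C \<in> Hom C (Unit C) (Dual C (IHom M N N))"
    if "s \<in> Hom C (IHom M N N) (Unit C)" for s
    by (rule C.comp_hom[OF C.dual_unit_hom C.dual_arr_hom[OF that]])
  have "\<exists>!t. t \<in> Hom C (IHom M N N) (Unit C) \<and>
      \<dd> N N \<cdot>\<^bsub>C\<^esub> dual_arr C t \<cdot>\<^bsub>C\<^esub> dual_unit C = pivotal_element N"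
  proof (intro ex1I conjI)
    show "t \<in> Hom C (IHom M N N) (Unit C)" by (rule t)
    show t': "\<dd> N N \<cdot>\<^bsub>C\<^esub> dual_arr C t \<cdot>\<^bsub>C\<^esub> dual_unit C = pivotal_element N"
      by (simp add: tp)
    fix s assume s: "s \<in> Hom C (IHom M N N) (Unit C) \<and>
      \<dd> N N \<cdot>\<^bsub>C\<^esub> dual_arr C s \<cdot>\<^bsub>C\<^esub> dual_unit C = pivotal_element N"
    have "dual_arr C s \<cdot>\<^bsub>C\<^esub> dual_unit C = dual_arr C t \<cdot>\<^bsub>C\<^esub> dual_unit C"
      using dt_hom[OF t] dt_hom[OF s[THEN conjunct1]] s t'
      by - (rule C.iso_cancel_left[OF d], auto simp: C.hom_iff)
    then show "s = t" using C.dual_arr_unit_inj s t by blast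
  qed
  from theI'[OF this] show "internal_trace C M \<dd> j' N \<in> Hom C (IHom M N N) (Unit C)"
    "\<dd> N N \<cdot>\<^bsub>C\<^esub> dual_arr C (internal_trace C M \<dd> j' N) \<cdot>\<^bsub>C\<^esub> dual_unit C = pivotal_element N"
    by (simp_all add: internal_trace_def pivotal_element_def)
qed

text \<open>
  By naturality of the Serre isomorphism, the two sides correspond to morphisms
  $\mathbf{1} \to [N, S L]$ with adjuncts $S(f) j'_N$ and $j'_L f$, up to the unit constraint. These agree
  because $j'$ is natural.
\<close>

lemma internal_trace_cyclic:
  assumes f: "f \<in> Hom M N L"
  shows "internal_trace C M \<dd> j' N \<cdot>\<^bsub>C\<^esub> ihom_arr C M f (Idn M N) =
    internal_trace C M \<dd> j' L \<cdot>\<^bsub>C\<^esub> ihom_arr C M (Idn M L) f"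
proof -
  note [simp] = f[unfolded M.hom_iff] M.hom_obj[OF f]
  have N: "N \<in> Obj M" and L: "L \<in> Obj M" by simp_all
  let ?tN = "internal_trace C M \<dd> j' N" and ?tL = "internal_trace C M \<dd> j' L"
  let ?a = "ihom_arr C M f (Idn M N)" and ?b = "ihom_arr C M (Idn M L) f"
  have a: "?a \<in> Hom C (IHom M L N) (IHom M N N)" and b: "?b \<in> Hom C (IHom M L N) (IHom M L L)"
    by (simp_all add: C.hom_iff)
  note tN = internal_trace_spec[OF N] and tL = internal_trace_spec[OF L]
  note [simp] = tN(1)[unfolded C.hom_iff] tL(1)[unfolded C.hom_iff] C.dual_unit_hom[unfolded C.hom_iff]
    C.dual_arr_hom[OF tN(1), unfolded C.hom_iff] C.dual_arr_hom[OF tL(1), unfolded C.hom_iff]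
    C.dual_arr_hom[OF a, unfolded C.hom_iff] C.dual_arr_hom[OF b, unfolded C.hom_iff]
    pivotal_element_hom[OF N, unfolded C.hom_iff] pivotal_element_hom[OF L, unfolded C.hom_iff]
  have na: "\<dd> L N \<cdot>\<^bsub>C\<^esub> dual_arr C ?a = ihom_arr C M (Idn M N) (FArr S f) \<cdot>\<^bsub>C\<^esub> \<dd> N N"
    using serre_natural[OF f M.idn_hom[OF N]] .
  have nb: "\<dd> L N \<cdot>\<^bsub>C\<^esub> dual_arr C ?b = ihom_arr C M f (Idn M (FObj S L)) \<cdot>\<^bsub>C\<^esub> \<dd> L L"
    using serre_natural[OF M.idn_hom[OF L] f] by simp
  have "\<dd> L N \<cdot>\<^bsub>C\<^esub> dual_arr C (?tN \<cdot>\<^bsub>C\<^esub> ?a) \<cdot>\<^bsub>C\<^esub> dual_unit C =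
      ihom_arr C M (Idn M N) (FArr S f) \<cdot>\<^bsub>C\<^esub> pivotal_element N"
    using C.comp_tail[OF na, of "dual_arr C ?tN \<cdot>\<^bsub>C\<^esub> dual_unit C"]
    by (simp add: C.dual_arr_comp[OF a tN(1)] tN(2))
  also have "\<dots> = ihom_arr C M f (Idn M (FObj S L)) \<cdot>\<^bsub>C\<^esub> pivotal_element L"
  proof (rule ihom_eqI)
    show "ihom_arr C M (Idn M N) (FArr S f) \<cdot>\<^bsub>C\<^esub> pivotal_element N \<in> Hom C (Unit C) (IHom M N (FObj S L))"
      "ihom_arr C M f (Idn M (FObj S L)) \<cdot>\<^bsub>C\<^esub> pivotal_element L \<in> Hom C (Unit C) (IHom M N (FObj S L))"
      "N \<in> Obj M" "FObj S L \<in> Obj M" by (simp_all add: C.hom_iff)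
    have "IEv M N (FObj S L) \<cdot> ((ihom_arr C M (Idn M N) (FArr S f) \<cdot>\<^bsub>C\<^esub> pivotal_element N) \<rhd>\<^sub>a Idn M N) =
        FArr S f \<cdot> j' N \<cdot> ActUnit M N"
      using iev_ihom_arr[OF M.idn_hom[OF N] _ pivotal_element_hom[OF N], of "FArr S f" "FObj S L"]
      by (simp add: M.hom_iff iev_pivotal_element)
    also have "\<dots> = j' L \<cdot> f \<cdot> ActUnit M N"
      using M.comp_tail[OF pivotal_nat[OF f], of "ActUnit M N"] by simp
    also have "\<dots> = j' L \<cdot> ActUnit M L \<cdot> (Idn C (Unit C) \<rhd>\<^sub>a f)"
      by (simp add: act_unit_natural[OF f])
    also have "\<dots> = (IEv M L (FObj S L) \<cdot> (pivotal_element L \<rhd>\<^sub>a Idn M L)) \<cdot> (Idn C (Unit C) \<rhd>\<^sub>a f)"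
      by (simp add: iev_pivotal_element del: M.assoc_comp) simp
    also have "\<dots> = IEv M L (FObj S L) \<cdot> (pivotal_element L \<rhd>\<^sub>a f)"
      by (simp add: act_interchange)
    also have "\<dots> = IEv M N (FObj S L) \<cdot>
        ((ihom_arr C M f (Idn M (FObj S L)) \<cdot>\<^bsub>C\<^esub> pivotal_element L) \<rhd>\<^sub>a Idn M N)"
      using iev_ihom_arr[OF f M.idn_hom pivotal_element_hom[OF L]] by simp
    finally show "IEv M N (FObj S L) \<cdot>
        ((ihom_arr C M (Idn M N) (FArr S f) \<cdot>\<^bsub>C\<^esub> pivotal_element N) \<rhd>\<^sub>a Idn M N) = \<dots>" .
  qed
  also have "\<dots> = \<dd> L N \<cdot>\<^bsub>C\<^esub> dual_arr C (?tL \<cdot>\<^bsub>C\<^esub> ?b) \<cdot>\<^bsub>C\<^esub> dual_unit C"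
    using C.comp_tail[OF nb, of "dual_arr C ?tL \<cdot>\<^bsub>C\<^esub> dual_unit C"]
    by (simp add: C.dual_arr_comp[OF b tL(1)] tL(2))
  finally have "dual_arr C (?tN \<cdot>\<^bsub>C\<^esub> ?a) \<cdot>\<^bsub>C\<^esub> dual_unit C = dual_arr C (?tL \<cdot>\<^bsub>C\<^esub> ?b) \<cdot>\<^bsub>C\<^esub> dual_unit C"
    using serre_iso[OF L N]
    by - (rule C.iso_cancel_left[of "\<dd> L N"], auto simp: C.dual_arr_comp[OF a tN(1)] C.dual_arr_comp[OF b tL(1)])
  then show ?thesis
    by (rule C.dual_arr_unit_inj[rotated 2]) (auto simp: C.hom_iff)
qed


section \<open>Additivity of the internal character\<close>

text \<open>
  Along each $e$ that admits a lift $s$, the component $\pi_2 e$ splits as $[1, f] u + [g, 1] s$,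
  and cyclicity turns the trace of the two summands into the traces at $M_1$ and $M_3$.
\<close>

lemma internal_character_additive:
  assumes A: "is_end C M A \<pi>" and ex: "short_exact M M\<^sub>1 f M\<^sub>2 g M\<^sub>3"
  shows "internal_character C M \<dd> j' \<pi> M\<^sub>2 =
    internal_character C M \<dd> j' \<pi> M\<^sub>1 \<^bold>+\<^bsub>C\<^esub> internal_character C M \<dd> j' \<pi> M\<^sub>3"
proof -
  have f: "f \<in> Hom M M\<^sub>1 M\<^sub>2" and g: "g \<in> Hom M M\<^sub>2 M\<^sub>3"
    and ker: "is_kernel M g f" and coker: "is_cokernel M f g"
    using ex by (auto simp: short_exact_def)
  note [simp] = f[unfolded M.hom_iff] g[unfolded M.hom_iff] M.hom_obj[OF f] M.hom_obj[OF g]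
  have gf: "g \<cdot> f = Zero M M\<^sub>1 M\<^sub>3" using ker by (simp add: is_kernel_def)
  have din: "is_dinatural C M A \<pi>" using A by (simp add: is_end_def)
  have A [simp]: "A \<in> Obj C" using din by (simp add: is_dinatural_def)
  have pi: "\<pi> N \<in> Hom C A (IHom M N N)" if "N \<in> Obj M" for N
    using din that by (simp add: is_dinatural_def)
  have din': "ihom_arr C M (Idn M N) h \<cdot>\<^bsub>C\<^esub> \<pi> N = ihom_arr C M h (Idn M N') \<cdot>\<^bsub>C\<^esub> \<pi> N'"
    if h: "h \<in> Hom M N N'" for h N N'
    using din M.hom_obj[OF h] h by (auto simp: is_dinatural_def)
  let ?t = "internal_trace C M \<dd> j'"
  have t: "?t N \<in> Hom C (IHom M N N) (Unit C)" if "N \<in> Obj M" for N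
    using internal_trace_spec(1)[OF that] .
  note [simp] = pi[unfolded C.hom_iff] t[unfolded C.hom_iff]
  let ?p = "ihom_arr C M (Idn M M\<^sub>3) g"
  have "?t M\<^sub>2 \<cdot>\<^bsub>C\<^esub> \<pi> M\<^sub>2 = ?t M\<^sub>1 \<cdot>\<^bsub>C\<^esub> \<pi> M\<^sub>1 \<^bold>+\<^bsub>C\<^esub> ?t M\<^sub>3 \<cdot>\<^bsub>C\<^esub> \<pi> M\<^sub>3"
  proof (rule C.epi_joint_epi)
    show "is_epi C ?p" by (rule ihom_post_epi[OF coker g]) simp
    show "?p \<in> Hom C (IHom M M\<^sub>3 M\<^sub>2) (IHom M M\<^sub>3 M\<^sub>3)" "\<pi> M\<^sub>3 \<in> Hom C A (IHom M M\<^sub>3 M\<^sub>3)"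
      "?t M\<^sub>2 \<cdot>\<^bsub>C\<^esub> \<pi> M\<^sub>2 \<in> Hom C A (Unit C)"
      "?t M\<^sub>1 \<cdot>\<^bsub>C\<^esub> \<pi> M\<^sub>1 \<^bold>+\<^bsub>C\<^esub> ?t M\<^sub>3 \<cdot>\<^bsub>C\<^esub> \<pi> M\<^sub>3 \<in> Hom C A (Unit C)"
      by (simp_all add: C.hom_iff)
    fix P e s
    assume e: "e \<in> Hom C P A" and s: "s \<in> Hom C P (IHom M M\<^sub>3 M\<^sub>2)"
      and lift: "?p \<cdot>\<^bsub>C\<^esub> s = \<pi> M\<^sub>3 \<cdot>\<^bsub>C\<^esub> e"
    note [simp] = e[unfolded C.hom_iff] s[unfolded C.hom_iff] C.hom_obj[OF e]
    let ?gi = "ihom_arr C M g (Idn M M\<^sub>2)" and ?ig = "ihom_arr C M (Idn M M\<^sub>2) g"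
    let ?if = "ihom_arr C M (Idn M M\<^sub>2) f" and ?fi = "ihom_arr C M f (Idn M M\<^sub>1)"
    let ?a = "?gi \<cdot>\<^bsub>C\<^esub> s" and ?x = "\<pi> M\<^sub>2 \<cdot>\<^bsub>C\<^esub> e"
    have a: "?a \<in> Hom C P (IHom M M\<^sub>2 M\<^sub>2)" and x: "?x \<in> Hom C P (IHom M M\<^sub>2 M\<^sub>2)"
      by (simp_all add: C.hom_iff)
    have "?ig \<cdot>\<^bsub>C\<^esub> ?x = ihom_arr C M g (Idn M M\<^sub>3) \<cdot>\<^bsub>C\<^esub> \<pi> M\<^sub>3 \<cdot>\<^bsub>C\<^esub> e"
      using C.comp_tail[OF din'[OF g], of e] by simp
    also have "\<dots> = ihom_arr C M g (Idn M M\<^sub>3) \<cdot>\<^bsub>C\<^esub> ?p \<cdot>\<^bsub>C\<^esub> s" by (simp add: lift)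
    also have "\<dots> = ihom_arr C M g g \<cdot>\<^bsub>C\<^esub> s"
      using C.comp_tail[OF ihom_arr_comp[OF M.idn_hom g g M.idn_hom], of s] by simp
    also have "\<dots> = ?ig \<cdot>\<^bsub>C\<^esub> ?a"
      using C.comp_tail[OF ihom_arr_comp[OF g M.idn_hom M.idn_hom g], of s] by simp
    finally have xa: "?ig \<cdot>\<^bsub>C\<^esub> ?x = ?ig \<cdot>\<^bsub>C\<^esub> ?a" .
    \<comment> \<open>The summand \<open>n\<close> is the negative of \<open>?a\<close>, so that \<open>u\<close> below accounts for \<open>?x - ?a\<close>.\<close>
    obtain n where n: "n \<in> Hom C P (IHom M M\<^sub>2 M\<^sub>2)"
      and an: "?a \<^bold>+\<^bsub>C\<^esub> n = Zero C P (IHom M M\<^sub>2 M\<^sub>2)"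
      using C.plus_inverse[OF a] by blast
    have ig: "?ig \<in> Hom C (IHom M M\<^sub>2 M\<^sub>2) (IHom M M\<^sub>2 M\<^sub>3)" by (simp add: C.hom_iff)
    have "?ig \<cdot>\<^bsub>C\<^esub> (?x \<^bold>+\<^bsub>C\<^esub> n) = ?ig \<cdot>\<^bsub>C\<^esub> (?a \<^bold>+\<^bsub>C\<^esub> n)"
      by (simp only: C.comp_plus_right[OF x n ig] C.comp_plus_right[OF a n ig] xa)
    also have "\<dots> = Zero C P (IHom M M\<^sub>2 M\<^sub>3)"
      unfolding an by (rule C.comp_zero_right[OF ig]) simp
    finally obtain u where u: "u \<in> Hom C P (IHom M M\<^sub>2 M\<^sub>1)" and ux: "?if \<cdot>\<^bsub>C\<^esub> u = ?x \<^bold>+\<^bsub>C\<^esub> n"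
      using ihom_post_kernel[OF ker f g, of M\<^sub>2 "?x \<^bold>+\<^bsub>C\<^esub> n" P] C.plus_hom[OF x n] by auto
    note [simp] = u[unfolded C.hom_iff]
    have b: "?if \<cdot>\<^bsub>C\<^esub> u \<in> Hom C P (IHom M M\<^sub>2 M\<^sub>2)" by (simp add: C.hom_iff)
    have "?if \<cdot>\<^bsub>C\<^esub> u \<^bold>+\<^bsub>C\<^esub> ?a = ?x \<^bold>+\<^bsub>C\<^esub> (?a \<^bold>+\<^bsub>C\<^esub> n)"
      unfolding ux using C.plus_assoc[OF x n a] C.plus_commute[OF a n] by simp
    then have split: "?x = ?if \<cdot>\<^bsub>C\<^esub> u \<^bold>+\<^bsub>C\<^esub> ?a"
      unfolding an using C.plus_zero[OF x] by simp
    \<comment> \<open>It suffices to compare after the monomorphism \<open>[1, f]\<close>; there the summand \<open>?a\<close> of \<open>?x\<close> does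
      not contribute because \<open>g \<cdot> f\<close> vanishes.\<close>
    have fu: "?fi \<cdot>\<^bsub>C\<^esub> u = \<pi> M\<^sub>1 \<cdot>\<^bsub>C\<^esub> e"
    proof (rule ihom_post_mono[OF f M.kernel_mono[OF ker]])
      let ?fi2 = "ihom_arr C M f (Idn M M\<^sub>2)"
      have fi2: "?fi2 \<in> Hom C (IHom M M\<^sub>2 M\<^sub>2) (IHom M M\<^sub>1 M\<^sub>2)" by (simp add: C.hom_iff)
      show "M\<^sub>1 \<in> Obj M" "?fi \<cdot>\<^bsub>C\<^esub> u \<in> Hom C P (IHom M M\<^sub>1 M\<^sub>1)" "\<pi> M\<^sub>1 \<cdot>\<^bsub>C\<^esub> e \<in> Hom C P (IHom M M\<^sub>1 M\<^sub>1)"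
        by (simp_all add: C.hom_iff)
      have "?fi2 \<cdot>\<^bsub>C\<^esub> ?a = ihom_arr C M (Zero M M\<^sub>1 M\<^sub>3) (Idn M M\<^sub>2) \<cdot>\<^bsub>C\<^esub> s"
        using C.comp_tail[OF ihom_arr_comp[OF g M.idn_hom f M.idn_hom], of M\<^sub>2 s] by (simp add: gf)
      also have "\<dots> = Zero C P (IHom M M\<^sub>1 M\<^sub>2)"
        by (rule ihom_arr_zero[OF _ _ M.idn_hom s]) auto
      finally have z: "?fi2 \<cdot>\<^bsub>C\<^esub> ?a = Zero C P (IHom M M\<^sub>1 M\<^sub>2)" .
      have "ihom_arr C M (Idn M M\<^sub>1) f \<cdot>\<^bsub>C\<^esub> \<pi> M\<^sub>1 \<cdot>\<^bsub>C\<^esub> e = ?fi2 \<cdot>\<^bsub>C\<^esub> ?x"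
        using C.comp_tail[OF din'[OF f], of e] by simp
      also have "\<dots> = ?fi2 \<cdot>\<^bsub>C\<^esub> ?if \<cdot>\<^bsub>C\<^esub> u \<^bold>+\<^bsub>C\<^esub> ?fi2 \<cdot>\<^bsub>C\<^esub> ?a"
        unfolding split by (rule C.comp_plus_right[OF b a fi2])
      also have "\<dots> = ?fi2 \<cdot>\<^bsub>C\<^esub> ?if \<cdot>\<^bsub>C\<^esub> u"
        unfolding z by (rule C.plus_zero) (simp add: C.hom_iff)
      also have "\<dots> = ihom_arr C M f f \<cdot>\<^bsub>C\<^esub> u"
        using C.comp_tail[OF ihom_arr_comp[OF M.idn_hom f f M.idn_hom], of u] by simp
      also have "\<dots> = ihom_arr C M (Idn M M\<^sub>1) f \<cdot>\<^bsub>C\<^esub> ?fi \<cdot>\<^bsub>C\<^esub> u"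
        using C.comp_tail[OF ihom_arr_comp[OF f M.idn_hom M.idn_hom f], of u] by simp
      finally show "ihom_arr C M (Idn M M\<^sub>1) f \<cdot>\<^bsub>C\<^esub> ?fi \<cdot>\<^bsub>C\<^esub> u =
          ihom_arr C M (Idn M M\<^sub>1) f \<cdot>\<^bsub>C\<^esub> \<pi> M\<^sub>1 \<cdot>\<^bsub>C\<^esub> e" ..
    qed
    have "(?t M\<^sub>2 \<cdot>\<^bsub>C\<^esub> \<pi> M\<^sub>2) \<cdot>\<^bsub>C\<^esub> e = ?t M\<^sub>2 \<cdot>\<^bsub>C\<^esub> ?x" by simp
    also have "\<dots> = ?t M\<^sub>2 \<cdot>\<^bsub>C\<^esub> ?if \<cdot>\<^bsub>C\<^esub> u \<^bold>+\<^bsub>C\<^esub> ?t M\<^sub>2 \<cdot>\<^bsub>C\<^esub> ?a"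
      unfolding split by (rule C.comp_plus_right[OF b a t]) simp
    also have "?t M\<^sub>2 \<cdot>\<^bsub>C\<^esub> ?if \<cdot>\<^bsub>C\<^esub> u = ?t M\<^sub>1 \<cdot>\<^bsub>C\<^esub> ?fi \<cdot>\<^bsub>C\<^esub> u"
      using C.comp_tail[OF internal_trace_cyclic[OF f, symmetric], of u] by simp
    also have "\<dots> = ?t M\<^sub>1 \<cdot>\<^bsub>C\<^esub> \<pi> M\<^sub>1 \<cdot>\<^bsub>C\<^esub> e" by (simp only: fu)
    also have "?t M\<^sub>2 \<cdot>\<^bsub>C\<^esub> ?a = ?t M\<^sub>3 \<cdot>\<^bsub>C\<^esub> ?p \<cdot>\<^bsub>C\<^esub> s"
      using C.comp_tail[OF internal_trace_cyclic[OF g], of s] by simp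
    also have "\<dots> = ?t M\<^sub>3 \<cdot>\<^bsub>C\<^esub> \<pi> M\<^sub>3 \<cdot>\<^bsub>C\<^esub> e" by (simp only: lift)
    also have "?t M\<^sub>1 \<cdot>\<^bsub>C\<^esub> \<pi> M\<^sub>1 \<cdot>\<^bsub>C\<^esub> e \<^bold>+\<^bsub>C\<^esub> ?t M\<^sub>3 \<cdot>\<^bsub>C\<^esub> \<pi> M\<^sub>3 \<cdot>\<^bsub>C\<^esub> e =
        (?t M\<^sub>1 \<cdot>\<^bsub>C\<^esub> \<pi> M\<^sub>1 \<^bold>+\<^bsub>C\<^esub> ?t M\<^sub>3 \<cdot>\<^bsub>C\<^esub> \<pi> M\<^sub>3) \<cdot>\<^bsub>C\<^esub> e"
      using C.comp_plus_left[OF e, of "?t M\<^sub>1 \<cdot>\<^bsub>C\<^esub> \<pi> M\<^sub>1" "Unit C" "?t M\<^sub>3 \<cdot>\<^bsub>C\<^esub> \<pi> M\<^sub>3"]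
      by (simp add: C.hom_iff)
    finally show "(?t M\<^sub>2 \<cdot>\<^bsub>C\<^esub> \<pi> M\<^sub>2) \<cdot>\<^bsub>C\<^esub> e =
        (?t M\<^sub>1 \<cdot>\<^bsub>C\<^esub> \<pi> M\<^sub>1 \<^bold>+\<^bsub>C\<^esub> ?t M\<^sub>3 \<cdot>\<^bsub>C\<^esub> \<pi> M\<^sub>3) \<cdot>\<^bsub>C\<^esub> e" .
  qed
  then show ?thesis by (simp add: internal_character_def)
qed

end

end

theorem lemma5p10:
  fixes C :: "('o, 'a, 'k::alg_closed_field) tensor_cat"
    and j :: "'o \<Rightarrow> 'a"
    and M :: "('p, 'b, 'k, 'o, 'a) module_cat"
    and S :: "('p, 'b, 'p, 'b) fctr"
    and \<dd> :: "'p \<Rightarrow> 'p \<Rightarrow> 'a"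
    and \<zeta> :: "'o \<Rightarrow> 'p \<Rightarrow> 'b"
    and j' :: "'p \<Rightarrow> 'b"
    and A :: 'o and \<pi> :: "'p \<Rightarrow> 'a"
    and M\<^sub>1 M\<^sub>2 M\<^sub>3 :: 'p and f g :: 'b
  assumes "pivotal_finite_tensor_category C j"
    and "pivotal_exact_module_category C j M S \<dd> \<zeta> j'"
    and "is_end C M A \<pi>"
    and "short_exact M M\<^sub>1 f M\<^sub>2 g M\<^sub>3"
  shows "internal_character C M \<dd> j' \<pi> M\<^sub>2 =
    internal_character C M \<dd> j' \<pi> M\<^sub>1 \<^bold>+\<^bsub>C\<^esub> internal_character C M \<dd> j' \<pi> M\<^sub>3"
proof -
  interpret pivotal_exact_module_category C j M S \<dd> \<zeta> j' by fact
  show ?thesis by (rule internal_character_additive[OF module_pivotal_nat_iso assms(3,4)])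
qed

end
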